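(* Let $X=AE$, where $E$ is an exponential random variable and $A$ is a positive random variable independent of $E$ (the instantaneous channel power of a spherically invariant random process fading model). Then: (1) $X$ is infinitely divisible; (2) if $A$ is a generalized gamma convolution, then $X$ is a generalized gamma convolution; (3) if $A$ is a hyperbolically completely monotone random variable, then $X$ is a hyperbolically completely monotone random variable.
   Context: A nonnegative random variable $X$ is infinitely divisible if for every integer $n\ge1$ it has the same distribution as a sum of $n$ independent identically distributed random variables. A nonnegative random variable $X$ is a generalized gamma convolution (GGC) if there are $a\ge 0$ and a nonnegative measure $\mu$ on $(0,\infty)$ with $\int_{(0,1]}|\log u|\,\mu(du)+\int_{(1,\infty)}u^{-1}\,\mu(du)<\infty$ such that $\mathbb{E}[e^{-sX}]=\exp\left(-as-\int_0^\infty\log(1+s/u)\,\mu(du)\right)$ for all $s\ge0$. A function $g:(0,\infty)\to[0,\infty)$ is hyperbolically completely monotone (HCM) if for each $u>0$ there is a nonnegative measure $K(\cdot\,;u)$ on $[0,\infty)$ with $g(uv)g(u/v)=\int_0^\infty e^{-\lambda u(v+v^{-1})}K(d\lambda;u)$ for all $v>0$. A random variable is HCM if it has a probability density on $(0,\infty)$ that is an HCM function. *)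

theory Defs
  imports "HOL-Probability.Probability"
begin

definition nonneg_random_variable :: "'a measure \<Rightarrow> ('a \<Rightarrow> real) \<Rightarrow> bool" where
  "nonneg_random_variable M X \<longleftrightarrow> X \<in> borel_measurable M \<and> (AE \<omega> in M. 0 \<le> X \<omega>)"

(* The i.i.d. summands may live on a probability space other than M. Restricting the sample
   space to the type nat => real loses nothing, since any finite family of real random variables
   has a copy with the same joint law on a product space over this type. *)
definition infinitely_divisible_rv :: "'a measure \<Rightarrow> ('a \<Rightarrow> real) \<Rightarrow> bool" where
  "infinitely_divisible_rv M X \<longleftrightarrow>
     nonneg_random_variable M X \<and>
     (\<forall>n\<ge>1. \<exists>(N :: (nat \<Rightarrow> real) measure) (Y :: nat \<Rightarrow> (nat \<Rightarrow> real) \<Rightarrow> real).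
        prob_space N \<and>
        prob_space.indep_vars N (\<lambda>_. borel) Y {..<n} \<and>
        (\<forall>i<n. \<forall>j<n. distr N borel (Y i) = distr N borel (Y j)) \<and>
        distr M borel X = distr N borel (\<lambda>\<omega>. \<Sum>i<n. Y i \<omega>))"

(* The explicit integrability clause excludes the Bochner convention that a divergent integral
   is 0. It adds no restriction: the expectation is positive, so the exponent must be finite. *)
definition GGC_rv :: "'a measure \<Rightarrow> ('a \<Rightarrow> real) \<Rightarrow> bool" where
  "GGC_rv M X \<longleftrightarrow>
     nonneg_random_variable M X \<and>
     (\<exists>(a::real) (\<mu> :: real measure). 0 \<le> a \<and>
        sets \<mu> = sets (restrict_space borel {0<..}) \<and>
        (\<integral>\<^sup>+u\<in>{0<..1}. ennreal \<bar>ln u\<bar> \<partial>\<mu>) + (\<integral>\<^sup>+u\<in>{1<..}. ennreal (1 / u) \<partial>\<mu>) < \<infinity> \<and>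
        (\<forall>s\<ge>0. integrable \<mu> (\<lambda>u. ln (1 + s / u)) \<and>
           (\<integral>\<omega>. exp (- s * X \<omega>) \<partial>M) = exp (- a * s - (\<integral>u. ln (1 + s / u) \<partial>\<mu>))))"

(* Only the values of g on the positive half-line matter. *)
definition HCM :: "(real \<Rightarrow> real) \<Rightarrow> bool" where
  "HCM g \<longleftrightarrow>
     (\<forall>x>0. 0 \<le> g x) \<and>
     (\<forall>u>0. \<exists>K :: real measure. sets K = sets (restrict_space borel {0..}) \<and>
        (\<forall>v>0. ennreal (g (u * v) * g (u / v)) =
           (\<integral>\<^sup>+k. ennreal (exp (- k * u * (v + 1 / v))) \<partial>K)))"

definition HCM_rv :: "'a measure \<Rightarrow> ('a \<Rightarrow> real) \<Rightarrow> bool" where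
  "HCM_rv M X \<longleftrightarrow>
     (\<exists>g. HCM g \<and> distributed M lborel X (\<lambda>x. ennreal (indicator {0<..} x * g x)))"

end

(*
  Everything is reduced to power series with nonnegative coefficients. A function psi on [0, oo) is
  completely monotone iff psi (c (1 - z)) is such a series in z in [0, 1] for every c > 0, a property which
  is visibly stable under products, mixtures and exponentials; Bernstein's theorem and uniqueness
  of Laplace transforms turn it back into statements about measures.

  (1) E exp (- s X) = E (l / (l + s A)). At s = c (1 - z) its coefficients form a moment sequence,
  hence are log-convex; by Kaluza's lemma the series is g / (1 - B z) with B a series with
  nonnegative coefficients and B 1 < 1, so all its positive powers are completely monotone.

  (3) In logarithmic coordinates the density of X is an integral of G a exp (- l exp (x - a)) over
  the real line. The substitution a = s + t, b = s - t in the product of two such integrals, and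
  a translation of t, show that the product depends on cosh of the difference in a completely
  monotone way.

  (2) The Laplace transform of A is hyperbolically completely monotone, and by the argument of (3)
  so is f, the one of X. Now f extends to the plane slit along the negative axis, has no zero
  there, and f (u v) f (u / v) is, as a function of y = v + 1 / v - 2, analytic for |y| < 4 with
  Taylor coefficients of alternating sign at small c > 0. It therefore decreases on (-4, 0), where
  it equals |f (u e^(i theta))|^2 with y = 2 cos theta - 2; so this modulus increases with theta in
  [0, pi), that is, P = - z f' / f maps the upper half-plane into its closure. The
  Cayley transform makes P a typically real function on the disc; its Herglotz representation,
  integrated once, is the logarithm of the Laplace transform of a generalized gamma convolution.
*)
theory Submission
  imports Defs "HOL-Complex_Analysis.Complex_Analysis" "HOL-Real_Asymp.Real_Asymp"
begin

section \<open>Power series with nonnegative coefficients\<close>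

text \<open>Infinite divisibility asks for roots of a transform, and signs of derivatives behave
  badly under roots; coefficients do not. Keeping the endpoint z = 1 makes them summable, so every
  representing measure is finite and the value at z = 1 dominates the whole family. The measures in
  the definition of HCM can be infinite, which is why v + 1 / v is shifted by 2. The argument for
  densities serves Laplace transforms too because f is (l / s) times the integral of phi (y) exp (-
  l y / s), where phi is the transform of A: in logarithmic coordinates this is the same kernel. For
  a general HCM transform, continuation to the slit plane and absence of zeros are difficulties of
  their own. Here f is a mixture of 1 / (1 + z b), which continues explicitly, and off the real axis
  the imaginary parts of these terms have one sign, so nothing cancels. The representation on the
  disc gives P only up to the constant P 1. A may have infinite mean, so f may have infinite slope
  at 0, but s f' (s) / f (s) still tends to 0 with s, and this determines the constant.\<close>

definition nonneg_ps :: "(real \<Rightarrow> real) \<Rightarrow> bool" where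
  "nonneg_ps G \<longleftrightarrow> (\<exists>d. (\<forall>n. 0 \<le> d n) \<and> (\<forall>z\<in>{0..1}. (\<lambda>n. d n * z ^ n) sums G z))"

lemma nonneg_psI:
  assumes "\<And>n. 0 \<le> d n" "\<And>z. 0 \<le> z \<Longrightarrow> z \<le> 1 \<Longrightarrow> (\<lambda>n. d n * z ^ n) sums G z"
  shows "nonneg_ps G"
  unfolding nonneg_ps_def using assms by (intro exI[of _ d]) auto

lemma nonneg_psE:
  assumes "nonneg_ps G"
  obtains d where "\<And>n. 0 \<le> d n" "\<And>z. 0 \<le> z \<Longrightarrow> z \<le> 1 \<Longrightarrow> (\<lambda>n. d n * z ^ n) sums G z"
proof -
  obtain d where "\<forall>n. 0 \<le> d n" "\<forall>z\<in>{0..1}. (\<lambda>n. d n * z ^ n) sums G z"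
    using assms unfolding nonneg_ps_def by blast
  then show ?thesis by (intro that[of d]) auto
qed

lemma nonneg_ps_cong:
  assumes "\<And>z. 0 \<le> z \<Longrightarrow> z \<le> 1 \<Longrightarrow> F z = G z" "nonneg_ps F"
  shows "nonneg_ps G"
proof -
  obtain d where d: "\<And>n. 0 \<le> d n" "\<And>z. 0 \<le> z \<Longrightarrow> z \<le> 1 \<Longrightarrow> (\<lambda>n. d n * z ^ n) sums F z"
    using assms(2) by (rule nonneg_psE) blast
  show ?thesis
    by (rule nonneg_psI[of d]) (use d assms(1) in auto)
qed

lemma nonneg_ps_monom: "0 \<le> a \<Longrightarrow> nonneg_ps (\<lambda>z. a * z ^ k)"
proof (rule nonneg_psI[of "\<lambda>n. if n = k then a else 0"])
  fix z :: real
  have "(\<lambda>n. if n = k then a * z ^ n else 0) sums (a * z ^ k)"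
    by (rule sums_single)
  then show "(\<lambda>n. (if n = k then a else 0) * z ^ n) sums (a * z ^ k)"
    by (rule back_subst[of "\<lambda>f. f sums _"]) auto
qed auto

lemma nonneg_ps_const: "0 \<le> a \<Longrightarrow> nonneg_ps (\<lambda>_. a)"
  using nonneg_ps_monom[of a 0] by simp

lemma nonneg_ps_nonneg:
  assumes "nonneg_ps G" "0 \<le> z" "z \<le> 1"
  shows "0 \<le> G z"
proof -
  obtain d where d: "\<And>n. 0 \<le> d n" "\<And>z. 0 \<le> z \<Longrightarrow> z \<le> 1 \<Longrightarrow> (\<lambda>n. d n * z ^ n) sums G z"
    using assms(1) by (rule nonneg_psE) blast
  show ?thesis
    by (rule sums_le[OF _ sums_zero d(2)]) (use d assms in auto)
qed

lemma nonneg_ps_mono: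
  assumes "nonneg_ps G" "0 \<le> y" "y \<le> z" "z \<le> 1"
  shows "G y \<le> G z"
proof -
  obtain d where d: "\<And>n. 0 \<le> d n" "\<And>z. 0 \<le> z \<Longrightarrow> z \<le> 1 \<Longrightarrow> (\<lambda>n. d n * z ^ n) sums G z"
    using assms(1) by (rule nonneg_psE) blast
  show ?thesis
    by (rule sums_le[OF _ d(2)[of y] d(2)[of z]])
      (use d assms in \<open>auto intro!: mult_left_mono power_mono\<close>)
qed

lemma nonneg_ps_mult:
  assumes "nonneg_ps F" "nonneg_ps G"
  shows "nonneg_ps (\<lambda>z. F z * G z)"
proof -
  obtain d where d: "\<And>n. 0 \<le> d n" "\<And>z. 0 \<le> z \<Longrightarrow> z \<le> 1 \<Longrightarrow> (\<lambda>n. d n * z ^ n) sums F z"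
    using assms(1) by (rule nonneg_psE) blast
  obtain e where e: "\<And>n. 0 \<le> e n" "\<And>z. 0 \<le> z \<Longrightarrow> z \<le> 1 \<Longrightarrow> (\<lambda>n. e n * z ^ n) sums G z"
    using assms(2) by (rule nonneg_psE) blast
  show ?thesis
  proof (rule nonneg_psI[of "\<lambda>n. \<Sum>i\<le>n. d i * e (n - i)"])
    show "0 \<le> (\<Sum>i\<le>n. d i * e (n - i))" for n
      using d e by (auto intro!: sum_nonneg)
    fix z :: real assume z: "0 \<le> z" "z \<le> 1"
    have "summable (\<lambda>n. norm (d n * z ^ n))" "summable (\<lambda>n. norm (e n * z ^ n))"
      using sums_summable[OF d(2)[OF z]] sums_summable[OF e(2)[OF z]] d(1) e(1) z by auto
    from Cauchy_product_sums[OF this]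
    have "(\<lambda>k. \<Sum>i\<le>k. d i * z ^ i * (e (k - i) * z ^ (k - i))) sums (F z * G z)"
      using sums_unique[OF d(2)[OF z]] sums_unique[OF e(2)[OF z]] by simp
    moreover have "(\<Sum>i\<le>k. d i * z ^ i * (e (k - i) * z ^ (k - i))) = (\<Sum>i\<le>k. d i * e (k - i)) * z ^ k" for k
      unfolding sum_distrib_right
      by (rule sum.cong) (auto simp: mult_ac power_add[symmetric] intro!: arg_cong[of _ _ "\<lambda>x. _ * x"])
    ultimately show "(\<lambda>n. (\<Sum>i\<le>n. d i * e (n - i)) * z ^ n) sums (F z * G z)"
      by simp
  qed
qed

lemma nonneg_ps_cmult: "nonneg_ps G \<Longrightarrow> 0 \<le> a \<Longrightarrow> nonneg_ps (\<lambda>z. a * G z)"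
  using nonneg_ps_mult[OF nonneg_ps_const] by simp

lemma nonneg_ps_power: "nonneg_ps G \<Longrightarrow> nonneg_ps (\<lambda>z. G z ^ k)"
  by (induction k) (auto intro: nonneg_ps_mult nonneg_ps_const)

text \<open>The coefficients are recovered successively as limits at \<open>0\<close>, so a pointwise choice of
  coefficients is automatically measurable in the parameter.\<close>

lemma powser_coeff_measurable:
  fixes d :: "'s \<Rightarrow> nat \<Rightarrow> real"
  assumes sums: "\<And>s z. s \<in> space M \<Longrightarrow> 0 \<le> z \<Longrightarrow> z \<le> 1 \<Longrightarrow> (\<lambda>n. d s n * z ^ n) sums G s z"
    and meas: "\<And>z. 0 \<le> z \<Longrightarrow> z \<le> 1 \<Longrightarrow> (\<lambda>s. G s z) \<in> borel_measurable M"
  shows "(\<lambda>s. d s n) \<in> borel_measurable M"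
proof (induction n rule: less_induct)
  case (less n)
  \<comment> \<open>Sample points tending to 0; the offset 2 keeps them strictly below 1, inside the
    disc of convergence.\<close>
  define e where "e m = 1 / real (m + 2)" for m
  have e: "0 < e m" "e m < 1" for m by (auto simp: e_def)
  have e0: "filterlim e (at 0) sequentially"
    unfolding e_def filterlim_at using LIMSEQ_inverse_real_of_nat_add[of 0]
    by (auto intro!: always_eventually real_tendsto_divide_at_top filterlim_tendsto_add_at_top filterlim_real_sequentially simp: filterlim_at_top_add_at_top
         intro: filterlim_compose[OF filterlim_real_sequentially filterlim_add_const_nat_at_top])
  show ?case
  proof (rule borel_measurable_LIMSEQ_real)
    fix s assume s: "s \<in> space M"
    have summ: "summable (\<lambda>k. d s (k + n) * z ^ k)" if "norm z < 1" for z
    proof -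
      have "summable (\<lambda>k. d s k * 1 ^ k)" using sums[OF s, of 1] by (auto intro: sums_summable)
      then have "summable (\<lambda>k. d s (k + n) * 1 ^ (k + n))" by (subst summable_iff_shift)
      then have "summable (\<lambda>k. d s (k + n) * 1 ^ k)" by simp
      from powser_inside[OF this, of z] that show ?thesis by simp
    qed
    have "((\<lambda>z. \<Sum>k. d s (k + n) * z ^ k) \<longlongrightarrow> d s (0 + n)) (at 0)"
      by (rule powser_limit_0[of 1]) (use summ summable_sums in auto)
    from filterlim_compose[OF this e0]
    have "(\<lambda>m. \<Sum>k. d s (k + n) * e m ^ k) \<longlonglongrightarrow> d s n" by simp
    \<comment> \<open>The tail series, whose limit at 0 is the coefficient of index n, is expressed
      through G and the lower coefficients, which are measurable by induction.\<close>
    moreover have "(\<Sum>k. d s (k + n) * e m ^ k) = (G s (e m) - (\<Sum>k<n. d s k * e m ^ k)) / e m ^ n" for m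
    proof -
      have *: "(\<lambda>n. d s n * e m ^ n) sums G s (e m)" using sums[OF s, of "e m"] e[of m] by auto
      have "G s (e m) = (\<Sum>k. d s (k + n) * e m ^ (k + n)) + (\<Sum>k<n. d s k * e m ^ k)"
        using suminf_split_initial_segment[OF sums_summable[OF *], of n] sums_unique[OF *] by simp
      also have "(\<Sum>k. d s (k + n) * e m ^ (k + n)) = (\<Sum>k. d s (k + n) * e m ^ k) * e m ^ n"
        using e[of m] by (subst suminf_mult2[OF summ]) (auto simp: power_add mult_ac)
      finally show ?thesis using e[of m] by (simp add: field_simps)
    qed
    ultimately show "(\<lambda>m. (G s (e m) - (\<Sum>k<n. d s k * e m ^ k)) / e m ^ n) \<longlonglongrightarrow> d s n" by simp
  next
    fix m
    have [measurable]: "(\<lambda>s. G s (e m)) \<in> borel_measurable M" using meas[of "e m"] e[of m] by auto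
    have "(\<lambda>s. \<Sum>k<n. d s k * e m ^ k) \<in> borel_measurable M"
      using less by (intro borel_measurable_sum borel_measurable_times) auto
    then show "(\<lambda>s. (G s (e m) - (\<Sum>k<n. d s k * e m ^ k)) / e m ^ n) \<in> borel_measurable M"
      by simp
  qed
qed

text \<open>Sums and integrals are interchanged in \<open>ennreal\<close>, by monotone convergence;
  this carries the resulting identity back to a real series.\<close>

lemma sums_of_ennreal:
  assumes "\<And>n. 0 \<le> f n" "0 \<le> x" "(\<Sum>n. ennreal (f n)) = ennreal x"
  shows "f sums x"
proof -
  have s: "summable f" using assms by (intro summable_suminf_not_top) auto
  then have "ennreal (suminf f) = ennreal x" using suminf_ennreal2[OF assms(1) s] assms(3) by (simp only:)
  then have "suminf f = x" using ennreal_inj[OF suminf_nonneg[OF s assms(1)] assms(2)] by simp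
  then show ?thesis using s summable_sums by blast
qed

text \<open>Monotonicity in z: the value at z = 1 is an integrable majorant.\<close>

lemma nonneg_ps_integrable:
  assumes ps: "\<And>s. s \<in> space M \<Longrightarrow> nonneg_ps (G s)"
    and meas: "\<And>z. 0 \<le> z \<Longrightarrow> z \<le> 1 \<Longrightarrow> (\<lambda>s. G s z) \<in> borel_measurable M"
    and int: "integrable M (\<lambda>s. G s 1)" and z: "0 \<le> z" "z \<le> 1"
  shows "integrable M (\<lambda>s. G s z)"
  by (rule Bochner_Integration.integrable_bound[OF int meas[OF z]])
    (use ps nonneg_ps_mono nonneg_ps_nonneg z in \<open>auto intro!: AE_I2\<close>)

text \<open>The coefficients of a mixture are the integrals of the coefficients. These may be chosen
  point by point, since \<open>powser_coeff_measurable\<close> makes any choice measurable, and each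
  is bounded by the integrable value at z = 1.\<close>

lemma nonneg_ps_integral:
  assumes ps: "\<And>s. s \<in> space M \<Longrightarrow> nonneg_ps (G s)"
    and meas: "\<And>z. 0 \<le> z \<Longrightarrow> z \<le> 1 \<Longrightarrow> (\<lambda>s. G s z) \<in> borel_measurable M"
    and int: "integrable M (\<lambda>s. G s 1)"
  shows "nonneg_ps (\<lambda>z. \<integral>s. G s z \<partial>M)"
proof -
  have "\<forall>s\<in>space M. \<exists>d. (\<forall>n. 0 \<le> d n) \<and> (\<forall>z\<in>{0..1}. (\<lambda>n. d n * z ^ n) sums G s z)"
    using ps unfolding nonneg_ps_def by auto
  then obtain d where d: "\<And>s n. s \<in> space M \<Longrightarrow> 0 \<le> d s n"
     "\<And>s z. s \<in> space M \<Longrightarrow> 0 \<le> z \<Longrightarrow> z \<le> 1 \<Longrightarrow> (\<lambda>n. d s n * z ^ n) sums G s z"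
    by (metis atLeastAtMost_iff)
  have [measurable]: "(\<lambda>s. d s n) \<in> borel_measurable M" for n
    by (rule powser_coeff_measurable[OF d(2) meas])
  have dle: "d s n \<le> G s 1" if "s \<in> space M" for s n
    using sum_le_suminf[OF sums_summable[OF d(2)[OF that, of 1]], of "{n}"] d(1)[OF that] sums_unique[OF d(2)[OF that, of 1]] by auto
  have di: "integrable M (\<lambda>s. d s n)" for n
    by (rule Bochner_Integration.integrable_bound[OF int]) (use d dle nonneg_ps_nonneg[OF ps, of _ 1] in \<open>auto intro!: AE_I2\<close>)
  show ?thesis
  proof (rule nonneg_psI[of "\<lambda>n. \<integral>s. d s n \<partial>M"])
    show "0 \<le> (\<integral>s. d s n \<partial>M)" for n using d(1) by (intro integral_nonneg_AE AE_I2) auto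
    fix z :: real assume z: "0 \<le> z" "z \<le> 1"
    show "(\<lambda>n. (\<integral>s. d s n \<partial>M) * z ^ n) sums (\<integral>s. G s z \<partial>M)"
    proof (rule sums_of_ennreal)
      show "0 \<le> (\<integral>s. d s n \<partial>M) * z ^ n" for n using d(1) z by (intro mult_nonneg_nonneg integral_nonneg_AE AE_I2) auto
      show "0 \<le> (\<integral>s. G s z \<partial>M)" using nonneg_ps_nonneg[OF ps _ ] z by (intro integral_nonneg_AE AE_I2) auto
      have "ennreal (\<integral>s. G s z \<partial>M) = (\<integral>\<^sup>+s. ennreal (G s z) \<partial>M)"
        by (rule nn_integral_eq_integral[symmetric, OF nonneg_ps_integrable[OF ps meas int z]])
          (use nonneg_ps_nonneg[OF ps] z in \<open>auto intro!: AE_I2\<close>)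
      also have "\<dots> = (\<integral>\<^sup>+s. (\<Sum>n. ennreal (d s n * z ^ n)) \<partial>M)"
        by (rule nn_integral_cong) (use d z in \<open>auto intro!: suminf_ennreal_eq[symmetric]\<close>)
      also have "\<dots> = (\<Sum>n. \<integral>\<^sup>+s. ennreal (d s n * z ^ n) \<partial>M)"
        by (rule nn_integral_suminf) measurable
      also have "\<dots> = (\<Sum>n. ennreal ((\<integral>s. d s n \<partial>M) * z ^ n))"
      proof (rule suminf_cong)
        fix n
        have "(\<integral>\<^sup>+s. ennreal (d s n * z ^ n) \<partial>M) = ennreal (\<integral>s. d s n * z ^ n \<partial>M)"
          by (rule nn_integral_eq_integral) (use di d z in \<open>auto intro!: AE_I2\<close>)
        then show "(\<integral>\<^sup>+s. ennreal (d s n * z ^ n) \<partial>M) = ennreal ((\<integral>s. d s n \<partial>M) * z ^ n)" by simp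
      qed
      finally show "(\<Sum>n. ennreal ((\<integral>s. d s n \<partial>M) * z ^ n)) = ennreal (\<integral>s. G s z \<partial>M)" by simp
    qed
  qed
qed

text \<open>A series is an integral for counting measure, so the mixture lemma covers infinite sums
  and with them composition with exp and ln.\<close>

lemma nonneg_ps_suminf:
  assumes ps: "\<And>k. nonneg_ps (G k)" and sm: "\<And>z. 0 \<le> z \<Longrightarrow> z \<le> 1 \<Longrightarrow> (\<lambda>k::nat. G k z) sums H z"
  shows "nonneg_ps H"
proof -
  have s: "summable (\<lambda>k. norm (G k z))" if "0 \<le> z" "z \<le> 1" for z
    using sums_summable[OF sm[OF that]] nonneg_ps_nonneg[OF ps that] by simp
  have "nonneg_ps (\<lambda>z. \<integral>k. G k z \<partial>count_space UNIV)"
    by (rule nonneg_ps_integral) (use ps s[of 1] in \<open>auto simp: integrable_count_space_nat_iff\<close>)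
  then show ?thesis
    by (rule nonneg_ps_cong[rotated])
      (use s sm in \<open>auto simp: integral_count_space_nat integrable_count_space_nat_iff sums_unique[symmetric]\<close>)
qed

lemma nonneg_ps_exp:
  assumes "nonneg_ps G"
  shows "nonneg_ps (\<lambda>z. exp (G z))"
proof (rule nonneg_ps_suminf[of "\<lambda>k z. inverse (fact k) * G z ^ k"])
  show "nonneg_ps (\<lambda>z. inverse (fact k) * G z ^ k)" for k
    by (intro nonneg_ps_cmult nonneg_ps_power assms) simp
  show "(\<lambda>k. inverse (fact k) * G z ^ k) sums exp (G z)" for z
    using exp_converges[of "G z"] by (simp add: divide_inverse mult.commute)
qed

section \<open>Logarithms and Kaluza's lemma\<close>

lemma neg_ln_one_minus_sums:
  assumes "0 \<le> x" "x < (1::real)"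
  shows "(\<lambda>k. x ^ Suc k / real (Suc k)) sums (- ln (1 - x))"
proof -
  have "(\<lambda>n. - ((- (- x)) ^ n) / of_nat n) sums ln (1 + (-x))"
    by (rule ln_series') (use assms in auto)
  from sums_minus[OF this] have "(\<lambda>n. x ^ n / real n) sums (- ln (1 - x))" by simp
  then show ?thesis by (subst sums_Suc_iff) simp
qed

text \<open>B 1 < 1 keeps the logarithmic series convergent up to z = 1. Together with
  \<open>nonneg_ps_exp\<close> this yields every positive power of 1 / (1 - B z).\<close>

lemma nonneg_ps_neg_ln:
  assumes "nonneg_ps B" "B 1 < 1"
  shows "nonneg_ps (\<lambda>z. - ln (1 - B z))"
proof (rule nonneg_ps_suminf[of "\<lambda>k z. (1 / real (Suc k)) * B z ^ Suc k"])
  show "nonneg_ps (\<lambda>z. (1 / real (Suc k)) * B z ^ Suc k)" for k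
    by (intro nonneg_ps_cmult nonneg_ps_power assms) simp
  show "(\<lambda>k. (1 / real (Suc k)) * B z ^ Suc k) sums (- ln (1 - B z))" if "0 \<le> z" "z \<le> 1" for z
    using neg_ln_one_minus_sums[of "B z"] nonneg_ps_nonneg[OF assms(1) that]
      nonneg_ps_mono[OF assms(1), of z 1] that assms(2) by simp
qed

text \<open>The quotient 1 - g 0 / G has coefficients b whose convolution with g is g, except at
  index 0, where it is 0. Log-convexity says that g (Suc m - k) / g (m - k) is at most g (Suc m) / g
  m. Inserted in the recursion at index Suc m, with b k nonnegative for k up to m, it bounds all
  terms but the last by g (Suc m), and what remains for b (Suc m) is nonnegative.\<close>

lemma kaluza:
  fixes g :: "nat \<Rightarrow> real"
  assumes pos: "\<And>n. 0 < g n" and lc: "\<And>n. g (Suc n) ^ 2 \<le> g n * g (Suc (Suc n))"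
    and sm: "\<And>z. 0 \<le> z \<Longrightarrow> z \<le> 1 \<Longrightarrow> (\<lambda>n. g n * z ^ n) sums G z"
  shows "nonneg_ps (\<lambda>z. 1 - g 0 / G z)"
proof -
  \<comment> \<open>The inversion takes place among formal power series, where a nonzero constant
    term suffices; convergence is a separate matter.\<close>
  have "\<exists>b. \<forall>n. (\<Sum>k\<le>n. b k * g (n - k)) = (if n = 0 then 0 else g n)"
  proof -
    define A where "A = Abs_fps g"
    define B where "B = 1 - fps_const (g 0) * inverse A"
    have "inverse A * A = 1"
      by (rule inverse_mult_eq_1) (use pos[of 0] in \<open>simp add: A_def\<close>)
    then have BA: "B * A = A - fps_const (g 0)"
      by (simp add: B_def algebra_simps)
    have "(\<Sum>k\<le>n. fps_nth B k * g (n - k)) = (if n = 0 then 0 else g n)" for n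
      using arg_cong[OF BA, of "\<lambda>f. fps_nth f n"] by (simp add: fps_mult_nth A_def atMost_atLeast0)
    then show ?thesis by blast
  qed
  then obtain b where b: "\<And>n. (\<Sum>k\<le>n. b k * g (n - k)) = (if n = 0 then 0 else g n)" by blast
  have b0: "b 0 = 0" using b[of 0] pos[of 0] by simp
  \<comment> \<open>Log-convexity means that successive ratios do not decrease; the ratio at m is
    compared with the one at m + j.\<close>
  have ratio: "g (Suc m) * g (m + j) \<le> g (m + Suc j) * g m" for m j
  proof (induction j)
    case (Suc j)
    have "g (Suc m) * g (m + Suc j) * g (m + j) \<le> g (m + Suc j) * g (m + Suc j) * g m"
      using mult_left_mono[OF Suc, of "g (m + Suc j)"] pos[of "m + Suc j"] by (simp add: mult_ac)
    also have "\<dots> \<le> g (m + j) * g (m + Suc (Suc j)) * g m"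
      using mult_right_mono[OF lc[of "m + j"], of "g m"] pos[of m] by (simp add: power2_eq_square)
    finally show ?case using pos[of "m + j"] by (simp add: mult_ac)
  qed simp
  have bnn: "0 \<le> b n" for n
  proof (induction n rule: less_induct)
    case (less n)
    show ?case
    proof (cases n)
      case (Suc m)
      have "(\<Sum>k\<le>m. b k * g (Suc m - k)) * g m \<le> g (Suc m) * (\<Sum>k\<le>m. b k * g (m - k))"
        unfolding sum_distrib_right sum_distrib_left
      proof (rule sum_mono)
        fix k assume k: "k \<in> {..m}"
        have "g (Suc (m - k)) * g (m - k + k) \<le> g (m - k + Suc k) * g (m - k)" by (rule ratio)
        then have "g (Suc m - k) * g m \<le> g (Suc m) * g (m - k)" using k by (simp add: Suc_diff_le)
        from mult_left_mono[OF this, of "b k"] less[of k] k Suc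
        show "b k * g (Suc m - k) * g m \<le> g (Suc m) * (b k * g (m - k))" by (simp add: mult_ac)
      qed
      also have "\<dots> \<le> g (Suc m) * g m" using b[of m] pos[of "Suc m"] pos[of m] by auto
      finally have "(\<Sum>k\<le>m. b k * g (Suc m - k)) \<le> g (Suc m)" using pos[of m] by simp
      moreover have "(\<Sum>k\<le>m. b k * g (Suc m - k)) + b (Suc m) * g 0 = g (Suc m)"
        using b[of "Suc m"] by simp
      ultimately have "0 \<le> b (Suc m) * g 0" by linarith
      then show ?thesis using pos[of 0] Suc by (simp add: zero_le_mult_iff)
    qed (simp add: b0)
  qed
  \<comment> \<open>A single nonnegative term of the convolution; summability of g at z = 1 thus
    passes to b.\<close>
  have ble: "b n * g 0 \<le> g n" for n
  proof -
    have "b n * g (n - n) \<le> (\<Sum>k\<le>n. b k * g (n - k))"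
      by (rule member_le_sum) (use bnn pos[THEN less_imp_le] in auto)
    then show ?thesis using b[of n] pos[of n] by (auto split: if_splits)
  qed
  have bs: "summable (\<lambda>n. b n * z ^ n)" if "0 \<le> z" "z \<le> 1" for z
  proof (rule summable_comparison_test'[of "\<lambda>n. g n * z ^ n / g 0" 0])
    show "summable (\<lambda>n. g n * z ^ n / g 0)" using sums_summable[OF sm[OF that]] by (rule summable_divide)
    show "norm (b n * z ^ n) \<le> g n * z ^ n / g 0" for n
      using mult_right_mono[OF ble[of n], of "z ^ n"] that bnn[of n] pos[of 0] by (simp add: field_simps)
  qed
  show ?thesis
  proof (rule nonneg_psI[OF bnn])
    fix z :: real assume z: "0 \<le> z" "z \<le> 1"
    have "(\<lambda>k. \<Sum>i\<le>k. b i * z ^ i * (g (k - i) * z ^ (k - i))) sums ((\<Sum>k. b k * z ^ k) * (\<Sum>k. g k * z ^ k))"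
      by (rule Cauchy_product_sums)
        (use bs[OF z] sums_summable[OF sm[OF z]] bnn pos[THEN less_imp_le] z in \<open>auto\<close>)
    moreover have "(\<Sum>i\<le>k. b i * z ^ i * (g (k - i) * z ^ (k - i))) = (if k = 0 then 0 else g k * z ^ k)" for k
    proof -
      have "(\<Sum>i\<le>k. b i * z ^ i * (g (k - i) * z ^ (k - i))) = (\<Sum>i\<le>k. b i * g (k - i)) * z ^ k"
        unfolding sum_distrib_right
        by (rule sum.cong) (auto simp: mult_ac power_add[symmetric] intro!: arg_cong[of _ _ "\<lambda>x. _ * x"])
      then show ?thesis using b[of k] by simp
    qed
    ultimately have 1: "(\<lambda>k. if k = 0 then 0 else g k * z ^ k) sums ((\<Sum>k. b k * z ^ k) * G z)"
      using sums_unique[OF sm[OF z]] by simp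
    have "(\<lambda>k. g k * z ^ k - (if k = 0 then g 0 * z ^ 0 else 0)) sums (G z - g 0 * z ^ 0)"
      by (intro sums_diff sm z sums_single)
    moreover have "g k * z ^ k - (if k = 0 then g 0 * z ^ 0 else 0) = (if k = 0 then 0 else g k * z ^ k)" for k
      by simp
    ultimately have "(\<Sum>k. b k * z ^ k) * G z = G z - g 0" using 1 sums_unique2 by fastforce
    moreover have "G z > 0"
    proof -
      have "g 0 * z ^ 0 \<le> G z"
        using sum_le_suminf[OF sums_summable[OF sm[OF z]], of "{0}"] sums_unique[OF sm[OF z]] pos[THEN less_imp_le] z by simp
      then show ?thesis using pos[of 0] by simp
    qed
    ultimately have "(\<Sum>k. b k * z ^ k) = 1 - g 0 / G z" by (simp add: field_simps)
    then show "(\<lambda>n. b n * z ^ n) sums (1 - g 0 / G z)" using summable_sums[OF bs[OF z]] by simp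
  qed
qed

section \<open>Complete monotonicity and Bernstein's theorem\<close>

text \<open>Allowing \<open>z = 1\<close> makes \<open>\<psi>\<close> right-continuous at \<open>0\<close>; only the values on the half-line \<open>{0..}\<close> matter.\<close>

definition compl_mono :: "(real \<Rightarrow> real) \<Rightarrow> bool" where
  "compl_mono \<psi> \<longleftrightarrow> (\<forall>c>0. nonneg_ps (\<lambda>z. \<psi> (c * (1 - z))))"

lemma compl_monoD: "compl_mono \<psi> \<Longrightarrow> 0 < c \<Longrightarrow> nonneg_ps (\<lambda>z. \<psi> (c * (1 - z)))"
  by (simp add: compl_mono_def)

lemma compl_mono_cong: "(\<And>s. 0 \<le> s \<Longrightarrow> \<phi> s = \<psi> s) \<Longrightarrow> compl_mono \<phi> \<Longrightarrow> compl_mono \<psi>"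
  unfolding compl_mono_def
proof (intro allI impI)
  fix c :: real assume eq: "\<And>s. 0 \<le> s \<Longrightarrow> \<phi> s = \<psi> s" and "\<forall>c>0. nonneg_ps (\<lambda>z. \<phi> (c * (1 - z)))" "0 < c"
  then have "nonneg_ps (\<lambda>z. \<phi> (c * (1 - z)))" by blast
  then show "nonneg_ps (\<lambda>z. \<psi> (c * (1 - z)))"
    by (rule nonneg_ps_cong[rotated]) (use eq \<open>0 < c\<close> in simp)
qed

lemma compl_mono_nonneg:
  assumes "compl_mono \<psi>" "0 \<le> s"
  shows "0 \<le> \<psi> s"
proof -
  have "0 \<le> \<psi> ((s + 1) * (1 - 1 / (s + 1)))"
    by (rule nonneg_ps_nonneg[OF compl_monoD[OF assms(1)]]) (use assms(2) in auto)
  moreover have "(s + 1) * (1 - 1 / (s + 1)) = s" using assms(2) by (simp add: right_diff_distrib)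
  ultimately show ?thesis by simp
qed

lemma compl_mono_antimono:
  assumes "compl_mono \<psi>" "0 \<le> s" "s \<le> t"
  shows "\<psi> t \<le> \<psi> s"
proof -
  have "\<psi> ((t + 1) * (1 - 1 / (t + 1))) \<le> \<psi> ((t + 1) * (1 - (t + 1 - s) / (t + 1)))"
    by (rule nonneg_ps_mono[OF compl_monoD[OF assms(1)]]) (use assms in \<open>auto simp: field_simps\<close>)
  moreover have "(t + 1) * (1 - 1 / (t + 1)) = t"
    using assms by (auto simp: right_diff_distrib)
  moreover have "(t + 1) * (1 - (t + 1 - s) / (t + 1)) = s"
    using assms by (simp add: divide_simps)
  ultimately show ?thesis by simp
qed

lemma compl_mono_continuous:
  assumes "compl_mono \<psi>" "0 < s"
  shows "isCont \<psi> s"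
proof -
  \<comment> \<open>With c = 2 s the point s sits at z = 1 / 2, in the interior of the disc of
    convergence.\<close>
  obtain d where d: "\<And>n. 0 \<le> d n" "\<And>z. 0 \<le> z \<Longrightarrow> z \<le> 1 \<Longrightarrow> (\<lambda>n. d n * z ^ n) sums \<psi> (2 * s * (1 - z))"
    using nonneg_psE[OF compl_monoD[OF assms(1), of "2 * s"]] assms(2) by auto
  have "isCont (\<lambda>z. \<Sum>n. d n * z ^ n) (1 / 2)"
    by (rule isCont_powser[of _ 1]) (use d(2)[of 1] sums_summable in auto)
  moreover have "1 / 2 = 1 - s / (2 * s)" using assms by simp
  ultimately have "isCont (\<lambda>z. \<Sum>n. d n * z ^ n) (1 - s / (2 * s))" by simp
  moreover have "isCont (\<lambda>t. 1 - t / (2 * s)) s" using assms by (intro continuous_intros) auto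
  ultimately have "isCont (\<lambda>t. \<Sum>n. d n * (1 - t / (2 * s)) ^ n) s"
    by (rule isCont_o2[rotated])
  moreover have "\<forall>\<^sub>F t in nhds s. (\<Sum>n. d n * (1 - t / (2 * s)) ^ n) = \<psi> t"
    using eventually_nhds_in_open[of "{0<..<2 * s}" s]
  proof (rule eventually_mono)
    fix t assume "t \<in> {0<..<2 * s}"
    then have "(\<lambda>n. d n * (1 - t / (2 * s)) ^ n) sums \<psi> (2 * s * (1 - (1 - t / (2 * s))))"
      by (intro d) auto
    then show "(\<Sum>n. d n * (1 - t / (2 * s)) ^ n) = \<psi> t" using assms by (simp add: sums_unique[symmetric])
  qed (use assms in auto)
  ultimately show ?thesis by (subst (asm) isCont_cong) auto
qed

text \<open>Abel's theorem for nonnegative coefficients: some partial sum at z = 1 already exceeds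
  any a < \<psi> 0, and it is a polynomial in s; the upper bound is monotonicity. In Bernstein's
  theorem this prevents mass from escaping.\<close>

lemma compl_mono_tendsto_0:
  assumes "compl_mono \<psi>"
  shows "(\<psi> \<longlongrightarrow> \<psi> 0) (at_right 0)"
proof -
  obtain d where d: "\<And>n. 0 \<le> d n" "\<And>z. 0 \<le> z \<Longrightarrow> z \<le> 1 \<Longrightarrow> (\<lambda>n. d n * z ^ n) sums \<psi> (1 * (1 - z))"
    using nonneg_psE[OF compl_monoD[OF assms, of 1]] by auto
  show ?thesis
  proof (rule order_tendstoI)
    fix a assume "a < \<psi> 0"
    moreover have "(\<lambda>n. \<Sum>k<n. d k) \<longlonglongrightarrow> \<psi> 0" using d(2)[of 1] by (simp add: sums_def)
    ultimately obtain n where n: "a < (\<Sum>k<n. d k)"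
      using eventually_happens'[OF sequentially_bot order_tendstoD(1)] by blast
    have "((\<lambda>s. \<Sum>k<n. d k * (1 - s) ^ k) \<longlongrightarrow> (\<Sum>k<n. d k * (1 - 0) ^ k)) (at_right 0)"
      by (intro tendsto_intros)
    then have "\<forall>\<^sub>F s in at_right 0. a < (\<Sum>k<n. d k * (1 - s) ^ k)"
      by (rule order_tendstoD) (use n in simp)
    moreover have "\<forall>\<^sub>F s::real in at_right 0. 0 < s \<and> s < 1"
      by (auto simp: eventually_at_right_field intro!: exI[of _ 1])
    ultimately show "\<forall>\<^sub>F s in at_right 0. a < \<psi> s"
    proof eventually_elim
      case (elim s)
      have "(\<Sum>k<n. d k * (1 - s) ^ k) \<le> \<psi> s"
        using sum_le_suminf[OF sums_summable[OF d(2)[of "1 - s"]], of "{..<n}"]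
          sums_unique[OF d(2)[of "1 - s"]] d(1) elim by simp
      then show ?case using elim by simp
    qed
  next
    fix a assume a: "\<psi> 0 < a"
    have "\<forall>\<^sub>F s::real in at_right 0. 0 < s"
      by (simp add: eventually_at_right_less)
    then show "\<forall>\<^sub>F s in at_right 0. \<psi> s < a"
      by eventually_elim (use a compl_mono_antimono[OF assms, of 0] in \<open>meson less_imp_le order.strict_trans1 order_refl\<close>)
  qed
qed

lemma compl_mono_mult: "compl_mono \<phi> \<Longrightarrow> compl_mono \<psi> \<Longrightarrow> compl_mono (\<lambda>s. \<phi> s * \<psi> s)"
  unfolding compl_mono_def by (auto intro: nonneg_ps_mult)

lemma compl_mono_const: "0 \<le> a \<Longrightarrow> compl_mono (\<lambda>_. a)"
  unfolding compl_mono_def by (auto intro: nonneg_ps_const)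

lemma compl_mono_exp_affine:
  assumes "0 \<le> b"
  shows "compl_mono (\<lambda>s. exp (- (a + b * s)))"
  unfolding compl_mono_def
proof (intro allI impI)
  fix c :: real assume "0 < c"
  then have "nonneg_ps (\<lambda>z. exp (- (a + b * c)) * exp (b * c * z ^ 1))"
    using assms by (intro nonneg_ps_cmult nonneg_ps_exp nonneg_ps_monom) auto
  then show "nonneg_ps (\<lambda>z. exp (- (a + b * (c * (1 - z)))))"
    by (rule nonneg_ps_cong[rotated]) (simp add: exp_add[symmetric] algebra_simps)
qed

lemma compl_mono_integral:
  assumes "\<And>x. x \<in> space M \<Longrightarrow> compl_mono (\<psi> x)" "\<And>s. 0 \<le> s \<Longrightarrow> (\<lambda>x. \<psi> x s) \<in> borel_measurable M"
    "integrable M (\<lambda>x. \<psi> x 0)"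
  shows "compl_mono (\<lambda>s. \<integral>x. \<psi> x s \<partial>M)"
  unfolding compl_mono_def
  by (intro allI impI nonneg_ps_integral) (use assms in \<open>auto simp: compl_mono_def\<close>)

text \<open>Tightness is immediate on a bounded interval. Weak convergence tests bounded functions
  only, so f is composed with the clamp \<open>cl\<close> onto [a, b], which changes no integral
  once the limit is known to live on [a, b] as well.\<close>

lemma helly_interval:
  fixes N :: "nat \<Rightarrow> real measure"
  assumes "\<And>n. real_distribution (N n)" and supp: "\<And>n. AE x in N n. x \<in> {a..b}" 
  obtains r \<nu> where "strict_mono (r :: nat \<Rightarrow> nat)" "real_distribution \<nu>" "AE x in \<nu>. x \<in> {a..b}"
    "\<And>f :: real \<Rightarrow> real. continuous_on UNIV f \<Longrightarrow> (\<lambda>n. \<integral>x. f x \<partial>N (r n)) \<longlonglongrightarrow> (\<integral>x. f x \<partial>\<nu>)"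
proof -
  interpret N: real_distribution "N n" for n by fact
  have "tight N"
    unfolding tight_def
  proof safe
    fix e :: real assume e: "0 < e"
    \<comment> \<open>The interval is open on the left, so it starts at a - 1 in order to contain
      a.\<close>
    have "measure (N n) {a - 1<..\<bar>b\<bar> + \<bar>a\<bar>} = 1" for n
      by (rule N.prob_eq_1[THEN iffD2]) (use supp[of n] in \<open>simp, elim eventually_mono, auto\<close>)
    then show "\<exists>a b. a < b \<and> (\<forall>n. 1 - e < measure (N n) {a<..b})"
      using e by (intro exI[of _ "a - 1"] exI[of _ "\<bar>b\<bar> + \<bar>a\<bar>"]) auto
  qed fact
  from tight_imp_convergent_subsubsequence[OF this strict_mono_id]
  obtain r \<nu> where r: "strict_mono r" "real_distribution \<nu>" "weak_conv_m (N \<circ> r) \<nu>"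
    by (auto simp: o_def)
  interpret nu: real_distribution \<nu> by fact
  define cl where "cl x = max a (min b x)" for x
  have ab: "a \<le> b"
  proof (rule ccontr)
    assume "\<not> a \<le> b"
    then have "AE x in N 0. False" using supp[of 0] by (elim eventually_mono) auto
    then show False using N.emeasure_space_1[of 0] by (simp only: N.AE_False)
  qed
  have conv: "(\<lambda>n. \<integral>x. f (cl x) \<partial>N (r n)) \<longlonglongrightarrow> (\<integral>x. f (cl x) \<partial>\<nu>)"
    if f: "continuous_on UNIV f" for f :: "real \<Rightarrow> real"
  proof -
    have c: "continuous_on UNIV (\<lambda>x. f (cl x))"
      unfolding cl_def by (intro continuous_on_compose2[OF f] continuous_intros) auto
    obtain B where B: "\<And>x. x \<in> {a..b} \<Longrightarrow> norm (f x) \<le> B"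
      using compact_imp_bounded[OF compact_continuous_image[OF continuous_on_subset[OF f] compact_Icc[of a b]]]
      unfolding bounded_iff by blast
    have "(\<lambda>n. \<integral>x. f (cl x) \<partial>(N \<circ> r) n) \<longlonglongrightarrow> (\<integral>x. f (cl x) \<partial>\<nu>)"
    proof (rule weak_conv_imp_bdd_ae_continuous_conv[OF _ r(2) r(3), where B=B])
      show "real_distribution ((N \<circ> r) n)" for n using assms by simp
      show "emeasure \<nu> {x. \<not> isCont (\<lambda>x. f (cl x)) x} = 0"
        using c by (simp add: continuous_on_eq_continuous_at)
      show "norm (f (cl x)) \<le> B" for x using B ab by (auto simp: cl_def)
    qed (use c in \<open>auto intro: borel_measurable_continuous_onI\<close>)
    then show ?thesis by simp
  qed
  have ae: "AE x in \<nu>. x \<in> {a..b}"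
  proof -
    \<comment> \<open>A bounded continuous test function vanishing exactly on [a, b]; its integral
      is 0 along the sequence, hence also in the limit.\<close>
    define f where "f x = \<bar>x - cl x\<bar> / (1 + \<bar>x - cl x\<bar>)" for x
    have fc: "continuous_on UNIV f" unfolding f_def cl_def by (intro continuous_intros) auto
    have [measurable]: "f \<in> borel_measurable borel" by (rule borel_measurable_continuous_onI[OF fc])
    have "(\<lambda>n. \<integral>x. f x \<partial>(N \<circ> r) n) \<longlonglongrightarrow> (\<integral>x. f x \<partial>\<nu>)"
    proof (rule weak_conv_imp_bdd_ae_continuous_conv[OF _ r(2) r(3), where B=1])
      show "real_distribution ((N \<circ> r) n)" for n using assms by simp
      show "emeasure \<nu> {x. \<not> isCont f x} = 0"
        using fc by (simp add: continuous_on_eq_continuous_at)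
      show "norm (f x) \<le> 1" for x by (auto simp: f_def)
    qed auto
    moreover have "(\<integral>x. f x \<partial>N (r n)) = 0" for n
    proof -
      have "(\<integral>x. f x \<partial>N (r n)) = (\<integral>x. 0 \<partial>N (r n))"
        by (rule integral_cong_AE) (use supp[of "r n"] in \<open>simp, simp, elim eventually_mono, auto simp: f_def cl_def\<close>)
      then show ?thesis by simp
    qed
    ultimately have "(\<integral>x. f x \<partial>\<nu>) = 0" by (simp add: LIMSEQ_const_iff)
    moreover have "integrable \<nu> f"
      by (rule nu.integrable_const_bound[of _ 1]) (auto simp: f_def)
    ultimately have "AE x in \<nu>. f x = 0"
      by (subst (asm) integral_nonneg_eq_0_iff_AE) (auto simp: f_def)
    then show ?thesis
      by eventually_elim (use ab in \<open>auto simp: f_def cl_def split: if_splits simp: max_def min_def\<close>)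
  qed
  show ?thesis
  proof (rule that[OF r(1,2) ae])
    fix f :: "real \<Rightarrow> real" assume f: "continuous_on UNIV f"
    have c: "continuous_on UNIV (\<lambda>x. f (cl x))"
      unfolding cl_def by (intro continuous_on_compose2[OF f] continuous_intros) auto
    note [measurable] = borel_measurable_continuous_onI[OF f] borel_measurable_continuous_onI[OF c]
    have 1: "(\<integral>x. f (cl x) \<partial>N (r n)) = (\<integral>x. f x \<partial>N (r n))" for n
      by (rule integral_cong_AE) (use supp[of "r n"] in \<open>simp, simp, elim eventually_mono, auto simp: cl_def\<close>)
    have 2: "(\<integral>x. f (cl x) \<partial>\<nu>) = (\<integral>x. f x \<partial>\<nu>)"
      by (rule integral_cong_AE) (use ae in \<open>simp, simp, elim eventually_mono, auto simp: cl_def\<close>)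
    show "(\<lambda>n. \<integral>x. f x \<partial>N (r n)) \<longlonglongrightarrow> (\<integral>x. f x \<partial>\<nu>)"
      using conv[OF f] by (simp only: 1 2)
  qed
qed

text \<open>The substitution \<open>z = exp (- s / c)\<close> reads the power series as the Laplace transform of a
  measure on the multiples of \<open>1 / c\<close>, transported to the unit interval by \<open>x \<mapsto> exp (- x)\<close>.\<close>

lemma compl_mono_discrete:
  assumes "compl_mono \<psi>" "\<psi> 0 = 1" "0 < c"
  obtains N where "real_distribution N" "AE x in N. x \<in> {0..1}"
    "\<And>s. 0 < s \<Longrightarrow> (\<integral>x. (max 0 x) powr s \<partial>N) = \<psi> (c * (1 - exp (- s / c)))"
proof -
  obtain d where d: "\<And>n. 0 \<le> d n" "\<And>z. 0 \<le> z \<Longrightarrow> z \<le> 1 \<Longrightarrow> (\<lambda>n. d n * z ^ n) sums \<psi> (c * (1 - z))"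
    using nonneg_psE[OF compl_monoD[OF assms(1,3)]] by auto
  define D where "D = density (count_space UNIV) (\<lambda>n. ennreal (d n))"
  \<comment> \<open>The series at z = 1 has sum \<psi> 0 = 1, so the coefficients form a probability
    on the naturals.\<close>
  have "emeasure D (space D) = (\<Sum>n. ennreal (d n))"
    by (simp add: D_def emeasure_density nn_integral_count_space_nat)
  also have "\<dots> = ennreal 1"
    by (rule suminf_ennreal_eq) (use d(1) d(2)[of 1] assms(2) in auto)
  finally interpret D: prob_space D by (intro prob_spaceI) simp
  define N where "N = distr D borel (\<lambda>n. exp (- real n / c))"
  have meas[measurable]: "(\<lambda>n. exp (- real n / c)) \<in> D \<rightarrow>\<^sub>M borel" by (simp add: D_def)
  show ?thesis
  proof (rule that[of N])
    show "real_distribution N"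
      unfolding N_def by (intro real_distribution.intro D.prob_space_distr meas) (auto intro!: real_distribution_axioms.intro)
    show "AE x in N. x \<in> {0..1}"
      unfolding N_def using assms(3) by (subst AE_distr_iff[OF meas]) auto
    fix s :: real assume s: "0 < s"
    have z: "0 \<le> exp (- s / c)" "exp (- s / c) \<le> 1" using s assms(3) by auto
    have "(\<integral>x. (max 0 x) powr s \<partial>N) = (\<integral>n. (max 0 (exp (- real n / c))) powr s \<partial>D)"
      unfolding N_def by (rule integral_distr) measurable
    also have "\<dots> = (\<integral>n. d n * exp (- s / c) ^ n \<partial>count_space UNIV)"
      unfolding D_def
      by (subst integral_density) (use d(1) in \<open>auto simp: exp_powr_real exp_of_nat_mult[symmetric] mult_ac\<close>)
    also have "\<dots> = (\<Sum>n. d n * exp (- s / c) ^ n)"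
      by (rule integral_count_space_nat)
        (use d(1) sums_summable[OF d(2)[OF z]] in \<open>auto simp: integrable_count_space_nat_iff\<close>)
    finally show "(\<integral>x. (max 0 x) powr s \<partial>N) = \<psi> (c * (1 - exp (- s / c)))"
      using sums_unique[OF d(2)[OF z]] by simp
  qed
qed

text \<open>Truncation at 0 gives a test function continuous on the whole line, as
  \<open>helly_interval\<close> demands. At s = 0 continuity fails, so mass at x = 0 has to be
  excluded by an argument of its own in Bernstein's theorem.\<close>

lemma continuous_max_powr:
  assumes "0 < (s::real)"
  shows "continuous_on UNIV (\<lambda>x. (max 0 x) powr s)"
  using assms by (intro continuous_on_powr' continuous_intros) auto

text \<open>The discrete measures reproduce \<psi> at c (1 - exp (- s / c)), which tends to s as c
  grows, so a weak limit has \<psi> s as its moment of order s; taking - ln turns moments into a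
  Laplace transform. The weak limit could have mass at x = 0, the image of infinity.\<close>

lemma bernstein_prob:
  assumes "compl_mono \<psi>" "\<psi> 0 = 1"
  obtains \<nu> where "real_distribution \<nu>" "AE x in \<nu>. 0 \<le> x" "\<And>s. 0 \<le> s \<Longrightarrow> \<psi> s = (\<integral>x. exp (- s * x) \<partial>\<nu>)"
proof -
  define P where "P n N \<longleftrightarrow> real_distribution N \<and> (AE x in N. x \<in> {0..1}) \<and>
    (\<forall>s>0. (\<integral>x. (max 0 x) powr s \<partial>N) = \<psi> (real (Suc n) * (1 - exp (- s / real (Suc n)))))" for n and N :: "real measure"
  have "\<exists>N. P n N" for n
  proof -
    obtain N where "real_distribution N" "AE x in N. x \<in> {0..1}"
      "\<And>s. 0 < s \<Longrightarrow> (\<integral>x. (max 0 x) powr s \<partial>N) = \<psi> (real (Suc n) * (1 - exp (- s / real (Suc n))))"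
      by (rule compl_mono_discrete[OF assms, of "real (Suc n)"]) auto
    then show ?thesis unfolding P_def by blast
  qed
  then obtain N where N: "\<And>n. P n (N n)" by metis
  have N1: "real_distribution (N n)" and N2: "AE x in N n. x \<in> {0..1}" 
    and N3: "\<forall>s>0. (\<integral>x. (max 0 x) powr s \<partial>N n) = \<psi> (real (Suc n) * (1 - exp (- s / real (Suc n))))" for n
    using N[of n] unfolding P_def by blast+
  obtain r \<nu> where r: "strict_mono (r :: nat \<Rightarrow> nat)" and nu: "real_distribution \<nu>" "AE x in \<nu>. x \<in> {0..1}"
    and lim: "\<And>f :: real \<Rightarrow> real. continuous_on UNIV f \<Longrightarrow> (\<lambda>n. \<integral>x. f x \<partial>N (r n)) \<longlonglongrightarrow> (\<integral>x. f x \<partial>\<nu>)"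
    by (rule helly_interval[of N 0 1, OF N1 N2]) (rule that)
  interpret nu: real_distribution \<nu> by fact
  have psi: "\<psi> s = (\<integral>x. (max 0 x) powr s \<partial>\<nu>)" if s: "0 < s" for s
  proof -
    have "((\<lambda>x::real. x * (1 - exp (- s / x))) \<longlongrightarrow> s) at_top"
      by real_asymp
    from filterlim_compose[OF this filterlim_compose[OF filterlim_real_sequentially filterlim_Suc]]
    have "(\<lambda>n. real (Suc n) * (1 - exp (- s / real (Suc n)))) \<longlonglongrightarrow> s" by simp
    then have "(\<lambda>n. \<psi> (real (Suc n) * (1 - exp (- s / real (Suc n))))) \<longlonglongrightarrow> \<psi> s"
      by (rule isCont_tendsto_compose[OF compl_mono_continuous[OF assms(1) s]])
    then have "(\<lambda>n. \<integral>x. (max 0 x) powr s \<partial>N n) \<longlonglongrightarrow> \<psi> s" using N3 s by simp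
    from LIMSEQ_subseq_LIMSEQ[OF this r] have "(\<lambda>n. \<integral>x. (max 0 x) powr s \<partial>N (r n)) \<longlonglongrightarrow> \<psi> s"
      by (simp add: o_def)
    then show ?thesis using lim[OF continuous_max_powr[OF s]] LIMSEQ_unique by blast
  qed
  \<comment> \<open>As e decreases to 0, x powr e tends to the indicator of x > 0, and continuity of
    \<psi> at 0 says that this indicator has integral 1.\<close>
  have pos: "AE x in \<nu>. 0 < x"
  proof -
    define e where "e n = inverse (real (Suc n))" for n
    have e: "filterlim e (at_right 0) sequentially"
      unfolding e_def filterlim_at using LIMSEQ_inverse_real_of_nat by auto
    have "(\<lambda>n. \<psi> (e n)) \<longlonglongrightarrow> 1" using filterlim_compose[OF compl_mono_tendsto_0[OF assms(1)] e] assms(2) by simp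
    moreover have "\<psi> (e n) = (\<integral>x. (max 0 x) powr (e n) \<partial>\<nu>)" for n
      by (rule psi) (simp add: e_def)
    ultimately have 1: "(\<lambda>n. \<integral>x. (max 0 x) powr (e n) \<partial>\<nu>) \<longlonglongrightarrow> 1" by (simp only:)
    have "(\<lambda>n. \<integral>x. (max 0 x) powr (e n) \<partial>\<nu>) \<longlonglongrightarrow> (\<integral>x. (indicator {0<..} x :: real) \<partial>\<nu>)"
    proof (rule integral_dominated_convergence[where w="\<lambda>_. 1"])
      show "AE x in \<nu>. (\<lambda>n. (max 0 x) powr (e n)) \<longlonglongrightarrow> (indicator {0<..} x :: real)"
      proof (rule AE_I2)
        fix x :: real
        show "(\<lambda>n. (max 0 x) powr (e n)) \<longlonglongrightarrow> (indicator {0<..} x :: real)"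
        proof (cases "0 < x")
          case True
          have "(\<lambda>n. x powr (e n)) \<longlonglongrightarrow> x powr 0"
            using True LIMSEQ_inverse_real_of_nat by (intro tendsto_powr) (auto simp: e_def)
          then show ?thesis using True by (simp add: max_def)
        qed (auto simp: max_def)
      qed
      show "AE x in \<nu>. norm ((max 0 x) powr (e n)) \<le> 1" for n
        using nu(2) by eventually_elim (auto simp: max_def e_def intro!: powr_le1)
    qed auto
    with 1 have "(\<integral>x. indicator {0::real<..} x \<partial>\<nu>) = (1::real)" using LIMSEQ_unique by blast
    then have "measure \<nu> {0<..} = 1" by simp
    then show ?thesis using nu.prob_eq_1[of "{0<..}"] by auto
  qed
  define N' where "N' = distr \<nu> borel (\<lambda>x. - ln x)"
  show ?thesis
  proof (rule that[of N'])
    show "real_distribution N'"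
      unfolding N'_def by (intro real_distribution.intro nu.prob_space_distr) (auto intro!: real_distribution_axioms.intro)
    show "AE x in N'. 0 \<le> x"
      unfolding N'_def using pos nu(2) by (subst AE_distr_iff) auto
    fix s :: real assume s: "0 \<le> s"
    show "\<psi> s = (\<integral>x. exp (- s * x) \<partial>N')"
    proof (cases "s = 0")
      case True
      then show ?thesis using assms(2) \<open>real_distribution N'\<close>
        by (simp add: prob_space.prob_space real_distribution_def)
    next
      case False
      have "(\<integral>x. exp (- s * x) \<partial>N') = (\<integral>x. exp (- s * - ln x) \<partial>\<nu>)"
        unfolding N'_def by (rule integral_distr) measurable
      also have "\<dots> = (\<integral>x. (max 0 x) powr s \<partial>\<nu>)"
        by (rule integral_cong_AE) (use pos in \<open>auto elim!: eventually_mono simp: powr_def max_def\<close>)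
      finally show ?thesis using psi[of s] s False by simp
    qed
  qed
qed

lemma bernstein:
  assumes "compl_mono \<psi>"
  obtains \<nu> :: "real measure" where "finite_measure \<nu>" "sets \<nu> = sets borel" "AE x in \<nu>. 0 \<le> x"
    "\<And>s. 0 \<le> s \<Longrightarrow> \<psi> s = (\<integral>x. exp (- s * x) \<partial>\<nu>)"
proof (cases "\<psi> 0 = 0")
  case True
  have "\<psi> s = 0" if "0 \<le> s" for s
    using compl_mono_antimono[OF assms, of 0 s] compl_mono_nonneg[OF assms that] that True by simp
  then show ?thesis
    by (intro that[of "null_measure borel"]) (auto intro!: finite_measureI simp: AE_iff_null null_sets_def)
next
  case False
  then have pos: "0 < \<psi> 0" using compl_mono_nonneg[OF assms, of 0] by simp
  have "compl_mono (\<lambda>s. inverse (\<psi> 0) * \<psi> s)" using pos by (intro compl_mono_mult compl_mono_const assms) simp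
  then obtain \<nu> where nu: "real_distribution \<nu>" "AE x in \<nu>. 0 \<le> x"
    "\<And>s. 0 \<le> s \<Longrightarrow> inverse (\<psi> 0) * \<psi> s = (\<integral>x. exp (- s * x) \<partial>\<nu>)"
    using bernstein_prob[of "\<lambda>s. inverse (\<psi> 0) * \<psi> s"] pos by auto
  interpret nu: real_distribution \<nu> by fact
  show ?thesis
  proof (rule that[of "density \<nu> (\<lambda>_. ennreal (\<psi> 0))"])
    show "finite_measure (density \<nu> (\<lambda>_. ennreal (\<psi> 0)))"
      by (rule finite_measureI) (auto simp: emeasure_density ennreal_mult_eq_top_iff)
    show "AE x in density \<nu> (\<lambda>_. ennreal (\<psi> 0)). 0 \<le> x"
      using nu(2) by (subst AE_density) (auto elim!: eventually_mono)
    show "\<psi> s = (\<integral>x. exp (- s * x) \<partial>density \<nu> (\<lambda>_. ennreal (\<psi> 0)))" if "0 \<le> s" for s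
      using nu(3)[OF that] pos by (subst integral_density) (auto simp: field_simps)
  qed auto
qed

text \<open>Under x -> exp (- x) the values at the integers become the moments of a law on [0, 1].
  These are at most 1, so the Taylor polynomials of the characteristic function converge to it and
  the moments determine the law.\<close>

lemma laplace_unique:
  assumes "real_distribution \<mu>" "real_distribution \<nu>" "AE x in \<mu>. 0 \<le> x" "AE x in \<nu>. 0 \<le> x"
    and eq: "\<And>n::nat. (\<integral>x. exp (- real n * x) \<partial>\<mu>) = (\<integral>x. exp (- real n * x) \<partial>\<nu>)"
  shows "\<mu> = \<nu>"
proof -
  define e where "e N = distr N borel (\<lambda>x::real. exp (- x))" for N
  have rd: "real_distribution (e N)" if "real_distribution N" for N
  proof -
    interpret real_distribution N by fact
    show ?thesis
      unfolding e_def by (intro real_distribution.intro prob_space_distr) (auto intro!: real_distribution_axioms.intro)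
  qed
  have mom: "(\<integral>x. x ^ n \<partial>e N) = (\<integral>x. exp (- real n * x) \<partial>N)" if "real_distribution N" for N n
  proof -
    interpret real_distribution N by fact
    show ?thesis unfolding e_def by (subst integral_distr) (auto simp: exp_of_nat_mult[symmetric])
  qed
  have ae: "AE x in e N. \<bar>x\<bar> \<le> 1" if "real_distribution N" "AE x in N. 0 \<le> x" for N
  proof -
    interpret real_distribution N by fact
    show ?thesis unfolding e_def using that(2) by (subst AE_distr_iff) (auto elim!: eventually_mono)
  qed
  have char: "(\<lambda>n. \<Sum>k\<le>n. ((\<i> * t) ^ k / fact k) * (\<integral>x. x ^ k \<partial>e N)) \<longlonglongrightarrow> char (e N) t"
    if "real_distribution N" "AE x in N. 0 \<le> x" for N and t :: real
  proof -
    interpret real_distribution "e N" by (rule rd) fact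
    have int: "integrable (e N) (\<lambda>x. x ^ k)" for k
      by (rule integrable_const_bound[of _ 1]) (use ae[OF that] in \<open>auto elim!: eventually_mono simp: power_abs intro!: power_le_one\<close>)
    have le: "(\<integral>x. \<bar>x\<bar> ^ n \<partial>e N) \<le> 1" for n
    proof -
      have "(\<integral>x. \<bar>x\<bar> ^ n \<partial>e N) \<le> (\<integral>x. 1 \<partial>e N)"
        by (rule integral_mono_AE)
          (use ae[OF that] integrable_norm[OF int[of n]] in \<open>auto elim!: eventually_mono simp: power_abs intro!: power_le_one\<close>)
      then show ?thesis using prob_space by simp
    qed
    have "(\<lambda>n. (\<Sum>k\<le>n. ((\<i> * t) ^ k / fact k) * (\<integral>x. x ^ k \<partial>e N)) - char (e N) t) \<longlonglongrightarrow> 0"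
    proof (rule Lim_null_comparison)
      show "\<forall>\<^sub>F n in sequentially. norm ((\<Sum>k\<le>n. ((\<i> * t) ^ k / fact k) * (\<integral>x. x ^ k \<partial>e N)) - char (e N) t)
         \<le> 2 * (\<bar>t\<bar> ^ n / fact n)"
      proof (rule always_eventually, rule allI)
        fix n
        have "norm ((\<Sum>k\<le>n. ((\<i> * t) ^ k / fact k) * (\<integral>x. x ^ k \<partial>e N)) - char (e N) t) \<le>
           (2 * \<bar>t\<bar> ^ n / fact n) * (\<integral>x. \<bar>x\<bar> ^ n \<partial>e N)"
          by (subst norm_minus_commute) (rule char_approx1[OF int])
        also have "\<dots> \<le> (2 * \<bar>t\<bar> ^ n / fact n) * 1" by (intro mult_left_mono le) auto
        finally show "norm ((\<Sum>k\<le>n. ((\<i> * t) ^ k / fact k) * (\<integral>x. x ^ k \<partial>e N)) - char (e N) t)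
         \<le> 2 * (\<bar>t\<bar> ^ n / fact n)" by simp
      qed
      have "(\<lambda>n. \<bar>t\<bar> ^ n / fact n) \<longlonglongrightarrow> 0"
        by (rule summable_LIMSEQ_zero) (use exp_converges[of "\<bar>t\<bar>"] in \<open>auto simp: field_simps sums_iff\<close>)
      from tendsto_mult_right_zero[OF this, of 2] show "(\<lambda>n. 2 * (\<bar>t\<bar> ^ n / fact n)) \<longlonglongrightarrow> 0" by simp
    qed
    then show ?thesis by (subst (asm) LIM_zero_iff)
  qed
  have "char (e \<mu>) t = char (e \<nu>) t" for t
    by (rule LIMSEQ_unique[OF char[OF assms(1,3)]])
      (use char[OF assms(2,4), of t] eq in \<open>simp add: mom[OF assms(1)] mom[OF assms(2)]\<close>)
  then have *: "e \<mu> = e \<nu>" by (intro Levy_uniqueness rd assms) auto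
  have inv: "distr (e N) borel (\<lambda>x. - ln x) = N" if "real_distribution N" for N
  proof -
    interpret real_distribution N by fact
    show ?thesis unfolding e_def by (subst distr_distr) (simp_all add: comp_def distr_id2[of borel N])
  qed
  show ?thesis using inv[OF assms(1)] inv[OF assms(2)] * by metis
qed

section \<open>Mixtures of exponential distributions\<close>

text \<open>Bernstein's theorem makes the n-th root the Laplace transform of a law \<nu>. The
  coordinates on its n-fold product are the summands; their sum has the law of X because transforms
  of independent summands multiply.\<close>

lemma infinitely_divisible_rvI:
  fixes X :: "'a \<Rightarrow> real"
  assumes "prob_space M" and meas: "X \<in> borel_measurable M" and nn: "AE \<omega> in M. 0 \<le> X \<omega>"
    and root: "\<And>n::nat. 1 \<le> n \<Longrightarrow> \<exists>\<psi>. compl_mono \<psi> \<and> (\<forall>s\<ge>0. \<psi> s ^ n = (\<integral>\<omega>. exp (- s * X \<omega>) \<partial>M))"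
  shows "infinitely_divisible_rv M X"
  unfolding infinitely_divisible_rv_def nonneg_random_variable_def
proof (intro conjI allI impI meas nn)
  interpret prob_space M by fact
  fix n :: nat assume n: "1 \<le> n"
  from root[OF n] obtain \<psi> where psi': "compl_mono \<psi> \<and> (\<forall>s\<ge>0. \<psi> s ^ n = (\<integral>\<omega>. exp (- s * X \<omega>) \<partial>M))" ..
  note cmpsi = conjunct1[OF psi']
  have psi: "\<psi> s ^ n = (\<integral>\<omega>. exp (- s * X \<omega>) \<partial>M)" if "0 \<le> s" for s
    using psi' that by (simp_all only:)
  have "\<psi> 0 ^ n = 1 ^ n" using psi[of 0] by (simp add: prob_space)
  then have psi0: "\<psi> 0 = 1"
    by (rule power_eq_imp_eq_base) (use compl_mono_nonneg[OF cmpsi, of 0] n in simp_all)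
  then obtain \<nu> where nu: "real_distribution \<nu>" "AE x in \<nu>. 0 \<le> x"
    and lt: "\<And>s. 0 \<le> s \<Longrightarrow> \<psi> s = (\<integral>x. exp (- s * x) \<partial>\<nu>)"
    by (rule bernstein_prob[OF cmpsi]) (rule that)
  interpret nu: real_distribution \<nu> by fact
  define N where "N = PiM {..<n} (\<lambda>_. \<nu>)"
  interpret P: product_prob_space "\<lambda>_::nat. \<nu>" "{..<n}" by unfold_locales
  interpret N: prob_space N unfolding N_def by (rule prob_space_PiM) unfold_locales
  have Y[measurable]: "(\<lambda>\<omega>. \<omega> i) \<in> borel_measurable N" if "i < n" for i
    unfolding N_def using measurable_component_singleton[of i "{..<n}" "\<lambda>_. \<nu>"] that
    by (simp cong: measurable_cong_sets)
  have dY: "distr N borel (\<lambda>\<omega>. \<omega> i) = \<nu>" if "i < n" for i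
  proof -
    have "distr N \<nu> (\<lambda>\<omega>. \<omega> i) = \<nu>" unfolding N_def
      by (rule distr_PiM_component) (use that nu.prob_space_axioms in auto)
    then show ?thesis by (simp cong: distr_cong)
  qed
  have S[measurable]: "(\<lambda>\<omega>. \<Sum>i<n. \<omega> i) \<in> borel_measurable N" by (intro borel_measurable_sum) auto
  show "\<exists>(N :: (nat \<Rightarrow> real) measure) (Y :: nat \<Rightarrow> (nat \<Rightarrow> real) \<Rightarrow> real).
        prob_space N \<and>
        prob_space.indep_vars N (\<lambda>_. borel) Y {..<n} \<and>
        (\<forall>i<n. \<forall>j<n. distr N borel (Y i) = distr N borel (Y j)) \<and>
        distr M borel X = distr N borel (\<lambda>\<omega>. \<Sum>i<n. Y i \<omega>)"
  proof (intro exI[of _ N] exI[of _ "\<lambda>i \<omega>. \<omega> i"] conjI allI impI)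
    show "prob_space N" by unfold_locales
    show "N.indep_vars (\<lambda>_. borel) (\<lambda>i \<omega>. \<omega> i) {..<n}"
    proof (subst N.indep_vars_iff_distr_eq_PiM')
      show "{..<n} \<noteq> {}" using n by (auto simp: lessThan_empty_iff)
      show "(\<lambda>\<omega>. \<omega> i) \<in> borel_measurable N" if "i \<in> {..<n}" for i using that by auto
      have "distr N (\<Pi>\<^sub>M i\<in>{..<n}. borel) (\<lambda>x. \<lambda>i\<in>{..<n}. x i) = distr N N (\<lambda>x. x)"
        by (rule distr_cong) (auto simp: N_def space_PiM intro!: sets_PiM_cong)
      also have "\<dots> = N" by (rule distr_id)
      also have "N = PiM {..<n} (\<lambda>i. distr N borel (\<lambda>\<omega>. \<omega> i))"
        by (subst (1) N_def, rule PiM_cong) (auto simp: dY)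
      finally show "distr N (\<Pi>\<^sub>M i\<in>{..<n}. borel) (\<lambda>x. \<lambda>i\<in>{..<n}. x i) =
        PiM {..<n} (\<lambda>i. distr N borel (\<lambda>\<omega>. \<omega> i))" .
    qed
    show "distr N borel (\<lambda>\<omega>. \<omega> i) = distr N borel (\<lambda>\<omega>. \<omega> j)" if "i < n" "j < n" for i j
      using dY that by simp
    show "distr M borel X = distr N borel (\<lambda>\<omega>. \<Sum>i<n. \<omega> i)"
    proof (rule laplace_unique)
      show "real_distribution (distr M borel X)"
        using meas by (intro real_distribution.intro prob_space_distr) (auto intro!: real_distribution_axioms.intro)
      show "real_distribution (distr N borel (\<lambda>\<omega>. \<Sum>i<n. \<omega> i))"
        by (intro real_distribution.intro N.prob_space_distr S) (auto intro!: real_distribution_axioms.intro)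
      show "AE x in distr M borel X. 0 \<le> x" using nn meas by (subst AE_distr_iff) auto
      have "AE \<omega> in N. \<forall>i\<in>{..<n}. 0 \<le> \<omega> i"
      proof (rule AE_ball_countable[THEN iffD2, rule_format])
        fix i assume i: "i \<in> {..<n}"
        have "AE x in distr N borel (\<lambda>\<omega>. \<omega> i). 0 \<le> x" using nu(2) i by (simp only: dY lessThan_iff)
        then show "AE \<omega> in N. 0 \<le> \<omega> i" using i by (subst (asm) AE_distr_iff) auto
      qed auto
      then have "AE \<omega> in N. 0 \<le> (\<Sum>i<n. \<omega> i)" by eventually_elim (auto intro: sum_nonneg)
      then show "AE x in distr N borel (\<lambda>\<omega>. \<Sum>i<n. \<omega> i). 0 \<le> x" by (subst AE_distr_iff) auto
      fix k :: nat
      have "(\<integral>x. exp (- real k * x) \<partial>distr M borel X) = \<psi> (real k) ^ n"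
        using psi[of "real k"] meas by (subst integral_distr) auto
      also have "\<dots> = (\<Prod>i<n. \<integral>x. exp (- real k * x) \<partial>\<nu>)" using lt[of "real k"] by simp
      also have "\<dots> = (\<integral>\<omega>. (\<Prod>i<n. exp (- real k * \<omega> i)) \<partial>N)"
        unfolding N_def
      proof (rule P.product_integral_prod[symmetric])
        show "integrable \<nu> (\<lambda>x. exp (- real k * x))"
          by (rule nu.integrable_const_bound[of _ 1]) (use nu(2) in \<open>auto elim!: eventually_mono\<close>)
      qed auto
      also have "\<dots> = (\<integral>\<omega>. exp (- real k * (\<Sum>i<n. \<omega> i)) \<partial>N)"
        by (simp add: exp_sum[symmetric] sum_distrib_left sum_negf)
      also have "\<dots> = (\<integral>x. exp (- real k * x) \<partial>distr N borel (\<lambda>\<omega>. \<Sum>i<n. \<omega> i))"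
        by (subst integral_distr) auto
      finally show "(\<integral>x. exp (- real k * x) \<partial>distr M borel X) = \<dots>" .
    qed
  qed
qed

text \<open>With s = c (1 - z) each l / (l + s A) is a geometric series p / (1 - x z), so the
  mixture has as coefficients the moments of x weighted by p. Once it is g 0 / (1 - B z), the power
  \<alpha> is a constant times the exponential of - \<alpha> ln (1 - B z).\<close>

lemma compl_mono_powr_exponential_mixture:
  fixes A :: "'a \<Rightarrow> real"
  assumes "prob_space M" and A[measurable]: "A \<in> borel_measurable M" and pos: "\<And>\<omega>. 0 < A \<omega>"
    and l: "0 < l" and \<alpha>: "0 < \<alpha>"
  shows "compl_mono (\<lambda>s. (\<integral>\<omega>. l / (l + s * A \<omega>) \<partial>M) powr \<alpha>)"
  unfolding compl_mono_def
proof (intro allI impI)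
  interpret prob_space M by fact
  fix c :: real assume c: "0 < c"
  define p where "p \<omega> = l / (l + c * A \<omega>)" for \<omega>
  define x where "x \<omega> = c * A \<omega> / (l + c * A \<omega>)" for \<omega>
  have [measurable]: "p \<in> borel_measurable M" "x \<in> borel_measurable M" unfolding p_def x_def by measurable
  have cA: "0 < c * A \<omega>" for \<omega> using pos c by simp
  have p: "0 < p \<omega>" "p \<omega> < 1" for \<omega> using cA[of \<omega>] l by (auto simp: p_def)
  have x: "0 < x \<omega>" "x \<omega> < 1" for \<omega> using cA[of \<omega>] l by (auto simp: x_def)
  define g where "g n = (\<integral>\<omega>. p \<omega> * x \<omega> ^ n \<partial>M)" for n
  define G where "G z = (\<integral>\<omega>. l / (l + (c * (1 - z)) * A \<omega>) \<partial>M)" for z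
  have px: "p \<omega> * x \<omega> ^ n \<le> 1" "0 < p \<omega> * x \<omega> ^ n" for \<omega> n
  proof -
    have "x \<omega> ^ n \<le> 1" using x[of \<omega>] by (intro power_le_one) auto
    then show "p \<omega> * x \<omega> ^ n \<le> 1" using p[of \<omega>] x[of \<omega>] by (intro mult_le_one) auto
    show "0 < p \<omega> * x \<omega> ^ n" using p[of \<omega>] x[of \<omega>] by simp
  qed
  have int: "integrable M (\<lambda>\<omega>. p \<omega> * x \<omega> ^ n)" for n
    by (rule integrable_const_bound[of _ 1]) (use px(2)[THEN less_imp_le] px(1) in \<open>auto simp: abs_of_nonneg\<close>)
  have gpos: "0 < g n" for n
  proof -
    have "g n \<noteq> 0"
    proof
      assume "g n = 0"
      then have "AE \<omega> in M. p \<omega> * x \<omega> ^ n = 0"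
        unfolding g_def by (subst (asm) integral_nonneg_eq_0_iff_AE[OF int]) (use px(2)[THEN less_imp_le] in auto)
      then have "AE \<omega> in M. False" by eventually_elim (use px(2) in \<open>metis less_irrefl\<close>)
      then show False by (simp only: AE_False)
    qed
    moreover have "0 \<le> g n" unfolding g_def
      by (rule Bochner_Integration.integral_nonneg) (use px(2)[THEN less_imp_le] in auto)
    ultimately show ?thesis by simp
  qed
  have lc: "g (Suc n) ^ 2 \<le> g n * g (Suc (Suc n))" for n
  proof -
    \<comment> \<open>Cauchy-Schwarz by the discriminant: this t minimises the integral of p x^n (x
      - t)^2.\<close>
    define t where "t = g (Suc n) / g n"
    have "0 \<le> (\<integral>\<omega>. p \<omega> * x \<omega> ^ n * (x \<omega> - t)\<^sup>2 \<partial>M)"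
      by (rule Bochner_Integration.integral_nonneg) (use px(2)[THEN less_imp_le] in auto)
    also have "\<dots> = (\<integral>\<omega>. p \<omega> * x \<omega> ^ Suc (Suc n) - 2 * t * (p \<omega> * x \<omega> ^ Suc n) + t\<^sup>2 * (p \<omega> * x \<omega> ^ n) \<partial>M)"
      by (rule Bochner_Integration.integral_cong) (auto simp: power2_eq_square algebra_simps)
    also have "\<dots> = g (Suc (Suc n)) - 2 * t * g (Suc n) + t\<^sup>2 * g n"
      unfolding g_def by (simp add: int del: power_Suc)
    finally have "0 \<le> (g (Suc (Suc n)) - 2 * t * g (Suc n) + t\<^sup>2 * g n) * g n" using gpos[of n] by simp
    then show ?thesis using gpos[of n] by (simp add: t_def power2_eq_square field_simps)
  qed
  have sums: "(\<lambda>n. g n * z ^ n) sums G z" if z: "0 \<le> z" "z \<le> 1" for z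
  proof (rule sums_of_ennreal)
    have Gnn: "0 \<le> l / (l + (c * (1 - z)) * A \<omega>)" "l / (l + (c * (1 - z)) * A \<omega>) \<le> 1" for \<omega>
    proof -
      have "0 \<le> (c * (1 - z)) * A \<omega>" using z c pos[of \<omega>] by simp
      then show "0 \<le> l / (l + (c * (1 - z)) * A \<omega>)" "l / (l + (c * (1 - z)) * A \<omega>) \<le> 1" using l by auto
    qed
    have Gnorm: "norm (l / (l + (c * (1 - z)) * A \<omega>)) \<le> 1" for \<omega>
      using Gnn by (simp only: real_norm_def abs_of_nonneg)
    show "0 \<le> g n * z ^ n" for n using gpos[of n] z by simp
    show "0 \<le> G z" unfolding G_def by (rule Bochner_Integration.integral_nonneg) (use Gnn in auto)
    have ge: "(\<lambda>n. p \<omega> * x \<omega> ^ n * z ^ n) sums (l / (l + (c * (1 - z)) * A \<omega>))" for \<omega>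
    proof -
      have "0 \<le> x \<omega> * z" "x \<omega> * z < 1" using x[of \<omega>] z mult_left_le[OF z(2), of "x \<omega>"] by (simp, linarith)
      then have "(\<lambda>n. p \<omega> * (x \<omega> * z) ^ n) sums (p \<omega> * (1 / (1 - x \<omega> * z)))"
        by (intro sums_mult geometric_sums) auto
      moreover have "p \<omega> * (1 / (1 - x \<omega> * z)) = l / (l + (c * (1 - z)) * A \<omega>)"
      proof -
        have "1 - x \<omega> * z = (l + (c * (1 - z)) * A \<omega>) / (l + c * A \<omega>)"
          using cA[of \<omega>] l by (simp add: x_def field_simps)
        then show ?thesis using cA[of \<omega>] l by (simp add: p_def)
      qed
      ultimately show ?thesis by (simp add: power_mult_distrib mult_ac)
    qed
    have "ennreal (G z) = (\<integral>\<^sup>+\<omega>. ennreal (l / (l + (c * (1 - z)) * A \<omega>)) \<partial>M)"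
      unfolding G_def
      by (rule nn_integral_eq_integral[symmetric], rule integrable_const_bound[of _ 1]) (use Gnn Gnorm in \<open>measurable, intro AE_I2, auto intro!: AE_I2\<close>)
    also have "\<dots> = (\<integral>\<^sup>+\<omega>. (\<Sum>n. ennreal (p \<omega> * x \<omega> ^ n * z ^ n)) \<partial>M)"
      by (rule nn_integral_cong, rule suminf_ennreal_eq[OF _ ge, symmetric])
        (use px z in \<open>auto intro!: mult_nonneg_nonneg[OF less_imp_le]\<close>)
    also have "\<dots> = (\<Sum>n. \<integral>\<^sup>+\<omega>. ennreal (p \<omega> * x \<omega> ^ n * z ^ n) \<partial>M)"
      by (rule nn_integral_suminf) measurable
    also have "\<dots> = (\<Sum>n. ennreal (g n * z ^ n))"
    proof (rule suminf_cong)
      fix n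
      have "(\<integral>\<^sup>+\<omega>. ennreal (p \<omega> * x \<omega> ^ n * z ^ n) \<partial>M) = ennreal (\<integral>\<omega>. p \<omega> * x \<omega> ^ n * z ^ n \<partial>M)"
        by (rule nn_integral_eq_integral)
          (use int z px in \<open>auto intro!: mult_nonneg_nonneg[OF less_imp_le]\<close>)
      then show "(\<integral>\<^sup>+\<omega>. ennreal (p \<omega> * x \<omega> ^ n * z ^ n) \<partial>M) = ennreal (g n * z ^ n)"
        by (simp add: g_def)
    qed
    finally show "(\<Sum>n. ennreal (g n * z ^ n)) = ennreal (G z)" by simp
  qed
  define B where "B z = 1 - g 0 / G z" for z
  have B: "nonneg_ps B" unfolding B_def by (rule kaluza[OF gpos lc sums])
  \<comment> \<open>z = 1 is s = 0, where the transform equals 1; hence B 1 = 1 - g 0 < 1.\<close>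
  have G1: "G 1 = 1" using l by (simp add: G_def prob_space)
  have B1: "B 1 < 1" using gpos[of 0] by (simp add: B_def G1)
  have "nonneg_ps (\<lambda>z. g 0 powr \<alpha> * exp (\<alpha> * (- ln (1 - B z))))"
    using \<alpha> by (intro nonneg_ps_cmult nonneg_ps_exp nonneg_ps_neg_ln B B1) auto
  then have "nonneg_ps (\<lambda>z. G z powr \<alpha>)"
  proof (rule nonneg_ps_cong[rotated])
    fix z :: real assume z: "0 \<le> z" "z \<le> 1"
    have "0 < g 0 * z ^ 0" using gpos[of 0] by simp
    also have "g 0 * z ^ 0 \<le> G z"
      using sum_le_suminf[OF sums_summable[OF sums[OF z]], of "{0}"] sums_unique[OF sums[OF z]] gpos[THEN less_imp_le] z by simp
    finally have Gp: "0 < G z" .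
    have "g 0 powr \<alpha> * exp (\<alpha> * (- ln (1 - B z))) = exp (\<alpha> * (ln (g 0) - ln (g 0 / G z)))"
      using gpos[of 0] by (simp add: powr_def B_def exp_add[symmetric] algebra_simps)
    also have "\<dots> = G z powr \<alpha>" using gpos[of 0] Gp by (simp add: powr_def ln_div)
    finally show "g 0 powr \<alpha> * exp (\<alpha> * (- ln (1 - B z))) = G z powr \<alpha>" .
  qed
  then show "nonneg_ps (\<lambda>z. (\<integral>\<omega>. l / (l + (c * (1 - z)) * A \<omega>) \<partial>M) powr \<alpha>)" by (simp only: G_def)
qed

text \<open>Fubini over the product law with h left free: an exponential h gives the Laplace
  transform of the product, an indicator gives its law.\<close>

lemma nn_integral_indep_exponential:
  fixes A E :: "'a \<Rightarrow> real" and h :: "real \<Rightarrow> real \<Rightarrow> ennreal"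
  assumes "prob_space M" and "A \<in> borel_measurable M" and l: "0 < l"
    and E: "distributed M lborel E (exponential_density l)"
    and "prob_space.indep_var M borel A borel E"
    and h[measurable]: "(\<lambda>(a, y). h a y) \<in> borel_measurable (borel \<Otimes>\<^sub>M borel)"
  shows "(\<integral>\<^sup>+\<omega>. h (A \<omega>) (E \<omega>) \<partial>M) = (\<integral>\<^sup>+\<omega>. \<integral>\<^sup>+y. h (A \<omega>) y * ennreal (exponential_density l y) \<partial>lborel \<partial>M)"
proof -
  interpret prob_space M by fact
  note [measurable] = assms(2)
  have Em[measurable]: "E \<in> borel_measurable M" using distributed_measurable[OF E] by simp
  have dE: "distr M borel E = density lborel (exponential_density l)"
    using distributed_distr_eq_density[OF E] by (simp cong: distr_cong)
  interpret E: prob_space "distr M borel E" by (rule prob_space_distr) measurable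
  have "(\<integral>\<^sup>+\<omega>. h (A \<omega>) (E \<omega>) \<partial>M) = (\<integral>\<^sup>+(a, y). h a y \<partial>distr M (borel \<Otimes>\<^sub>M borel) (\<lambda>\<omega>. (A \<omega>, E \<omega>)))"
    by (subst nn_integral_distr) auto
  also have "\<dots> = (\<integral>\<^sup>+(a, y). h a y \<partial>(distr M borel A \<Otimes>\<^sub>M distr M borel E))"
    using assms(5) by (simp add: indep_var_distribution_eq)
  also have "\<dots> = (\<integral>\<^sup>+a. \<integral>\<^sup>+y. h a y \<partial>distr M borel E \<partial>distr M borel A)"
    by (subst E.nn_integral_fst[symmetric]) (auto cong: measurable_cong_sets)
  also have "\<dots> = (\<integral>\<^sup>+\<omega>. \<integral>\<^sup>+y. h (A \<omega>) y \<partial>distr M borel E \<partial>M)"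
    by (subst nn_integral_distr) auto
  also have "\<dots> = (\<integral>\<^sup>+\<omega>. \<integral>\<^sup>+y. h (A \<omega>) y * ennreal (exponential_density l y) \<partial>lborel \<partial>M)"
    unfolding dE by (intro nn_integral_cong, subst nn_integral_density) (auto simp: mult.commute)
  finally show ?thesis .
qed

text \<open>Exponential tilting: exp (- a y) times the density of rate l is l / (l + a) times the
  density of rate l + a.\<close>

lemma nn_integral_exp_exponential_density:
  assumes l: "0 < l" and a: "0 \<le> a"
  shows "(\<integral>\<^sup>+y. ennreal (exp (- (a * y))) * ennreal (exponential_density l y) \<partial>lborel) = ennreal (l / (l + a))"
proof -
  define m where "m = l + a"
  have m: "0 < m" using l a by (simp add: m_def)
  interpret D: prob_space "density lborel (exponential_density m)"
    by (rule prob_space_exponential_density[OF m])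
  have "(\<integral>\<^sup>+y. ennreal (exponential_density m y) \<partial>lborel) = 1"
    using D.emeasure_space_1 by (simp add: emeasure_density)
  moreover have "ennreal (exp (- (a * y))) * ennreal (exponential_density l y)
     = ennreal (l / m) * ennreal (exponential_density m y)" for y
  proof -
    have "exp (- (a * y)) * exp (- y * l) = exp (- y * m)"
      by (simp add: exp_add[symmetric] m_def algebra_simps)
    then have "exp (- (a * y)) * (l * exp (- y * l)) = l / m * (m * exp (- y * m))"
      using m by simp
    then have "exp (- (a * y)) * exponential_density l y = l / m * exponential_density m y"
      by (simp add: exponential_density_def)
    then show ?thesis using m l by (simp add: ennreal_mult[symmetric] exponential_density_nonneg)
  qed
  ultimately show ?thesis by (simp add: nn_integral_cmult m_def)
qed

lemma laplace_mult_exponential: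
  fixes A E :: "'a \<Rightarrow> real"
  assumes M: "prob_space M" and A: "A \<in> borel_measurable M" and l: "0 < l"
    and E: "distributed M lborel E (exponential_density l)"
    and ind: "prob_space.indep_var M borel A borel E"
    and pos: "AE \<omega> in M. 0 < A \<omega>" and s: "0 \<le> s"
  shows "(\<integral>\<omega>. exp (- s * (A \<omega> * E \<omega>)) \<partial>M) = (\<integral>\<omega>. l / (l + s * A \<omega>) \<partial>M)"
proof -
  interpret prob_space M by fact
  note [measurable] = A
  have Em[measurable]: "E \<in> borel_measurable M" using distributed_measurable[OF E] by simp
  have "(\<integral>\<^sup>+\<omega>. ennreal (exp (- s * (A \<omega> * E \<omega>))) \<partial>M) =
     (\<integral>\<^sup>+\<omega>. \<integral>\<^sup>+y. ennreal (exp (- s * (A \<omega> * y))) * ennreal (exponential_density l y) \<partial>lborel \<partial>M)"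
    by (rule nn_integral_indep_exponential[OF M A l E ind]) measurable
  also have "\<dots> = (\<integral>\<^sup>+\<omega>. ennreal (l / (l + s * A \<omega>)) \<partial>M)"
  proof (rule nn_integral_cong_AE)
    show "AE \<omega> in M. (\<integral>\<^sup>+y. ennreal (exp (- s * (A \<omega> * y))) * ennreal (exponential_density l y) \<partial>lborel)
       = ennreal (l / (l + s * A \<omega>))"
      using pos
    proof eventually_elim
      case (elim \<omega>)
      have e: "exp (- s * (A \<omega> * y)) = exp (- (s * A \<omega> * y))" for y by (simp add: mult.assoc)
      show ?case unfolding e
        by (rule nn_integral_exp_exponential_density[OF l]) (use s elim in simp)
    qed
  qed
  finally have eq: "(\<integral>\<^sup>+\<omega>. ennreal (exp (- s * (A \<omega> * E \<omega>))) \<partial>M) = (\<integral>\<^sup>+\<omega>. ennreal (l / (l + s * A \<omega>)) \<partial>M)" .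
  have "AE \<omega> in M. 0 \<le> l / (l + s * A \<omega>)"
    using pos by eventually_elim (use l s in \<open>auto intro!: divide_nonneg_nonneg add_nonneg_nonneg\<close>)
  then show ?thesis
    using eq by (subst (1 2) integral_eq_nn_integral) auto
qed

section \<open>Hyperbolic complete monotonicity\<close>

text \<open>With \<open>u = exp s\<close> and \<open>v = exp t\<close> one has \<open>v + 1 / v = 2 cosh t\<close>; subtracting \<open>2\<close> lets the
  argument of \<open>\<psi>\<close> range over the whole half-line.\<close>

definition log_HCM :: "(real \<Rightarrow> real) \<Rightarrow> bool" where
  "log_HCM G \<longleftrightarrow> (\<forall>a. 0 \<le> G a) \<and>
     (\<forall>s. \<exists>\<psi>. compl_mono \<psi> \<and> (\<forall>t. G (s + t) * G (s - t) = \<psi> (2 * cosh t - 2)))"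

text \<open>The factor 2 is the Jacobian of (s, t) -> (s + t, s - t); it arises from two
  one-dimensional substitutions, b = a - 2 t for fixed a and then a = s + t for fixed t.\<close>

lemma nn_integral_times_rotate:
  fixes f g :: "real \<Rightarrow> ennreal"
  assumes [measurable]: "f \<in> borel_measurable borel" "g \<in> borel_measurable borel"
  shows "(\<integral>\<^sup>+a. f a \<partial>lborel) * (\<integral>\<^sup>+a. g a \<partial>lborel) = 2 * (\<integral>\<^sup>+s. \<integral>\<^sup>+t. f (s + t) * g (s - t) \<partial>lborel \<partial>lborel)"
proof -
  have "(\<integral>\<^sup>+a. f a \<partial>lborel) * (\<integral>\<^sup>+a. g a \<partial>lborel) = (\<integral>\<^sup>+a. f a * (\<integral>\<^sup>+b. g b \<partial>lborel) \<partial>lborel)"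
    by (simp add: nn_integral_multc)
  also have "\<dots> = (\<integral>\<^sup>+a. 2 * (\<integral>\<^sup>+t. f a * g (a - 2 * t) \<partial>lborel) \<partial>lborel)"
  proof (rule nn_integral_cong)
    fix a :: real
    have "(\<integral>\<^sup>+b. g b \<partial>lborel) = ennreal \<bar>- 2\<bar> * (\<integral>\<^sup>+t. g (a + (- 2) * t) \<partial>lborel)"
      by (rule nn_integral_real_affine) auto
    then show "f a * (\<integral>\<^sup>+b. g b \<partial>lborel) = 2 * (\<integral>\<^sup>+t. f a * g (a - 2 * t) \<partial>lborel)"
      by (simp add: nn_integral_cmult mult_ac)
  qed
  also have "\<dots> = 2 * (\<integral>\<^sup>+a. \<integral>\<^sup>+t. f a * g (a - 2 * t) \<partial>lborel \<partial>lborel)"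
    by (rule nn_integral_cmult) measurable
  also have "(\<integral>\<^sup>+a. \<integral>\<^sup>+t. f a * g (a - 2 * t) \<partial>lborel \<partial>lborel) = (\<integral>\<^sup>+t. \<integral>\<^sup>+a. f a * g (a - 2 * t) \<partial>lborel \<partial>lborel)"
    by (rule lborel_pair.Fubini') measurable
  also have "\<dots> = (\<integral>\<^sup>+t. \<integral>\<^sup>+s. f (s + t) * g (s - t) \<partial>lborel \<partial>lborel)"
  proof (rule nn_integral_cong)
    fix t :: real
    have "(\<integral>\<^sup>+a. f a * g (a - 2 * t) \<partial>lborel) = ennreal \<bar>1\<bar> * (\<integral>\<^sup>+s. f (t + 1 * s) * g ((t + 1 * s) - 2 * t) \<partial>lborel)"
      by (rule nn_integral_real_affine) auto
    then show "(\<integral>\<^sup>+a. f a * g (a - 2 * t) \<partial>lborel) = (\<integral>\<^sup>+s. f (s + t) * g (s - t) \<partial>lborel)"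
      by (simp add: algebra_simps)
  qed
  also have "\<dots> = (\<integral>\<^sup>+s. \<integral>\<^sup>+t. f (s + t) * g (s - t) \<partial>lborel \<partial>lborel)"
    by (rule lborel_pair.Fubini') measurable
  finally show ?thesis .
qed

text \<open>The integral of \<open>exp (- a exp t - b exp (- t))\<close> depends on \<open>a b\<close> only, which here is affine in
  \<open>2 cosh \<eta>\<close>.\<close>

lemma nn_integral_exp_cosh_shift:
  assumes "0 \<le> u" "0 < b"
  shows "(\<integral>\<^sup>+t. ennreal (exp (- u * (2 * cosh t) - b * (2 * cosh (t - \<eta>)))) \<partial>lborel) =
    (\<integral>\<^sup>+t. ennreal (exp (- exp t - (u + b)\<^sup>2 * exp (- t) - u * b * exp (- t) * (2 * cosh \<eta> - 2))) \<partial>lborel)"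
proof -
  \<comment> \<open>The coefficient of exp t in the exponent; shifting t by - ln A makes it 1 and
    leaves the product of both coefficients in front of exp (- t).\<close>
  define A where "A = u + b * exp (- \<eta>)"
  have A: "0 < A" using assms by (auto simp: A_def intro: add_nonneg_pos)
  have "(\<integral>\<^sup>+t. ennreal (exp (- u * (2 * cosh t) - b * (2 * cosh (t - \<eta>)))) \<partial>lborel) =
    ennreal \<bar>1\<bar> * (\<integral>\<^sup>+t. ennreal (exp (- u * (2 * cosh (- ln A + 1 * t)) - b * (2 * cosh (- ln A + 1 * t - \<eta>)))) \<partial>lborel)"
    by (rule nn_integral_real_affine) (auto simp: cosh_def)
  also have "\<dots> = (\<integral>\<^sup>+t. ennreal (exp (- exp t - (u + b)\<^sup>2 * exp (- t) - u * b * exp (- t) * (2 * cosh \<eta> - 2))) \<partial>lborel)"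
  proof -
    have "- u * (2 * cosh (- ln A + 1 * t)) - b * (2 * cosh (- ln A + 1 * t - \<eta>)) =
       - exp t - (u + b)\<^sup>2 * exp (- t) - u * b * exp (- t) * (2 * cosh \<eta> - 2)" for t
    proof -
      have c: "2 * cosh x = exp x + exp (- x)" for x :: real by (simp add: cosh_def)
      have e1: "exp (- ln A + t) = exp t / A" using A by (simp add: exp_diff)
      have e2: "exp (- (- ln A + t)) = A * exp (- t)" using A by (simp add: exp_add[symmetric] exp_diff exp_minus divide_inverse)
      have e3: "exp (- ln A + t - \<eta>) = exp t / A * exp (- \<eta>)" using e1 by (simp add: exp_diff exp_minus divide_inverse)
      have e4: "exp (- (- ln A + t - \<eta>)) = A * exp (- t) * exp \<eta>" using e2 by (simp add: exp_diff exp_minus exp_add divide_inverse)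
      \<comment> \<open>The product of the two coefficients is affine in 2 cosh \<eta> - 2 with
        nonnegative slope u b.\<close>
      have AA: "A * (u + b * exp \<eta>) = (u + b)\<^sup>2 + u * b * (2 * cosh \<eta> - 2)"
        unfolding A_def c by (simp add: algebra_simps power2_eq_square exp_add[symmetric])
      have "u * (2 * cosh (- ln A + 1 * t)) + b * (2 * cosh (- ln A + 1 * t - \<eta>)) =
         (u + b * exp (- \<eta>)) * (exp t / A) + A * (u + b * exp \<eta>) * exp (- t)"
        by (simp only: c mult_1_left e1 e2 e3 e4) (simp add: algebra_simps)
      also have "\<dots> = exp t + ((u + b)\<^sup>2 + u * b * (2 * cosh \<eta> - 2)) * exp (- t)"
        using A by (simp only: AA A_def[symmetric]) simp
      finally show ?thesis by (simp add: algebra_simps)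
    qed
    then show ?thesis by simp
  qed
  finally show ?thesis .
qed

text \<open>Transfers Laplace integrals in \<open>ennreal\<close> to \<open>compl_mono\<close>.
  Finiteness at 0 is integrability of W, which dominates the integrand for every y \<ge> 0. The
  formula for K is demanded at y \<ge> 0 only, so that K may be built with
  \<open>arcosh\<close>.\<close>

lemma compl_mono_nn_integral_exp:
  assumes [measurable]: "W \<in> borel_measurable M" "V \<in> borel_measurable M"
    and nn: "\<And>x. 0 \<le> W x" "\<And>x. 0 \<le> V x"
    and K: "\<And>y. 0 \<le> y \<Longrightarrow> K y = (\<integral>\<^sup>+x. ennreal (W x * exp (- V x * y)) \<partial>M)" and fin: "K 0 < \<infinity>"
  shows "compl_mono (\<lambda>y. enn2real (K y))" "0 \<le> y \<Longrightarrow> K y < \<infinity>"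
proof -
  have W: "integrable M W"
    by (rule integrableI_nonneg) (use nn fin K[of 0] in auto)
  have int: "integrable M (\<lambda>x. W x * exp (- V x * y))" if "0 \<le> y" for y
    by (rule Bochner_Integration.integrable_bound[OF W])
      (use nn that in \<open>auto simp: abs_mult intro!: AE_I2 mult_left_le\<close>)
  have K2: "K y = ennreal (\<integral>x. W x * exp (- V x * y) \<partial>M)" if "0 \<le> y" for y
    unfolding K[OF that] by (rule nn_integral_eq_integral[OF int[OF that]]) (use nn in auto)
  show "K y < \<infinity>" if "0 \<le> y" using K2[OF that] by simp
  have "compl_mono (\<lambda>y. W x * exp (- (0 + V x * y)))" for x
    by (intro compl_mono_mult compl_mono_const compl_mono_exp_affine nn)
  then have "compl_mono (\<lambda>y. \<integral>x. W x * exp (- V x * y) \<partial>M)"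
    by (intro compl_mono_integral) (use W in auto)
  then show "compl_mono (\<lambda>y. enn2real (K y))"
    by (rule compl_mono_cong[rotated]) (use K2 nn in \<open>auto intro!: integral_nonneg_AE\<close>)
qed

text \<open>The hyperbolic substitution \<open>a = s + t\<close>, \<open>b = s - t\<close> turns the product of two values of the
  integral into a mixture over \<open>s\<close> of integrals that are completely monotone in \<open>2 cosh \<eta> - 2\<close>.\<close>

lemma log_HCM_kernel_integral:
  assumes G: "log_HCM G" and [measurable]: "G \<in> borel_measurable borel" and b: "0 < b"
    and int: "\<And>\<xi>. integrable lborel (\<lambda>a. G a * exp (- b * exp (a - \<xi>)))"
  shows "log_HCM (\<lambda>\<xi>. \<integral>a. G a * exp (- b * exp (a - \<xi>)) \<partial>lborel)" (is "log_HCM ?F")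
  unfolding log_HCM_def
proof (intro conjI allI)
  have Gnn: "0 \<le> G a" for a using G by (simp add: log_HCM_def)
  show Fnn: "0 \<le> ?F \<xi>" for \<xi> using Gnn by (intro integral_nonneg_AE AE_I2) simp
  fix \<xi> :: real
  define \<beta> where "\<beta> s = b * exp (s - \<xi>)" for s
  have \<beta>: "0 < \<beta> s" for s using b by (simp add: \<beta>_def)
  \<comment> \<open>The inner integral for a fixed midpoint s. Its finiteness will be known only for
    almost every s, hence the values in \<open>ennreal\<close>.\<close>
  define K where "K s \<eta> = (\<integral>\<^sup>+t. ennreal (G (s + t) * G (s - t) * exp (- \<beta> s * (2 * cosh (t - \<eta>)))) \<partial>lborel)" for s \<eta>
  have Fe: "ennreal (?F x) = (\<integral>\<^sup>+a. ennreal (G a * exp (- b * exp (a - x))) \<partial>lborel)" for x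
    by (rule nn_integral_eq_integral[OF int, symmetric]) (use Gnn in auto)
  have prod: "ennreal (?F (\<xi> + \<eta>) * ?F (\<xi> - \<eta>)) = 2 * (\<integral>\<^sup>+s. K s \<eta> \<partial>lborel)" for \<eta>
  proof -
    have "ennreal (?F (\<xi> + \<eta>) * ?F (\<xi> - \<eta>)) = ennreal (?F (\<xi> + \<eta>)) * ennreal (?F (\<xi> - \<eta>))"
      by (rule ennreal_mult[OF Fnn Fnn])
    also have "\<dots> = 2 * (\<integral>\<^sup>+s. \<integral>\<^sup>+t. ennreal (G (s + t) * exp (- b * exp (s + t - (\<xi> + \<eta>)))) *
         ennreal (G (s - t) * exp (- b * exp (s - t - (\<xi> - \<eta>)))) \<partial>lborel \<partial>lborel)"
      unfolding Fe by (rule nn_integral_times_rotate) measurable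
    also have "\<dots> = 2 * (\<integral>\<^sup>+s. K s \<eta> \<partial>lborel)"
      unfolding K_def
    proof (intro arg_cong[of _ _ "\<lambda>x. 2 * x"] nn_integral_cong)
      fix s t :: real
      have "- b * exp (s + t - (\<xi> + \<eta>)) + - b * exp (s - t - (\<xi> - \<eta>)) = - \<beta> s * (2 * cosh (t - \<eta>))"
        by (simp add: \<beta>_def cosh_def exp_add[symmetric] algebra_simps)
      then have "exp (- b * exp (s + t - (\<xi> + \<eta>))) * exp (- b * exp (s - t - (\<xi> - \<eta>))) = exp (- \<beta> s * (2 * cosh (t - \<eta>)))"
        by (simp only: exp_add[symmetric])
      then show "ennreal (G (s + t) * exp (- b * exp (s + t - (\<xi> + \<eta>)))) *
         ennreal (G (s - t) * exp (- b * exp (s - t - (\<xi> - \<eta>)))) = ennreal (G (s + t) * G (s - t) * exp (- \<beta> s * (2 * cosh (t - \<eta>))))"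
        using Gnn by (subst ennreal_mult[symmetric]) (simp_all add: mult_ac)
    qed
    finally show ?thesis .
  qed
  have Kmeas: "(\<lambda>s. K s \<eta>) \<in> borel_measurable borel" for \<eta>
    unfolding K_def \<beta>_def cosh_def by measurable
  \<comment> \<open>Recovers \<eta> \<ge> 0 from y = 2 cosh \<eta> - 2; a negative \<eta> only
    exchanges the two factors of the product.\<close>
  define H where "H y = arcosh (1 + y / 2)" for y :: real
  have H: "2 * cosh (H y) - 2 = y" if "0 \<le> y" for y using that by (simp add: H_def)
  have H0: "H 0 = 0" by (simp add: H_def)
  have Kcm: "compl_mono (\<lambda>y. enn2real (K s (H y))) \<and> (\<forall>y\<ge>0. K s (H y) < \<infinity>)" if fin: "K s 0 < \<infinity>" for s
  proof -
    from G obtain \<psi> where psi: "compl_mono \<psi>" "\<And>t. G (s + t) * G (s - t) = \<psi> (2 * cosh t - 2)"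
      unfolding log_HCM_def by metis
    obtain \<nu> where nu: "finite_measure \<nu>" "sets \<nu> = sets borel" "AE x in \<nu>. 0 \<le> x"
      and lt: "\<And>s. 0 \<le> s \<Longrightarrow> \<psi> s = (\<integral>x. exp (- s * x) \<partial>\<nu>)"
      by (rule bernstein[OF psi(1)]) (rule that)
    interpret nu: finite_measure \<nu> by fact
    note [measurable_cong] = nu(2)
    interpret P: pair_sigma_finite \<nu> lborel ..
    \<comment> \<open>The factor exp (2 u) undoes the shift by 2 in the argument of \<psi>. Absolute
      values keep W and V under control at every u, whereas \<nu> is carried by u \<ge> 0 only up to
      a null set.\<close>
    define W where "W = (\<lambda>(u, t). exp (2 * \<bar>u\<bar>) * exp (- exp t - (\<bar>u\<bar> + \<beta> s)\<^sup>2 * exp (- t)))"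
    define V where "V = (\<lambda>(u, t). \<bar>u\<bar> * \<beta> s * exp (- t))"
    have W[measurable]: "W \<in> borel_measurable (\<nu> \<Otimes>\<^sub>M lborel)" unfolding W_def by measurable
    have V[measurable]: "V \<in> borel_measurable (\<nu> \<Otimes>\<^sub>M lborel)" unfolding V_def by measurable
    have K: "K s (H y) = (\<integral>\<^sup>+x. ennreal (W x * exp (- V x * y)) \<partial>(\<nu> \<Otimes>\<^sub>M lborel))" if y: "0 \<le> y" for y
    proof -
      have "K s (H y) = (\<integral>\<^sup>+t. \<integral>\<^sup>+u. ennreal (exp (- (2 * cosh t - 2) * u) * exp (- \<beta> s * (2 * cosh (t - H y)))) \<partial>\<nu> \<partial>lborel)"
        unfolding K_def psi(2)
      proof (rule nn_integral_cong)
        fix t :: real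
        have c: "0 \<le> 2 * cosh t - 2" using cosh_real_ge_1[of t] by simp
        have i: "integrable \<nu> (\<lambda>u. exp (- (2 * cosh t - 2) * u))"
        proof (rule nu.integrable_const_bound[of _ 1])
          show "AE u in \<nu>. norm (exp (- (2 * cosh t - 2) * u)) \<le> 1"
            using nu(3) by eventually_elim (use c in \<open>simp add: mult_nonpos_nonneg\<close>)
        qed measurable
        have "ennreal (\<psi> (2 * cosh t - 2)) = (\<integral>\<^sup>+u. ennreal (exp (- (2 * cosh t - 2) * u)) \<partial>\<nu>)"
          unfolding lt[OF c] by (rule nn_integral_eq_integral[OF i, symmetric]) auto
        then show "ennreal (\<psi> (2 * cosh t - 2) * exp (- \<beta> s * (2 * cosh (t - H y)))) =
          (\<integral>\<^sup>+u. ennreal (exp (- (2 * cosh t - 2) * u) * exp (- \<beta> s * (2 * cosh (t - H y)))) \<partial>\<nu>)"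
          using compl_mono_nonneg[OF psi(1) c] by (simp add: ennreal_mult nn_integral_multc)
      qed
      also have "\<dots> = (\<integral>\<^sup>+u. \<integral>\<^sup>+t. ennreal (exp (- (2 * cosh t - 2) * u) * exp (- \<beta> s * (2 * cosh (t - H y)))) \<partial>lborel \<partial>\<nu>)"
        unfolding cosh_def by (rule P.Fubini') measurable
      also have "\<dots> = (\<integral>\<^sup>+u. \<integral>\<^sup>+t. ennreal (W (u, t) * exp (- V (u, t) * y)) \<partial>lborel \<partial>\<nu>)"
      proof (rule nn_integral_cong_AE)
        show "AE u in \<nu>. (\<integral>\<^sup>+t. ennreal (exp (- (2 * cosh t - 2) * u) * exp (- \<beta> s * (2 * cosh (t - H y)))) \<partial>lborel)
           = (\<integral>\<^sup>+t. ennreal (W (u, t) * exp (- V (u, t) * y)) \<partial>lborel)"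
          using nu(3)
        proof eventually_elim
          case (elim u)
          have "exp (- (2 * cosh t - 2) * u) * exp (- \<beta> s * (2 * cosh (t - H y))) =
             exp (2 * u) * exp (- u * (2 * cosh t) - \<beta> s * (2 * cosh (t - H y)))" for t
            unfolding exp_add[symmetric] by (rule arg_cong[of _ _ exp]) (simp add: algebra_simps)
          then have "(\<integral>\<^sup>+t. ennreal (exp (- (2 * cosh t - 2) * u) * exp (- \<beta> s * (2 * cosh (t - H y)))) \<partial>lborel)
            = ennreal (exp (2 * u)) * (\<integral>\<^sup>+t. ennreal (exp (- u * (2 * cosh t) - \<beta> s * (2 * cosh (t - H y)))) \<partial>lborel)"
            by (simp add: ennreal_mult nn_integral_cmult cosh_def)
          also have "\<dots> = ennreal (exp (2 * u)) *
            (\<integral>\<^sup>+t. ennreal (exp (- exp t - (u + \<beta> s)\<^sup>2 * exp (- t) - u * \<beta> s * exp (- t) * y)) \<partial>lborel)"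
            by (subst nn_integral_exp_cosh_shift[OF elim \<beta>]) (simp only: H[OF y])
          also have "\<dots> = (\<integral>\<^sup>+t. ennreal (exp (2 * u) * exp (- exp t - (u + \<beta> s)\<^sup>2 * exp (- t) - u * \<beta> s * exp (- t) * y)) \<partial>lborel)"
            by (simp add: ennreal_mult nn_integral_cmult)
          also have "\<dots> = (\<integral>\<^sup>+t. ennreal (W (u, t) * exp (- V (u, t) * y)) \<partial>lborel)"
            using elim by (intro nn_integral_cong) (simp add: W_def V_def exp_add[symmetric] exp_diff exp_minus divide_inverse mult_ac)
          finally show ?case .
        qed
      qed
      also have "\<dots> = (\<integral>\<^sup>+x. ennreal (W x * exp (- V x * y)) \<partial>(\<nu> \<Otimes>\<^sub>M lborel))"
        by (rule lborel.nn_integral_fst) measurable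
      finally show ?thesis .
    qed
    show ?thesis
      using compl_mono_nn_integral_exp[OF W V _ _ K] fin \<beta>[of s] by (auto simp: W_def V_def H0 less_imp_le)
  qed
  \<comment> \<open>Set to 0 at the exceptional midpoints, so that every \<open>k s\<close> is
    completely monotone and the mixture lemma applies.\<close>
  define k where "k s y = (if K s 0 < \<infinity> then enn2real (K s (H y)) else 0)" for s y
  have tot: "(\<integral>\<^sup>+s. K s 0 \<partial>lborel) < \<infinity>"
    using prod[of 0] by (auto simp: less_top[symmetric] ennreal_mult_eq_top_iff dest: sym)
  have aefin: "AE s in lborel. K s 0 < \<infinity>"
    using nn_integral_PInf_AE[of "\<lambda>s. K s 0" lborel] tot Kmeas by (auto simp: less_top)
  have kmeas[measurable]: "(\<lambda>s. k s y) \<in> borel_measurable lborel" for y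
    using Kmeas[of 0] Kmeas[of "H y"] unfolding k_def by measurable
  have kcm: "compl_mono (k s)" for s
    by (cases "K s 0 < \<infinity>") (use Kcm[of s] in \<open>auto simp: k_def[abs_def] compl_mono_const\<close>)
  have kK: "AE s in lborel. ennreal (k s y) = K s (H y)" if "0 \<le> y" for y
    using aefin by eventually_elim (use Kcm that in \<open>auto simp: k_def less_top\<close>)
  have kint: "integrable lborel (\<lambda>s. k s y)" if y: "0 \<le> y" for y
  proof (rule integrableI_nonneg)
    show "(\<integral>\<^sup>+s. ennreal (k s y) \<partial>lborel) < \<infinity>"
    proof -
      have "(\<integral>\<^sup>+s. ennreal (k s y) \<partial>lborel) \<le> (\<integral>\<^sup>+s. ennreal (k s 0) \<partial>lborel)"
        by (intro nn_integral_mono ennreal_leI compl_mono_antimono[OF kcm]) (use y in auto)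
      also have "\<dots> = (\<integral>\<^sup>+s. K s (H 0) \<partial>lborel)" by (rule nn_integral_cong_AE) (rule kK, simp)
      finally show ?thesis using tot by (simp add: H0)
    qed
    show "AE s in lborel. 0 \<le> k s y" using compl_mono_nonneg[OF kcm y] by simp
  qed measurable
  have "compl_mono (\<lambda>y. 2 * (\<integral>s. k s y \<partial>lborel))"
    by (intro compl_mono_mult compl_mono_const compl_mono_integral kcm kint) auto
  moreover have "?F (\<xi> + \<eta>) * ?F (\<xi> - \<eta>) = 2 * (\<integral>s. k s (2 * cosh \<eta> - 2) \<partial>lborel)" for \<eta>
  proof -
    have pos: "?F (\<xi> + \<eta>) * ?F (\<xi> - \<eta>) = 2 * (\<integral>s. k s (2 * cosh \<eta> - 2) \<partial>lborel)" if "0 \<le> \<eta>" for \<eta>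
    proof -
      have y: "0 \<le> 2 * cosh \<eta> - 2" using cosh_real_ge_1[of \<eta>] by simp
      have h: "H (2 * cosh \<eta> - 2) = \<eta>" using that arcosh_cosh_real[OF that] by (simp add: H_def diff_divide_distrib)
      have "ennreal (?F (\<xi> + \<eta>) * ?F (\<xi> - \<eta>)) = 2 * (\<integral>\<^sup>+s. K s \<eta> \<partial>lborel)" by (rule prod)
      also have "(\<integral>\<^sup>+s. K s \<eta> \<partial>lborel) = (\<integral>\<^sup>+s. ennreal (k s (2 * cosh \<eta> - 2)) \<partial>lborel)"
        using kK[OF y] unfolding h by (intro nn_integral_cong_AE) (auto elim!: eventually_mono)
      also have "\<dots> = ennreal (\<integral>s. k s (2 * cosh \<eta> - 2) \<partial>lborel)"
        by (rule nn_integral_eq_integral[OF kint[OF y]]) (use compl_mono_nonneg[OF kcm y] in auto)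
      also have "2 * \<dots> = ennreal (2 * (\<integral>s. k s (2 * cosh \<eta> - 2) \<partial>lborel))"
        by (subst ennreal_mult) (use compl_mono_nonneg[OF kcm y] in \<open>auto intro!: integral_nonneg_AE\<close>)
      finally show ?thesis
        by (subst (asm) ennreal_inj) (use Fnn compl_mono_nonneg[OF kcm y] in \<open>auto intro!: integral_nonneg_AE mult_nonneg_nonneg\<close>)
    qed
    show ?thesis
    proof (cases "0 \<le> \<eta>")
      case False
      then show ?thesis using pos[of "- \<eta>"] by (simp add: mult.commute)
    qed (rule pos)
  qed
  ultimately show "\<exists>\<psi>. compl_mono \<psi> \<and> (\<forall>\<eta>. ?F (\<xi> + \<eta>) * ?F (\<xi> - \<eta>) = \<psi> (2 * cosh \<eta> - 2))"
    by blast
qed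

section \<open>Closure properties and translation between the two forms of HCM\<close>

lemma log_HCM_exp: "log_HCM (\<lambda>a. exp (c * a))"
  unfolding log_HCM_def
proof (intro conjI allI)
  fix s
  have "exp (c * (s + t)) * exp (c * (s - t)) = exp (2 * c * s)" for t
    by (simp add: exp_add[symmetric] algebra_simps)
  then show "\<exists>\<psi>. compl_mono \<psi> \<and> (\<forall>t. exp (c * (s + t)) * exp (c * (s - t)) = \<psi> (2 * cosh t - 2))"
    by (intro exI[of _ "\<lambda>_. exp (2 * c * s)"]) (simp add: compl_mono_const)
qed simp

lemma log_HCM_const: "0 \<le> c \<Longrightarrow> log_HCM (\<lambda>_. c)"
  unfolding log_HCM_def by (auto intro!: exI[of _ "\<lambda>_. c * c"] compl_mono_const)

lemma log_HCM_mult: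
  assumes "log_HCM F" "log_HCM G"
  shows "log_HCM (\<lambda>a. F a * G a)"
  unfolding log_HCM_def
proof (intro conjI allI)
  show "0 \<le> F a * G a" for a using assms by (simp add: log_HCM_def)
  fix s
  from assms(1) obtain \<phi> where phi: "compl_mono \<phi>" "\<And>t. F (s + t) * F (s - t) = \<phi> (2 * cosh t - 2)"
    unfolding log_HCM_def by metis
  from assms(2) obtain \<psi> where psi: "compl_mono \<psi>" "\<And>t. G (s + t) * G (s - t) = \<psi> (2 * cosh t - 2)"
    unfolding log_HCM_def by metis
  have "F (s + t) * G (s + t) * (F (s - t) * G (s - t)) = \<phi> (2 * cosh t - 2) * \<psi> (2 * cosh t - 2)" for t
    unfolding phi(2)[symmetric] psi(2)[symmetric] by (simp only: mult_ac)
  then show "\<exists>\<psi>. compl_mono \<psi> \<and> (\<forall>t. F (s + t) * G (s + t) * (F (s - t) * G (s - t)) = \<psi> (2 * cosh t - 2))"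
    using compl_mono_mult[OF phi(1) psi(1)] by (intro exI[of _ "\<lambda>y. \<phi> y * \<psi> y"]) simp
qed

lemma log_HCM_reflect:
  assumes "log_HCM G"
  shows "log_HCM (\<lambda>a. G (- a))"
  unfolding log_HCM_def
proof (intro conjI allI)
  show "0 \<le> G (- a)" for a using assms by (simp add: log_HCM_def)
  fix s
  from assms obtain \<psi> where "compl_mono \<psi>" "\<And>t. G (- s + t) * G (- s - t) = \<psi> (2 * cosh t - 2)"
    unfolding log_HCM_def by metis
  then show "\<exists>\<psi>. compl_mono \<psi> \<and> (\<forall>t. G (- (s + t)) * G (- (s - t)) = \<psi> (2 * cosh t - 2))"
    by (intro exI[of _ \<psi>]) (simp add: mult.commute)
qed

text \<open>K may be infinite, but by the case v = 1 the function exp (- 2 k u) has the finite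
  K-integral g u * g u. Writing v + 1 / v as 2 plus (2 cosh t - 2) moves this factor into the
  measure.\<close>

lemma HCM_imp_log_HCM:
  assumes "HCM g"
  shows "log_HCM (\<lambda>a. g (exp a))"
  unfolding log_HCM_def
proof (intro conjI allI)
  show "0 \<le> g (exp a)" for a using assms by (simp add: HCM_def)
  fix s :: real
  define u where "u = exp s"
  have u: "0 < u" by (simp add: u_def)
  from assms u obtain K :: "real measure" where K: "sets K = sets (restrict_space borel {0..})"
    and g: "\<And>v. 0 < v \<Longrightarrow> ennreal (g (u * v) * g (u / v)) = (\<integral>\<^sup>+k. ennreal (exp (- k * u * (v + 1 / v))) \<partial>K)"
    unfolding HCM_def by blast
  have space: "space K = {0..}" using sets_eq_imp_space_eq[OF K] by (simp add: space_restrict_space)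
  note [measurable_cong] = K
  define W where "W k = exp (- 2 * k * u)" for k
  define V where "V k = \<bar>k\<bar> * u" for k
  define L where "L y = (\<integral>\<^sup>+k. ennreal (W k * exp (- V k * y)) \<partial>K)" for y
  have W: "W \<in> borel_measurable K" unfolding W_def measurable_cong_sets[OF K refl]
    by (intro measurable_restrict_space1) measurable
  have V: "V \<in> borel_measurable K" unfolding V_def measurable_cong_sets[OF K refl]
    by (intro measurable_restrict_space1) measurable
  have L: "ennreal (g (exp (s + t)) * g (exp (s - t))) = L (2 * cosh t - 2)" for t
  proof -
    have "ennreal (g (u * exp t) * g (u / exp t)) = (\<integral>\<^sup>+k. ennreal (exp (- k * u * (exp t + 1 / exp t))) \<partial>K)"
      by (rule g) simp
    also have "\<dots> = L (2 * cosh t - 2)"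
      unfolding L_def
    proof (rule nn_integral_cong)
      fix k assume "k \<in> space K"
      then have k: "\<bar>k\<bar> = k" using space by simp
      have "- k * u * (exp t + 1 / exp t) = - 2 * k * u + - V k * (2 * cosh t - 2)"
      proof -
        have c: "exp t + 1 / exp t = 2 * cosh t" by (simp only: cosh_field_def exp_minus inverse_eq_divide) simp
        show ?thesis unfolding V_def k c by (simp add: algebra_simps)
      qed
      then show "ennreal (exp (- k * u * (exp t + 1 / exp t))) = ennreal (W k * exp (- V k * (2 * cosh t - 2)))"
        by (simp only: W_def exp_add[symmetric])
    qed
    finally show ?thesis by (simp add: u_def exp_add exp_diff)
  qed
  have "L (2 * cosh 0 - 2) < \<infinity>" by (subst L[symmetric]) simp
  then have "L 0 < \<infinity>" by simp
  then have "compl_mono (\<lambda>y. enn2real (L y))"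
    by (intro compl_mono_nn_integral_exp(1)[OF W V _ _ L_def]) (use u in \<open>auto simp: W_def V_def\<close>)
  moreover have "g (exp (s + t)) * g (exp (s - t)) = enn2real (L (2 * cosh t - 2))" for t
    using assms by (simp add: L[symmetric] HCM_def)
  ultimately show "\<exists>\<psi>. compl_mono \<psi> \<and> (\<forall>t. g (exp (s + t)) * g (exp (s - t)) = \<psi> (2 * cosh t - 2))"
    by (intro exI[of _ "\<lambda>y. enn2real (L y)"]) simp
qed

text \<open>The finite measure from Bernstein's theorem is rescaled by k = x / u, and the density
  exp (2 k u) restores the factor split off by the shift; the resulting K may be infinite.\<close>

lemma log_HCM_imp_HCM:
  assumes "log_HCM (\<lambda>a. g (exp a))"
  shows "HCM g"
  unfolding HCM_def
proof (intro conjI allI impI)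
  show "0 \<le> g x" if "0 < x" for x
  proof -
    have "0 \<le> g (exp (ln x))" using assms unfolding log_HCM_def by blast
    then show ?thesis using that by simp
  qed
  fix u :: real assume u: "0 < u"
  from assms obtain \<psi> where psi: "compl_mono \<psi>" "\<And>t. g (exp (ln u + t)) * g (exp (ln u - t)) = \<psi> (2 * cosh t - 2)"
    unfolding log_HCM_def by metis
  obtain \<nu> where nu: "finite_measure \<nu>" "sets \<nu> = sets borel" "AE x in \<nu>. 0 \<le> x"
    and lt: "\<And>s. 0 \<le> s \<Longrightarrow> \<psi> s = (\<integral>x. exp (- s * x) \<partial>\<nu>)"
    by (rule bernstein[OF psi(1)]) (rule that)
  interpret nu: finite_measure \<nu> by fact
  note [measurable_cong] = nu(2)
  define K where "K = restrict_space (density (distr \<nu> borel (\<lambda>x. x / u)) (\<lambda>k. ennreal (exp (2 * k * u)))) {0..}"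
  show "\<exists>K :: real measure. sets K = sets (restrict_space borel {0..}) \<and>
        (\<forall>v>0. ennreal (g (u * v) * g (u / v)) = (\<integral>\<^sup>+k. ennreal (exp (- k * u * (v + 1 / v))) \<partial>K))"
  proof (intro exI[of _ K] conjI allI impI)
    show "sets K = sets (restrict_space borel {0..})" unfolding K_def by (rule sets_restrict_space_cong) simp
    fix v :: real assume v: "0 < v"
    define y where "y = 2 * cosh (ln v) - 2"
    have y: "0 \<le> y" using cosh_real_ge_1[of "ln v"] by (simp add: y_def)
    have vy: "v + 1 / v = 2 + y" using v by (simp only: y_def cosh_ln_real inverse_eq_divide) simp
    have i: "integrable \<nu> (\<lambda>x. exp (- y * x))"
    proof (rule nu.integrable_const_bound[of _ 1])
      show "AE x in \<nu>. norm (exp (- y * x)) \<le> 1"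
        using nu(3) by eventually_elim (use y in simp)
    qed measurable
    have "ennreal (g (u * v) * g (u / v)) = ennreal (\<psi> y)"
      using psi(2)[of "ln v"] u v by (simp add: y_def exp_add exp_diff)
    also have "\<dots> = (\<integral>\<^sup>+x. ennreal (exp (- y * x)) \<partial>\<nu>)"
      unfolding lt[OF y] by (rule nn_integral_eq_integral[OF i, symmetric]) auto
    also have "\<dots> = (\<integral>\<^sup>+x. ennreal (exp (2 * (x / u) * u)) * (ennreal (exp (- (x / u) * u * (v + 1 / v))) * indicator {0..} (x / u)) \<partial>\<nu>)"
    proof (rule nn_integral_cong_AE)
      show "AE x in \<nu>. ennreal (exp (- y * x)) =
        ennreal (exp (2 * (x / u) * u)) * (ennreal (exp (- (x / u) * u * (v + 1 / v))) * indicator {0..} (x / u))"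
        using nu(3) by eventually_elim
          (use u in \<open>simp add: vy ennreal_mult[symmetric] exp_add[symmetric] algebra_simps\<close>)
    qed
    also have "\<dots> = (\<integral>\<^sup>+k. ennreal (exp (2 * k * u)) * (ennreal (exp (- k * u * (v + 1 / v))) * indicator {0..} k) \<partial>distr \<nu> borel (\<lambda>x. x / u))"
      by (subst nn_integral_distr) auto
    also have "\<dots> = (\<integral>\<^sup>+k. ennreal (exp (- k * u * (v + 1 / v))) * indicator {0..} k \<partial>density (distr \<nu> borel (\<lambda>x. x / u)) (\<lambda>k. ennreal (exp (2 * k * u))))"
      by (subst nn_integral_density) auto
    also have "\<dots> = (\<integral>\<^sup>+k. ennreal (exp (- k * u * (v + 1 / v))) \<partial>K)"
      unfolding K_def by (subst nn_integral_restrict_space) auto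
    finally show "ennreal (g (u * v) * g (u / v)) = (\<integral>\<^sup>+k. ennreal (exp (- k * u * (v + 1 / v))) \<partial>K)" .
  qed
qed

text \<open>Substitution on the compact intervals from exp (- n) to exp n, then monotone convergence
  on both sides.\<close>

lemma nn_integral_exp_substitution:
  fixes h :: "real \<Rightarrow> real"
  assumes [measurable]: "h \<in> borel_measurable borel"
  shows "(\<integral>\<^sup>+a. ennreal (h a) * indicator {0<..} a \<partial>lborel) = (\<integral>\<^sup>+r. ennreal (h (exp r)) * ennreal (exp r) \<partial>lborel)"
proof -
  have *: "(\<integral>\<^sup>+a. ennreal (h a) * indicator {exp (- real n)..exp (real n)} a \<partial>lborel) =
     (\<integral>\<^sup>+r. ennreal (h (exp r)) * ennreal (exp r) * indicator {- real n..real n} r \<partial>lborel)" for n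
  proof -
    have "(\<integral>\<^sup>+a. ennreal (h a * indicator {exp (- real n)..exp (real n)} a) \<partial>lborel) =
     (\<integral>\<^sup>+r. ennreal (h (exp r) * exp r * indicator {- real n..real n} r) \<partial>lborel)"
      by (rule nn_integral_substitution)
        (auto intro!: derivative_eq_intros continuous_intros simp: set_borel_measurable_def)
    moreover have "ennreal (h a * indicator S a) = ennreal (h a) * indicator S a" for a S
      by (simp add: indicator_def)
    moreover have "ennreal (h (exp r) * exp r * indicator S r) = ennreal (h (exp r)) * ennreal (exp r) * indicator S r" for r S
      by (simp add: indicator_def ennreal_mult'')
    ultimately show ?thesis by simp
  qed
  have 1: "(SUP n::nat. indicator {exp (- real n)..exp (real n)} a) = (indicator {0<..} a :: ennreal)" for a :: real
  proof (cases "0 < a")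
    case True
    obtain n :: nat where "\<bar>ln a\<bar> \<le> real n" using real_arch_simple by blast
    then have "exp (- real n) \<le> exp (ln a)" "exp (ln a) \<le> exp (real n)" by auto
    then have "a \<in> {exp (- real n)..exp (real n)}" using True by simp
    then have "(1::ennreal) \<le> (SUP n::nat. indicator {exp (- real n)..exp (real n)} a)"
      by (intro SUP_upper2[of n]) auto
    moreover have "(SUP n::nat. indicator {exp (- real n)..exp (real n)} a) \<le> (1::ennreal)"
      by (intro SUP_least) (simp add: indicator_def)
    ultimately show ?thesis using True by simp
  next
    case False
    then have "indicator {exp (- real n)..exp (real n)} a = (0::ennreal)" for n
      using exp_gt_zero[of "- real n"] by (auto simp: indicator_def simp del: exp_gt_zero)
    then show ?thesis using False by simp
  qed
  have mono: "indicator {exp (- real m)..exp (real m)} a \<le> (indicator {exp (- real n)..exp (real n)} a :: ennreal)"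
    if "m \<le> n" for m n :: nat and a :: real
  proof (rule indicator_leI)
    assume "a \<in> {exp (- real m)..exp (real m)}"
    moreover have "exp (- real n) \<le> exp (- real m)" "exp (real m) \<le> exp (real n)" using that by auto
    ultimately show "a \<in> {exp (- real n)..exp (real n)}" by (metis atLeastAtMost_iff order_trans)
  qed
  have 2: "(SUP n::nat. indicator {- real n..real n} r) = (1 :: ennreal)" for r :: real
  proof -
    obtain n :: nat where "\<bar>r\<bar> \<le> real n" using real_arch_simple by blast
    then have "r \<in> {- real n..real n}" by auto
    then have "(1::ennreal) \<le> (SUP n::nat. indicator {- real n..real n} r)"
      by (intro SUP_upper2[of n]) auto
    moreover have "(SUP n::nat. indicator {- real n..real n} r) \<le> (1::ennreal)"
      by (intro SUP_least) (simp add: indicator_def)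
    ultimately show ?thesis by simp
  qed
  have "(\<integral>\<^sup>+a. ennreal (h a) * indicator {0<..} a \<partial>lborel) = (\<integral>\<^sup>+a. (SUP n::nat. ennreal (h a) * indicator {exp (- real n)..exp (real n)} a) \<partial>lborel)"
    by (simp add: SUP_mult_left_ennreal[symmetric] 1)
  also have "\<dots> = (SUP n::nat. \<integral>\<^sup>+a. ennreal (h a) * indicator {exp (- real n)..exp (real n)} a \<partial>lborel)"
    by (rule nn_integral_monotone_convergence_SUP)
      (auto simp: incseq_def le_fun_def intro!: mult_left_mono mono)
  also have "\<dots> = (SUP n::nat. \<integral>\<^sup>+r. ennreal (h (exp r)) * ennreal (exp r) * indicator {- real n..real n} r \<partial>lborel)"
    by (simp only: *)
  also have "\<dots> = (\<integral>\<^sup>+r. (SUP n::nat. ennreal (h (exp r)) * ennreal (exp r) * indicator {- real n..real n} r) \<partial>lborel)"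
    by (rule nn_integral_monotone_convergence_SUP[symmetric])
      (auto simp: incseq_def le_fun_def intro!: mult_left_mono split: split_indicator)
  also have "\<dots> = (\<integral>\<^sup>+r. ennreal (h (exp r)) * ennreal (exp r) \<partial>lborel)"
    by (simp add: SUP_mult_left_ennreal[symmetric] 2)
  finally show ?thesis .
qed

section \<open>Densities of products with an exponential variable\<close>

lemma exp_minus_le_inverse: "0 < y \<Longrightarrow> exp (- y) \<le> 1 / (y::real)"
proof -
  assume y: "0 < y"
  have "y \<le> exp y" using exp_ge_add_one_self[of y] by linarith
  then show ?thesis using y by (simp add: exp_minus field_simps)
qed

text \<open>The product has at x > 0 the density l times the integral of g a exp (- l x / a) / a.
  With a = exp r the kernel depends on ln x - r only; reflecting r and ln x brings it to the form of
  \<open>log_HCM_kernel_integral\<close>.\<close>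

lemma HCM_rv_mult_exponential:
  fixes A E X :: "'a \<Rightarrow> real"
  assumes M: "prob_space M" and A: "A \<in> borel_measurable M" and l: "0 < l"
    and E: "distributed M lborel E (exponential_density l)"
    and ind: "prob_space.indep_var M borel A borel E"
    and X: "\<And>\<omega>. \<omega> \<in> space M \<Longrightarrow> X \<omega> = A \<omega> * E \<omega>"
    and hcm: "HCM_rv M A"
  shows "HCM_rv M X"
proof -
  interpret prob_space M by fact
  note [measurable] = A
  have Em[measurable]: "E \<in> borel_measurable M" using distributed_measurable[OF E] by simp
  have Xm[measurable]: "X \<in> borel_measurable M"
    using X by (subst measurable_cong[where g="\<lambda>\<omega>. A \<omega> * E \<omega>"]) auto
  from hcm obtain g where g: "HCM g" and D: "distributed M lborel A (\<lambda>x. ennreal (indicator {0<..} x * g x))"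
    unfolding HCM_rv_def by blast
  have gnn: "0 \<le> g x" if "0 < x" for x using g that by (simp add: HCM_def)
  \<comment> \<open>Measurability is known only for the density with its indicator;
    \<open>g0\<close> carries it and agrees with g on the half-line.\<close>
  define g0 where "g0 x = indicator {0<..} x * g x" for x
  have g0nn: "0 \<le> g0 x" for x using gnn by (simp add: g0_def indicator_def)
  have "(\<lambda>x. ennreal (g0 x)) \<in> borel_measurable borel"
    using distributed_borel_measurable[OF D] by (simp add: g0_def)
  then have "(\<lambda>x. enn2real (ennreal (g0 x))) \<in> borel_measurable borel" by measurable
  then have g0m[measurable]: "g0 \<in> borel_measurable borel" using g0nn by simp
  define G where "G a = g (exp a)" for a
  have G0: "G a = g0 (exp a)" for a by (simp add: G_def g0_def)
  have Gm[measurable]: "G \<in> borel_measurable borel" unfolding G0[abs_def] by measurable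
  have Gnn: "0 \<le> G a" for a by (simp add: G0 g0nn)
  have "log_HCM G" unfolding G_def[abs_def] by (rule HCM_imp_log_HCM[OF g])
  then have lG: "log_HCM (\<lambda>a. G (- a))" by (rule log_HCM_reflect)
  have "(\<integral>\<^sup>+r. ennreal (g0 (exp r)) * ennreal (exp r) \<partial>lborel) = (\<integral>\<^sup>+a. ennreal (g0 a) * indicator {0<..} a \<partial>lborel)"
    by (rule nn_integral_exp_substitution[symmetric]) measurable
  also have "\<dots> = (\<integral>\<^sup>+a. ennreal (g0 a) * 1 \<partial>lborel)"
    by (rule nn_integral_cong) (simp add: g0_def indicator_def)
  also have "\<dots> = (\<integral>\<^sup>+\<omega>. 1 \<partial>M)"
    using distributed_nn_integral[OF D, of "\<lambda>_. 1"] by (simp add: g0_def)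
  finally have "(\<integral>\<^sup>+r. ennreal (G r * exp r) \<partial>lborel) = 1" 
    by (simp add: emeasure_space_1 G0 ennreal_mult g0nn)
  then have GI: "integrable lborel (\<lambda>r. G r * exp r)"
    by (intro integrableI_nonneg) (auto simp: Gnn)
  \<comment> \<open>Since exp (- y) \<le> 1 / y, the integrand is at most a constant times G r exp
    r, which is the density of ln A.\<close>
  have intr: "integrable lborel (\<lambda>r. G r * exp (- l * exp (\<xi> - r)))" for \<xi>
  proof (rule Bochner_Integration.integrable_bound)
    show "integrable lborel (\<lambda>r. exp (- \<xi>) / l * (G r * exp r))" using GI by simp
    show "AE r in lborel. norm (G r * exp (- l * exp (\<xi> - r))) \<le> norm (exp (- \<xi>) / l * (G r * exp r))"
    proof (rule AE_I2)
      fix r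
      have "exp (- (l * exp (\<xi> - r))) \<le> 1 / (l * exp (\<xi> - r))" by (rule exp_minus_le_inverse) (use l in simp)
      also have "\<dots> = exp (- \<xi>) / l * exp r" by (simp add: exp_diff exp_minus field_simps)
      finally have "G r * exp (- (l * exp (\<xi> - r))) \<le> G r * (exp (- \<xi>) / l * exp r)"
        by (rule mult_left_mono) (rule Gnn)
      then show "norm (G r * exp (- l * exp (\<xi> - r))) \<le> norm (exp (- \<xi>) / l * (G r * exp r))"
        using l Gnn[of r] by (simp add: abs_mult mult_ac)
    qed
  qed measurable
  define F where "F x = l * (\<integral>r. G r * exp (- l * exp (ln x - r)) \<partial>lborel)" for x
  have Fnn: "0 \<le> F x" for x unfolding F_def using l Gnn by (intro mult_nonneg_nonneg integral_nonneg_AE AE_I2) auto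
  have "HCM F"
  proof (rule log_HCM_imp_HCM)
    have refl: "(\<integral>r. G r * exp (- l * exp (\<xi> - r)) \<partial>lborel) = (\<integral>a. G (- a) * exp (- l * exp (a - (- \<xi>))) \<partial>lborel)" for \<xi>
      using lborel_integral_real_affine[of "- 1" "\<lambda>r. G r * exp (- l * exp (\<xi> - r))" 0] by (simp add: add.commute)
    have "integrable lborel (\<lambda>a. G (- a) * exp (- l * exp (a - \<xi>)))" for \<xi>
      using lborel_integrable_real_affine[OF intr[of "- \<xi>"], of "- 1" 0] by (simp add: algebra_simps)
    then have "log_HCM (\<lambda>\<xi>. \<integral>a. G (- a) * exp (- l * exp (a - \<xi>)) \<partial>lborel)"
      by (intro log_HCM_kernel_integral[OF lG _ l]) auto
    from log_HCM_mult[OF log_HCM_const[OF less_imp_le[OF l]] log_HCM_reflect[OF this]]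
    have "log_HCM (\<lambda>a. l * (\<integral>x. G (- x) * exp (- l * exp (x - - a)) \<partial>lborel))" by simp
    moreover have "F (exp a) = l * (\<integral>x. G (- x) * exp (- l * exp (x - - a)) \<partial>lborel)" for a
      by (simp only: F_def ln_exp refl)
    ultimately show "log_HCM (\<lambda>a. F (exp a))" by (simp only:)
  qed
  moreover have "distributed M lborel X (\<lambda>x. ennreal (indicator {0<..} x * F x))"
  proof -
    \<comment> \<open>x = 0 is set aside: there \<open>exponential_density\<close> takes the value l
      while the claimed density vanishes, a difference on a null set.\<close>
    have inner: "(\<integral>\<^sup>+a. ennreal (g0 a) * ennreal (1 / a * exponential_density l (x / a)) \<partial>lborel) = ennreal (indicator {0<..} x * F x)"
      if "x \<noteq> 0" for x
    proof (cases "0 < x")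
      case True
      define h where "h a = g0 a * (1 / a * exponential_density l (x / a))" for a
      have hm: "h \<in> borel_measurable borel" unfolding h_def by measurable
      have "(\<integral>\<^sup>+a. ennreal (g0 a) * ennreal (1 / a * exponential_density l (x / a)) \<partial>lborel) = (\<integral>\<^sup>+a. ennreal (h a) * indicator {0<..} a \<partial>lborel)"
        
      proof (rule nn_integral_cong)
        fix a
        show "ennreal (g0 a) * ennreal (1 / a * exponential_density l (x / a)) = ennreal (h a) * indicator {0<..} a"
          unfolding h_def ennreal_mult'[OF g0nn] by (simp add: g0_def indicator_def)
      qed
      also have "\<dots> = (\<integral>\<^sup>+r. ennreal (h (exp r)) * ennreal (exp r) \<partial>lborel)"
        by (rule nn_integral_exp_substitution[OF hm])
      also have "\<dots> = (\<integral>\<^sup>+r. ennreal (l * (G r * exp (- l * exp (ln x - r)))) \<partial>lborel)"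
      proof (rule nn_integral_cong)
        fix r
        have "h (exp r) * exp r = l * (G r * exp (- l * exp (ln x - r)))"
          using True by (simp add: h_def G0 exponential_density_def exp_diff divide_less_0_iff mult_ac)
        then show "ennreal (h (exp r)) * ennreal (exp r) = ennreal (l * (G r * exp (- l * exp (ln x - r))))"
          by (simp add: ennreal_mult''[symmetric])
      qed
      also have "\<dots> = ennreal (F x)"
        unfolding F_def using intr[of "ln x"] l Gnn
        by (subst nn_integral_eq_integral) auto
      finally show ?thesis using True by simp
    next
      case False
      have "g0 a * (1 / a * exponential_density l (x / a)) = 0" for a
        using False that by (simp add: g0_def indicator_def exponential_density_def divide_less_0_iff)
      then have "ennreal (g0 a) * ennreal (1 / a * exponential_density l (x / a)) = 0" for a
        by (metis ennreal_0 ennreal_mult' g0nn)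
      then have "(\<integral>\<^sup>+a. ennreal (g0 a) * ennreal (1 / a * exponential_density l (x / a)) \<partial>lborel) = (\<integral>\<^sup>+a. 0 \<partial>(lborel :: real measure))"
        by (intro nn_integral_cong) simp
      then show ?thesis using False by simp
    qed
    have Fm: "(\<lambda>x. ennreal (indicator {0<..} x * F x)) \<in> borel_measurable lborel"
      unfolding F_def by measurable
    have "distr M lborel X = density lborel (\<lambda>x. ennreal (indicator {0<..} x * F x))"
    proof (rule measure_eqI)
      fix B assume "B \<in> sets (distr M lborel X)"
      then have B[measurable]: "B \<in> sets borel" by simp
      have "emeasure (distr M lborel X) B = (\<integral>\<^sup>+x. indicator B x \<partial>distr M lborel X)" by simp
      also have "\<dots> = (\<integral>\<^sup>+\<omega>. indicator B (X \<omega>) \<partial>M)"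
        by (rule nn_integral_distr) auto
      also have "\<dots> = (\<integral>\<^sup>+\<omega>. indicator B (A \<omega> * E \<omega>) \<partial>M)"
        by (rule nn_integral_cong) (simp add: X)
      also have "\<dots> = (\<integral>\<^sup>+\<omega>. \<integral>\<^sup>+y. indicator B (A \<omega> * y) * ennreal (exponential_density l y) \<partial>lborel \<partial>M)"
        by (rule nn_integral_indep_exponential[OF M A l E ind, of "\<lambda>a y. indicator B (a * y)"]) measurable
      also have "\<dots> = (\<integral>\<^sup>+a. ennreal (g0 a) * (\<integral>\<^sup>+y. indicator B (a * y) * ennreal (exponential_density l y) \<partial>lborel) \<partial>lborel)"
        unfolding g0_def by (rule distributed_nn_integral[OF D, symmetric]) measurable
      also have "\<dots> = (\<integral>\<^sup>+a. \<integral>\<^sup>+x. indicator B x * (ennreal (g0 a) * ennreal (1 / a * exponential_density l (x / a))) \<partial>lborel \<partial>lborel)"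
      proof (rule nn_integral_cong)
        fix a :: real
        show "ennreal (g0 a) * (\<integral>\<^sup>+y. indicator B (a * y) * ennreal (exponential_density l y) \<partial>lborel) =
          (\<integral>\<^sup>+x. indicator B x * (ennreal (g0 a) * ennreal (1 / a * exponential_density l (x / a))) \<partial>lborel)"
        proof (cases "0 < a")
          case True
          have "(\<integral>\<^sup>+y. indicator B (a * y) * ennreal (exponential_density l y) \<partial>lborel) =
            ennreal \<bar>1 / a\<bar> * (\<integral>\<^sup>+x. indicator B (a * (0 + 1 / a * x)) * ennreal (exponential_density l (0 + 1 / a * x)) \<partial>lborel)"
            by (rule nn_integral_real_affine) (use True in auto)
          also have "\<dots> = (\<integral>\<^sup>+x. indicator B x * ennreal (1 / a * exponential_density l (x / a)) \<partial>lborel)"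
          proof -
            have "ennreal \<bar>1 / a\<bar> * (indicator B (a * (0 + 1 / a * x)) * ennreal (exponential_density l (0 + 1 / a * x))) =
              indicator B x * ennreal (1 / a * exponential_density l (x / a))" for x
            proof -
              have "ennreal (1 / a * exponential_density l (x / a)) = ennreal (1 / a) * ennreal (exponential_density l (x / a))"
                by (rule ennreal_mult) (use True l in \<open>auto simp: exponential_density_nonneg\<close>)
              then show ?thesis using True by (simp only:) (simp add: mult_ac)
            qed
            then show ?thesis by (subst nn_integral_cmult[symmetric]) auto
          qed
          finally show ?thesis by (simp add: nn_integral_cmult[symmetric] mult_ac)
        qed (simp add: g0_def)
      qed
      also have "\<dots> = (\<integral>\<^sup>+x. \<integral>\<^sup>+a. indicator B x * (ennreal (g0 a) * ennreal (1 / a * exponential_density l (x / a))) \<partial>lborel \<partial>lborel)"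
        by (rule lborel_pair.Fubini') measurable
      also have "\<dots> = (\<integral>\<^sup>+x. indicator B x * ennreal (indicator {0<..} x * F x) \<partial>lborel)"
      proof (rule nn_integral_cong_AE)
        show "AE x in lborel. (\<integral>\<^sup>+a. indicator B x * (ennreal (g0 a) * ennreal (1 / a * exponential_density l (x / a))) \<partial>lborel)
          = indicator B x * ennreal (indicator {0<..} x * F x)"
          using AE_lborel_singleton[of 0]
        proof eventually_elim
          case (elim x)
          have "(\<integral>\<^sup>+a. indicator B x * (ennreal (g0 a) * ennreal (1 / a * exponential_density l (x / a))) \<partial>lborel)
            = indicator B x * (\<integral>\<^sup>+a. ennreal (g0 a) * ennreal (1 / a * exponential_density l (x / a)) \<partial>lborel)"
            by (rule nn_integral_cmult) measurable
          also have "\<dots> = indicator B x * ennreal (indicator {0<..} x * F x)"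
            using elim by (subst inner) auto
          finally show ?case .
        qed
      qed
      also have "\<dots> = emeasure (density lborel (\<lambda>x. ennreal (indicator {0<..} x * F x))) B"
        using Fm by (simp add: emeasure_density mult.commute)
      finally show "emeasure (distr M lborel X) B = emeasure (density lborel (\<lambda>x. ennreal (indicator {0<..} x * F x))) B" .
    qed simp
    then show ?thesis using Fm by (simp add: distributed_def)
  qed
  ultimately show ?thesis unfolding HCM_rv_def by blast
qed

section \<open>HCM property of Laplace transforms\<close>

lemma log_HCM_GGC_laplace:
  fixes \<mu> :: "real measure"
  assumes a: "0 \<le> a" and sets: "sets \<mu> = sets (restrict_space borel {0<..})"
    and int: "\<And>s. 0 \<le> s \<Longrightarrow> integrable \<mu> (\<lambda>u. ln (1 + s / u))"
  shows "log_HCM (\<lambda>r. exp (- a * exp r - (\<integral>u. ln (1 + exp r / u) \<partial>\<mu>)))"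
  unfolding log_HCM_def
proof (intro conjI allI)
  have space: "space \<mu> = {0<..}" using sets_eq_imp_space_eq[OF sets] by (simp add: space_restrict_space)
  have meas: "f \<in> borel_measurable \<mu>" if "f \<in> borel_measurable borel" for f :: "real \<Rightarrow> real"
    unfolding measurable_cong_sets[OF sets refl] using that by (rule measurable_restrict_space1)
  fix s :: real
  define x where "x = exp s"
  have x: "0 < x" by (simp add: x_def)
  \<comment> \<open>The product of 1 + x exp t / u and 1 + x exp (- t) / u is affine in y = 2 cosh t
    - 2; this is why the Laplace transform of a GGC is HCM.\<close>
  define L where "L y u = ln (1 + x\<^sup>2 / u\<^sup>2 + x / u * (2 + y))" for y u
  have L2: "L (2 * cosh t - 2) u = ln (1 + exp (s + t) / u) + ln (1 + exp (s - t) / u)" if u: "0 < u" for t u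
  proof -
    have c: "2 * cosh t = exp t + exp (- t)" by (simp add: cosh_field_def)
    have "(1 + exp (s + t) / u) * (1 + exp (s - t) / u) = 1 + x\<^sup>2 / u\<^sup>2 + x / u * (exp t + exp (- t))"
    proof -
      have "exp (s + t) * exp (s - t) = x\<^sup>2" by (simp add: x_def exp_add[symmetric] power2_eq_square)
      moreover have "exp (s + t) = x * exp t" "exp (s - t) = x * exp (- t)"
        by (simp_all add: x_def exp_add exp_diff exp_minus divide_inverse)
      ultimately show ?thesis using u by (simp add: field_simps power2_eq_square)
    qed
    then have "L (2 * cosh t - 2) u = ln ((1 + exp (s + t) / u) * (1 + exp (s - t) / u))"
      by (simp add: L_def c)
    also have "\<dots> = ln (1 + exp (s + t) / u) + ln (1 + exp (s - t) / u)"
      using u by (intro ln_mult_pos) (auto intro!: add_pos_nonneg)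
    finally show ?thesis .
  qed
  have Lint2: "integrable \<mu> (L (2 * cosh t - 2))" and Lval: "(\<integral>u. L (2 * cosh t - 2) u \<partial>\<mu>) =
     (\<integral>u. ln (1 + exp (s + t) / u) \<partial>\<mu>) + (\<integral>u. ln (1 + exp (s - t) / u) \<partial>\<mu>)" for t
  proof -
    have i: "integrable \<mu> (\<lambda>u. ln (1 + exp (s + t) / u) + ln (1 + exp (s - t) / u))"
      by (intro Bochner_Integration.integrable_add int) auto
    show "integrable \<mu> (L (2 * cosh t - 2))"
      using i by (subst Bochner_Integration.integrable_cong[OF refl, of \<mu> _ "\<lambda>u. ln (1 + exp (s + t) / u) + ln (1 + exp (s - t) / u)"])
        (auto simp: L2 space)
    have "(\<integral>u. L (2 * cosh t - 2) u \<partial>\<mu>) = (\<integral>u. ln (1 + exp (s + t) / u) + ln (1 + exp (s - t) / u) \<partial>\<mu>)"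
      by (rule Bochner_Integration.integral_cong) (auto simp: L2 space)
    also have "\<dots> = (\<integral>u. ln (1 + exp (s + t) / u) \<partial>\<mu>) + (\<integral>u. ln (1 + exp (s - t) / u) \<partial>\<mu>)"
      by (intro Bochner_Integration.integral_add int) auto
    finally show "(\<integral>u. L (2 * cosh t - 2) u \<partial>\<mu>) = \<dots>" .
  qed
  \<comment> \<open>Every y \<ge> 0 is 2 cosh t - 2 for some t, so integrability comes from that of
    the two logarithms.\<close>
  have Lint: "integrable \<mu> (L y)" if "0 \<le> y" for y
    using Lint2[of "arcosh (1 + y / 2)"] that by simp
  define \<psi> where "\<psi> y = exp (- a * x * (2 + y) - (\<integral>u. L y u \<partial>\<mu>))" for y
  have "compl_mono \<psi>"
    unfolding compl_mono_def
  proof (intro allI impI)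
    fix c :: real assume c: "0 < c"
    \<comment> \<open>Factoring out the value at y = c leaves 1 - \<open>\<rho> u\<close> z with
      \<open>\<rho> u\<close> in [0, 1). Minus its logarithm has nonnegative coefficients, a
      property kept by integration over \<mu> and by exp.\<close>
    define \<rho> where "\<rho> u = c * (x / u) / (1 + x\<^sup>2 / u\<^sup>2 + x / u * (2 + c))" for u
    have \<rho>: "0 \<le> \<rho> u" "\<rho> u < 1" and Lz: "0 \<le> z \<Longrightarrow> z \<le> 1 \<Longrightarrow> L (c * (1 - z)) u = L c u + ln (1 - \<rho> u * z)" if u: "0 < u" for u z
    proof -
      define T where "T = 1 + x\<^sup>2 / u\<^sup>2 + x / u * (2 + c)"
      have xu: "0 < x / u" using x u by simp
      have "T = 1 + x\<^sup>2 / u\<^sup>2 + (2 * (x / u) + c * (x / u))" using u by (simp add: T_def field_simps)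
      moreover have cxu: "0 \<le> c * (x / u)" by (rule mult_nonneg_nonneg[OF less_imp_le[OF c] less_imp_le[OF xu]])
      moreover have "0 \<le> x\<^sup>2 / u\<^sup>2" by simp
      ultimately have T: "0 < T" "c * (x / u) < T" using xu by linarith+
      have rT: "\<rho> u = c * (x / u) / T" by (simp only: \<rho>_def T_def)
      from cxu show r: "0 \<le> \<rho> u" "\<rho> u < 1" unfolding rT using T by (auto intro!: divide_nonneg_pos simp only: divide_less_eq_1_pos)
      assume z: "0 \<le> z" "z \<le> 1"
      have rz: "\<rho> u * z < 1" using mult_left_le[OF z(2) r(1)] r(2) by linarith
      have "T * (1 - \<rho> u * z) = T - (c * (x / u)) * z" unfolding rT using T(1) by (simp add: right_diff_distrib)
      also have "\<dots> = 1 + x\<^sup>2 / u\<^sup>2 + x / u * (2 + c * (1 - z))" by (simp add: T_def algebra_simps)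
      finally have "L (c * (1 - z)) u = ln (T * (1 - \<rho> u * z))" by (simp add: L_def)
      also have "\<dots> = ln T + ln (1 - \<rho> u * z)" using T rz by (intro ln_mult_pos) auto
      finally show "L (c * (1 - z)) u = L c u + ln (1 - \<rho> u * z)" by (simp add: L_def T_def)
    qed
    define R where "R u z = - ln (1 - \<rho> u * z ^ 1)" for u z
    have Rps: "nonneg_ps (R u)" if "u \<in> space \<mu>" for u
      unfolding R_def using \<rho>[of u] that space by (intro nonneg_ps_neg_ln nonneg_ps_monom) auto
    have RL: "R u z = L c u - L (c * (1 - z)) u" if "u \<in> space \<mu>" "0 \<le> z" "z \<le> 1" for u z
      using Lz[of u z] that space by (simp add: R_def)
    have Rint: "integrable \<mu> (\<lambda>u. R u z)" and Rval: "(\<integral>u. R u z \<partial>\<mu>) = (\<integral>u. L c u \<partial>\<mu>) - (\<integral>u. L (c * (1 - z)) u \<partial>\<mu>)"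
      if z: "0 \<le> z" "z \<le> 1" for z
    proof -
      have i: "integrable \<mu> (L c)" "integrable \<mu> (L (c * (1 - z)))" using z c by (auto intro!: Lint)
      show "integrable \<mu> (\<lambda>u. R u z)"
        using Bochner_Integration.integrable_diff[OF i]
        by (subst Bochner_Integration.integrable_cong[OF refl, of \<mu> _ "\<lambda>u. L c u - L (c * (1 - z)) u"]) (auto simp: RL z)
      have "(\<integral>u. R u z \<partial>\<mu>) = (\<integral>u. L c u - L (c * (1 - z)) u \<partial>\<mu>)"
        by (rule Bochner_Integration.integral_cong) (auto simp: RL z)
      then show "(\<integral>u. R u z \<partial>\<mu>) = (\<integral>u. L c u \<partial>\<mu>) - (\<integral>u. L (c * (1 - z)) u \<partial>\<mu>)"
        using i by simp
    qed
    have "nonneg_ps (\<lambda>z. \<integral>u. R u z \<partial>\<mu>)"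
      by (rule nonneg_ps_integral) (use Rps Rint in auto)
    then have "nonneg_ps (\<lambda>z. exp (- a * x * (2 + c) - (\<integral>u. L c u \<partial>\<mu>)) * (exp (a * x * c * z ^ 1) * exp (\<integral>u. R u z \<partial>\<mu>)))"
      using a x c by (intro nonneg_ps_cmult nonneg_ps_mult nonneg_ps_exp nonneg_ps_monom) auto
    then show "nonneg_ps (\<lambda>z. \<psi> (c * (1 - z)))"
    proof (rule nonneg_ps_cong[rotated])
      fix z :: real assume "0 \<le> z" "z \<le> 1"
      then show "exp (- a * x * (2 + c) - (\<integral>u. L c u \<partial>\<mu>)) * (exp (a * x * c * z ^ 1) * exp (\<integral>u. R u z \<partial>\<mu>)) = \<psi> (c * (1 - z))"
        by (simp add: Rval \<psi>_def exp_add[symmetric] algebra_simps)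
    qed
  qed
  moreover have "exp (- a * exp (s + t) - (\<integral>u. ln (1 + exp (s + t) / u) \<partial>\<mu>)) *
      exp (- a * exp (s - t) - (\<integral>u. ln (1 + exp (s - t) / u) \<partial>\<mu>)) = \<psi> (2 * cosh t - 2)" for t
  proof -
    have c: "2 * cosh t = exp t + exp (- t)" by (simp add: cosh_field_def)
    have "a * x * (2 * cosh t) = a * exp (s + t) + a * exp (s - t)"
      unfolding c x_def by (simp add: exp_add exp_diff exp_minus divide_inverse algebra_simps)
    then show ?thesis by (simp add: \<psi>_def Lval exp_add[symmetric])
  qed
  ultimately show "\<exists>\<psi>. compl_mono \<psi> \<and> (\<forall>t. exp (- a * exp (s + t) - (\<integral>u. ln (1 + exp (s + t) / u) \<partial>\<mu>)) *
      exp (- a * exp (s - t) - (\<integral>u. ln (1 + exp (s - t) / u) \<partial>\<mu>)) = \<psi> (2 * cosh t - 2))"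
    by blast
qed simp

text \<open>l / (l + s A) is the integral of exp (- s A y) against the exponential density;
  exchanging integrals leaves \<phi> (s y) against l exp (- l y). Substituting a = ln (s y) with s =
  exp \<xi> gives l exp (- \<xi>) times a kernel integral, so the HCM property passes from \<phi> to
  the mixture.\<close>

lemma log_HCM_exponential_mixture:
  fixes A :: "'a \<Rightarrow> real"
  assumes M: "prob_space M" and [measurable]: "A \<in> borel_measurable M" and nn: "\<And>\<omega>. 0 < A \<omega>"
    and l: "0 < l" and hcm: "log_HCM (\<lambda>r. \<integral>\<omega>. exp (- exp r * A \<omega>) \<partial>M)"
  shows "log_HCM (\<lambda>r. \<integral>\<omega>. l / (l + exp r * A \<omega>) \<partial>M)"
proof -
  interpret prob_space M by fact
  interpret P: pair_sigma_finite M lborel ..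
  define \<phi> where "\<phi> s = (\<integral>\<omega>. exp (- s * A \<omega>) \<partial>M)" for s
  have [measurable]: "\<phi> \<in> borel_measurable borel" unfolding \<phi>_def by measurable
  have phinn: "0 \<le> \<phi> s" for s unfolding \<phi>_def by (rule Bochner_Integration.integral_nonneg) simp
  \<comment> \<open>The factor exp a is the Jacobian of the logarithmic substitution; it is a power
    of the original variable and therefore HCM.\<close>
  define G where "G a = exp (1 * a) * \<phi> (exp a)" for a
  have [measurable]: "G \<in> borel_measurable borel" unfolding G_def by measurable
  have Gnn: "0 \<le> G a" for a using phinn by (simp add: G_def)
  have Ghcm: "log_HCM G" unfolding G_def \<phi>_def by (rule log_HCM_mult[OF log_HCM_exp hcm])
  have eq: "ennreal (\<integral>\<omega>. l / (l + exp \<xi> * A \<omega>) \<partial>M) =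
    (\<integral>\<^sup>+a. ennreal (l * exp (- \<xi>) * (G a * exp (- l * exp (a - \<xi>)))) \<partial>lborel)" for \<xi>
  proof -
    define s where "s = exp \<xi>"
    have s: "0 < s" by (simp add: s_def)
    have sA: "0 < s * A \<omega>" for \<omega> using s nn by simp
    have nn': "0 \<le> l / (l + s * A \<omega>)" "l / (l + s * A \<omega>) \<le> 1" for \<omega> using l sA[of \<omega>] by auto
    have "ennreal (\<integral>\<omega>. l / (l + s * A \<omega>) \<partial>M) = (\<integral>\<^sup>+\<omega>. ennreal (l / (l + s * A \<omega>)) \<partial>M)"
    proof (rule nn_integral_eq_integral[symmetric])
      have "norm (l / (l + s * A \<omega>)) \<le> 1" for \<omega>
        using nn'[of \<omega>] by (simp only: real_norm_def abs_of_nonneg)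
      then show "integrable M (\<lambda>\<omega>. l / (l + s * A \<omega>))"
        by (intro integrable_const_bound[of _ 1] AE_I2) auto
    qed (use nn' in auto)
    also have "\<dots> = (\<integral>\<^sup>+\<omega>. \<integral>\<^sup>+y. ennreal (exp (- (s * A \<omega> * y))) * ennreal (exponential_density l y) \<partial>lborel \<partial>M)"
      by (rule nn_integral_cong, rule nn_integral_exp_exponential_density[OF l, symmetric]) (use sA in \<open>simp add: less_imp_le\<close>)
    also have "\<dots> = (\<integral>\<^sup>+y. \<integral>\<^sup>+\<omega>. ennreal (exp (- (s * A \<omega> * y))) * ennreal (exponential_density l y) \<partial>M \<partial>lborel)"
      by (rule P.Fubini'[symmetric]) measurable
    also have "\<dots> = (\<integral>\<^sup>+y. ennreal (\<phi> (s * y) * (l * exp (- y * l))) * indicator {0<..} y \<partial>lborel)"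
    proof (rule nn_integral_cong_AE)
      show "AE y in lborel. (\<integral>\<^sup>+\<omega>. ennreal (exp (- (s * A \<omega> * y))) * ennreal (exponential_density l y) \<partial>M)
         = ennreal (\<phi> (s * y) * (l * exp (- y * l))) * indicator {0<..} y"
        using AE_lborel_singleton[of 0]
      proof eventually_elim
        case (elim y)
        show ?case
        proof (cases "0 < y")
          case True
          have "integrable M (\<lambda>\<omega>. exp (- (s * A \<omega> * y)))"
            by (rule integrable_const_bound[of _ 1]) (use True sA in \<open>auto intro!: AE_I2 simp: less_imp_le\<close>)
          then have "(\<integral>\<^sup>+\<omega>. ennreal (exp (- (s * A \<omega> * y))) \<partial>M) = ennreal (\<phi> (s * y))"
            unfolding \<phi>_def by (subst nn_integral_eq_integral) (auto simp: mult_ac)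
          then show ?thesis using True l phinn
            by (simp add: nn_integral_multc exponential_density_def ennreal_mult)
        next
          case False
          then show ?thesis using elim by (simp add: exponential_density_def)
        qed
      qed
    qed
    also have "\<dots> = (\<integral>\<^sup>+r. ennreal (\<phi> (s * exp r) * (l * exp (- exp r * l))) * ennreal (exp r) \<partial>lborel)"
      by (rule nn_integral_exp_substitution) measurable
    also have "\<dots> = ennreal \<bar>1\<bar> * (\<integral>\<^sup>+a. ennreal (\<phi> (s * exp (- \<xi> + 1 * a)) * (l * exp (- exp (- \<xi> + 1 * a) * l))) * ennreal (exp (- \<xi> + 1 * a)) \<partial>lborel)"
      by (rule nn_integral_real_affine) measurable
    also have "\<dots> = (\<integral>\<^sup>+a. ennreal (l * exp (- \<xi>) * (G a * exp (- l * exp (a - \<xi>)))) \<partial>lborel)"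
    proof -
      have "\<phi> (s * exp (- \<xi> + 1 * a)) * (l * exp (- exp (- \<xi> + 1 * a) * l)) * exp (- \<xi> + 1 * a) =
        l * exp (- \<xi>) * (G a * exp (- l * exp (a - \<xi>)))" for a
      proof -
        have "s * exp (- \<xi> + 1 * a) = exp a" by (simp add: s_def exp_add[symmetric])
        moreover have "exp (- \<xi> + 1 * a) = exp (- \<xi>) * exp a" by (simp add: exp_add[symmetric])
        moreover have "exp (a - \<xi>) = exp (- \<xi>) * exp a" by (simp add: exp_add[symmetric])
        ultimately show ?thesis by (simp only: G_def) (simp add: mult_ac)
      qed
      then have "ennreal (\<phi> (s * exp (- \<xi> + 1 * a)) * (l * exp (- exp (- \<xi> + 1 * a) * l))) * ennreal (exp (- \<xi> + 1 * a)) =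
        ennreal (l * exp (- \<xi>) * (G a * exp (- l * exp (a - \<xi>))))" for a
        by (subst ennreal_mult''[symmetric]) (simp_all only: exp_ge_zero)
      then show ?thesis by (simp only: abs_one ennreal_1 mult_1_left)
    qed
    finally show ?thesis by (simp only: s_def)
  qed
  have int: "integrable lborel (\<lambda>a. G a * exp (- l * exp (a - \<xi>)))" for \<xi>
  proof -
    have "integrable lborel (\<lambda>a. l * exp (- \<xi>) * (G a * exp (- l * exp (a - \<xi>))))"
      by (rule integrableI_nonneg) (use l Gnn eq[of \<xi>, symmetric] in auto)
    then show ?thesis using l by simp
  qed
  have "(\<integral>\<omega>. l / (l + exp \<xi> * A \<omega>) \<partial>M) = l * (exp (- 1 * \<xi>) * (\<integral>a. G a * exp (- l * exp (a - \<xi>)) \<partial>lborel))" for \<xi>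
  proof -
    have "ennreal (\<integral>\<omega>. l / (l + exp \<xi> * A \<omega>) \<partial>M) = ennreal (\<integral>a. l * exp (- \<xi>) * (G a * exp (- l * exp (a - \<xi>))) \<partial>lborel)"
      unfolding eq by (rule nn_integral_eq_integral) (use int l Gnn in auto)
    moreover have "0 \<le> (\<integral>\<omega>. l / (l + exp \<xi> * A \<omega>) \<partial>M)"
      using l nn by (intro Bochner_Integration.integral_nonneg divide_nonneg_nonneg add_nonneg_nonneg) (auto simp: less_imp_le)
    moreover have "0 \<le> (\<integral>a. l * exp (- \<xi>) * (G a * exp (- l * exp (a - \<xi>))) \<partial>lborel)"
      using l Gnn by (intro Bochner_Integration.integral_nonneg) auto
    ultimately show ?thesis by (simp add: mult.assoc)
  qed
  moreover have "log_HCM (\<lambda>\<xi>. l * (exp (- 1 * \<xi>) * (\<integral>a. G a * exp (- l * exp (a - \<xi>)) \<partial>lborel)))"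
    by (intro log_HCM_mult log_HCM_const log_HCM_exp log_HCM_kernel_integral Ghcm int) (use l in auto)
  ultimately show ?thesis by (simp only:)
qed

section \<open>Analytic continuation to the slit plane\<close>

text \<open>Expanding at a small \<open>c > 0\<close> the power series in \<open>z = 1 - y / c\<close> has nonnegative coefficients
  and its disc of convergence reaches the given negative \<open>y\<close>.\<close>

lemma compl_mono_extension_antimono:
  assumes hol: "C holomorphic_on ball 0 R" and "compl_mono \<psi>"
    and eq: "\<And>y. 0 \<le> y \<Longrightarrow> y < R \<Longrightarrow> C (of_real y) = of_real (\<psi> y)"
    and y: "- R < y1" "y1 \<le> y2" "y2 \<le> 0"
  shows "Re (C (of_real y2)) \<le> Re (C (of_real y1))"
proof -
  have R: "0 < R" using y by simp
  \<comment> \<open>Any positive c below (R - |y1|) / 2 would do: the disc |z| < (R - c) / c is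
    mapped into |y| < R and contains the point 1 - y1 / c.\<close>
  define c where "c = (R - \<bar>y1\<bar>) / 4"
  have c: "0 < c" "4 * c \<le> R" "\<bar>y1\<bar> < R - 2 * c" using y by (auto simp: c_def field_simps)
  define \<rho> where "\<rho> = (R - c) / c"
  have \<rho>: "c * \<rho> = R - c" "1 < \<rho>" using c by (auto simp: \<rho>_def)
  define h where "h z = C (of_real c * (1 - z))" for z
  have "h holomorphic_on ball 0 \<rho>"
  proof -
    have sub: "(\<lambda>z. complex_of_real c * (1 - z)) ` ball 0 \<rho> \<subseteq> ball 0 R"
    proof (rule image_subsetI)
      fix z :: complex assume "z \<in> ball 0 \<rho>"
      then have "norm z < \<rho>" by simp
      then have "c * norm (1 - z) < c * (1 + \<rho>)"
        using norm_triangle_ineq4[of 1 z] c(1) by (intro mult_strict_left_mono) auto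
      also have "\<dots> = R" using \<rho> by (simp add: algebra_simps)
      finally show "of_real c * (1 - z) \<in> ball 0 R" using c(1) by (simp add: norm_mult)
    qed
    have "(C \<circ> (\<lambda>z. of_real c * (1 - z))) holomorphic_on ball 0 \<rho>"
      by (rule holomorphic_on_compose_gen[OF _ hol sub]) (intro holomorphic_intros)
    then show ?thesis by (simp add: o_def h_def[abs_def])
  qed
  note hps = holomorphic_power_series[OF this]
  define e where "e n = (deriv ^^ n) h 0 / fact n" for n
  have e: "(\<lambda>n. Re (e n) * x ^ n) sums Re (h (of_real x))" if "\<bar>x\<bar> < \<rho>" for x :: real
  proof -
    have "(\<lambda>n. e n * of_real x ^ n) sums h (of_real x)"
      using hps[of "of_real x"] that by (simp add: e_def)
    from sums_Re[OF this] show ?thesis by (simp add: Re_complex_of_real flip: of_real_power)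
  qed
  obtain d where d: "\<And>n. 0 \<le> d n" "\<And>z. 0 \<le> z \<Longrightarrow> z \<le> 1 \<Longrightarrow> (\<lambda>n. d n * z ^ n) sums \<psi> (c * (1 - z))"
    by (rule nonneg_psE[OF compl_monoD[OF assms(2) c(1)]]) (rule that)
  \<comment> \<open>Both expansions agree for z in [0, 1). Zeros of a nonzero power series do not
    accumulate at 0, so the real parts of the Taylor coefficients are the nonnegative d, now valid
    on the larger disc.\<close>
  define a where "a n = Re (e n) - d n" for n
  define f where "f x = (\<Sum>n. a n * x ^ n)" for x
  have sm: "(\<lambda>n. a n * x ^ n) sums f x" if x: "\<bar>x\<bar> < 1" for x
  proof -
    have "summable (\<lambda>n. d n * 1 ^ n)" using d(2)[of 1] by (auto intro: sums_summable)
    from powser_inside[OF this, of x] x have "summable (\<lambda>n. d n * x ^ n)" by simp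
    moreover have "summable (\<lambda>n. Re (e n) * x ^ n)" using e[of x] x \<rho>(2) sums_summable by fastforce
    ultimately have "summable (\<lambda>n. a n * x ^ n)" unfolding a_def left_diff_distrib by (intro summable_diff)
    then show ?thesis unfolding f_def by (rule summable_sums)
  qed
  have f0: "f x = 0" if x: "0 \<le> x" "x < 1" for x
  proof -
    have cx: "0 \<le> c * (1 - x)" "c * (1 - x) < R" 
    proof -
      have "c * (1 - x) \<le> c * 1" using x c by (intro mult_left_mono) auto
      then show "c * (1 - x) < R" using c by linarith
    qed (use x c in simp)
    have "(\<lambda>n. Re (e n) * x ^ n - d n * x ^ n) sums (Re (h (of_real x)) - \<psi> (c * (1 - x)))"
      by (intro sums_diff e d) (use x \<rho> in auto)
    moreover have "h (of_real x) = of_real (\<psi> (c * (1 - x)))"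
      using eq[OF cx] by (simp add: h_def)
    ultimately have "(\<lambda>n. a n * x ^ n) sums 0" by (simp add: a_def left_diff_distrib)
    then show ?thesis using sm[of x] x sums_unique2 by fastforce
  qed
  have "a n = 0" for n
  proof (rule ccontr)
    assume n: "a n \<noteq> 0"
    show False
    proof (cases "n = 0")
      case True
      then show False using n sums_unique2[OF sm[of 0]] f0[of 0] powser_sums_zero[of a] by simp
    next
      case False
      obtain s where s: "0 < s" "\<And>z. z \<in> cball 0 s - {0} \<Longrightarrow> f z \<noteq> 0"
        by (rule powser_0_nonzero[of 1 0 a f n]) (use sm f0[of 0] n False in auto)
      have "f (min s (1 / 2)) \<noteq> 0" by (rule s(2)) (use s(1) in auto)
      then show False using f0[of "min s (1 / 2)"] s(1) by (simp add: min_def split: if_splits)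
    qed
  qed
  then have enn: "0 \<le> Re (e n)" for n using d(1)[of n] by (simp add: a_def)
  \<comment> \<open>Negative y correspond to z > 1, beyond the original interval, where nonnegative
    coefficients still give monotonicity.\<close>
  define z where "z y = 1 - y / c" for y
  have z: "1 \<le> z y2" "z y2 \<le> z y1" "z y1 < \<rho>" 
  proof -
    have zc: "z y = (c - y) / c" for y using c by (simp add: z_def diff_divide_distrib)
    show "1 \<le> z y2" using c y by (simp add: zc)
    show "z y2 \<le> z y1" unfolding zc using c y by (intro divide_right_mono) auto
    show "z y1 < \<rho>" unfolding zc \<rho>_def using c y by (intro divide_strict_right_mono) auto
  qed
  have hz: "h (of_real (z y)) = C (of_real y)" for y
  proof -
    have "c * (1 - z y) = y" using c by (simp add: z_def)
    then show ?thesis unfolding h_def by (metis of_real_1 of_real_diff of_real_mult)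
  qed
  have "Re (h (of_real (z y2))) \<le> Re (h (of_real (z y1)))"
    by (rule sums_le[OF _ e e]) (use z enn in \<open>auto intro!: mult_left_mono power_mono\<close>)
  then show ?thesis by (simp only: hz)
qed

definition slit :: "complex set" where "slit = - \<real>\<^sub>\<le>\<^sub>0"

lemma open_slit: "open slit"
  by (simp add: slit_def open_Compl)

lemma slit_iff: "z \<in> slit \<longleftrightarrow> Im z \<noteq> 0 \<or> 0 < Re z"
  by (auto simp: slit_def complex_nonpos_Reals_iff)

text \<open>(1 + z b) / (1 + b) lies on the segment from 1 to z, a compact set avoiding 0 because z
  is off the closed negative axis. The bound is uniform in b and so controls all values of B at
  once.\<close>

lemma slit_lower_bound:
  assumes "z \<in> slit"
  obtains \<delta> where "0 < \<delta>" "\<And>b::real. 0 \<le> b \<Longrightarrow> \<delta> * (1 + b) \<le> norm (1 + z * of_real b)"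
proof -
  have "0 \<notin> closed_segment 1 z"
  proof
    assume "0 \<in> closed_segment 1 z"
    then obtain t where t: "0 \<le> t" "t \<le> 1" "(1 - t) *\<^sub>R 1 + t *\<^sub>R z = 0"
      by (auto simp: closed_segment_def)
    then have "1 - t + t * Re z = 0" "t * Im z = 0" by (auto simp: complex_eq_iff)
    then have "t \<noteq> 0" by auto
    then have "Im z = 0" using \<open>t * Im z = 0\<close> by simp
    then have "0 < Re z" using assms by (simp add: slit_iff)
    then have "0 < t * Re z" using t \<open>t \<noteq> 0\<close> by simp
    then show False using t \<open>1 - t + t * Re z = 0\<close> by linarith
  qed
  then obtain \<delta> where \<delta>: "0 < \<delta>" "\<And>x. x \<in> closed_segment 1 z \<Longrightarrow> \<delta> \<le> dist 0 x"
    using separate_point_closed[OF closed_segment, of 0 1 z] by blast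
  show ?thesis
  proof (rule that[OF \<delta>(1)])
    fix b :: real assume b: "0 \<le> b"
    define t where "t = b / (1 + b)"
    have t: "0 \<le> t" "t \<le> 1" "1 - t = 1 / (1 + b)" using b by (auto simp: t_def field_simps)
    have "(1 - t) *\<^sub>R 1 + t *\<^sub>R z \<in> closed_segment 1 z" using t(1,2) unfolding closed_segment_def by blast
    then have "\<delta> \<le> norm ((1 - t) *\<^sub>R 1 + t *\<^sub>R z)" using \<delta>(2) by (metis dist_0_norm)
    moreover have "(1 - t) *\<^sub>R 1 + t *\<^sub>R z = (1 / (1 + b)) *\<^sub>R (1 + z * of_real b)"
    proof -
      have "1 + complex_of_real b \<noteq> 0" using b by (auto simp: complex_eq_iff)
      then show ?thesis unfolding t(3) using b by (simp add: t_def scaleR_conv_of_real field_simps)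
    qed
    ultimately have "\<delta> \<le> norm ((1 / (1 + b)) *\<^sub>R (1 + z * of_real b))" by simp
    also have "\<dots> = norm (1 + z * of_real b) / (1 + b)" using b by simp
    finally show "\<delta> * (1 + b) \<le> norm (1 + z * of_real b)" using b by (simp add: field_simps)
  qed
qed

text \<open>B stands for A / l, so that f is the Laplace transform of A E. Positivity at every
  sample point is arranged by changing A on a null set.\<close>

locale pos_mixture = prob_space M for M :: "'a measure" +
  fixes B :: "'a \<Rightarrow> real"
  assumes B_measurable[measurable]: "B \<in> borel_measurable M" and B_pos: "\<And>\<omega>. 0 < B \<omega>"
begin

definition f :: "real \<Rightarrow> real" where "f s = (\<integral>\<omega>. 1 / (1 + s * B \<omega>) \<partial>M)"

definition F :: "complex \<Rightarrow> complex" where "F z = (\<integral>\<omega>. 1 / (1 + z * of_real (B \<omega>)) \<partial>M)"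

definition F' :: "complex \<Rightarrow> complex" where
  "F' z = (\<integral>\<omega>. - of_real (B \<omega>) / (1 + z * of_real (B \<omega>))\<^sup>2 \<partial>M)"

lemma integrable_bounds:
  assumes "z \<in> slit"
  shows "integrable M (\<lambda>\<omega>. 1 / (1 + z * of_real (B \<omega>)))"
    and "integrable M (\<lambda>\<omega>. - of_real (B \<omega>) / (1 + z * of_real (B \<omega>))\<^sup>2)"
proof -
  obtain \<delta> where \<delta>: "0 < \<delta>" "\<And>b::real. 0 \<le> b \<Longrightarrow> \<delta> * (1 + b) \<le> norm (1 + z * of_real b)"
    by (rule slit_lower_bound[OF assms]) (rule that)
  have d1: "\<delta> \<le> norm (1 + z * of_real (B \<omega>))" "\<delta> * B \<omega> \<le> norm (1 + z * of_real (B \<omega>))" for \<omega>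
  proof -
    have "\<delta> + \<delta> * B \<omega> \<le> norm (1 + z * of_real (B \<omega>))"
      using \<delta>(2)[of "B \<omega>"] B_pos[of \<omega>] by (simp add: distrib_left less_imp_le)
    moreover have "0 < \<delta> * B \<omega>" using \<delta>(1) B_pos by simp
    ultimately show "\<delta> \<le> norm (1 + z * of_real (B \<omega>))" "\<delta> * B \<omega> \<le> norm (1 + z * of_real (B \<omega>))"
      using \<delta>(1) by linarith+
  qed
  show "integrable M (\<lambda>\<omega>. 1 / (1 + z * of_real (B \<omega>)))"
  proof (rule integrable_const_bound[of _ "1 / \<delta>"])
    show "AE \<omega> in M. norm (1 / (1 + z * of_real (B \<omega>))) \<le> 1 / \<delta>"
      by (rule AE_I2) (use d1(1) \<delta>(1) in \<open>auto simp: norm_divide intro!: frac_le\<close>)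
  qed measurable
  show "integrable M (\<lambda>\<omega>. - of_real (B \<omega>) / (1 + z * of_real (B \<omega>))\<^sup>2)"
  proof (rule integrable_const_bound[of _ "1 / \<delta>\<^sup>2"])
    show "AE \<omega> in M. norm (- of_real (B \<omega>) / (1 + z * of_real (B \<omega>))\<^sup>2) \<le> 1 / \<delta>\<^sup>2"
    proof (rule AE_I2)
      fix \<omega>
      define N where "N = norm (1 + z * of_real (B \<omega>))"
      have N: "\<delta> \<le> N" "\<delta> * B \<omega> \<le> N" "0 < N" using d1[of \<omega>] \<delta>(1) by (auto simp: N_def)
      have "\<delta>\<^sup>2 * B \<omega> \<le> N\<^sup>2"
        using mult_mono[OF N(1,2)] \<delta>(1) N(3) B_pos[of \<omega>] by (simp add: power2_eq_square mult.assoc)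
      then show "norm (- of_real (B \<omega>) / (1 + z * of_real (B \<omega>))\<^sup>2) \<le> 1 / \<delta>\<^sup>2"
        using \<delta>(1) N(3) B_pos[of \<omega>]
        by (simp add: norm_divide norm_power N_def[symmetric] divide_simps mult_ac)
    qed
  qed measurable
qed

text \<open>The error of the difference quotient is the integral of (w - z) b^2 / (W Z^2), with W =
  1 + w b and Z = 1 + z b. Both factors grow at least like 1 + b, so the error is O(|w - z|)
  uniformly in b, whatever the moments of B.\<close>

lemma F_has_derivative:
  assumes "z \<in> slit"
  shows "(F has_field_derivative F' z) (at z)"
proof -
  obtain \<delta> where \<delta>: "0 < \<delta>" "\<And>b::real. 0 \<le> b \<Longrightarrow> \<delta> * (1 + b) \<le> norm (1 + z * of_real b)"
    by (rule slit_lower_bound[OF assms]) (rule that)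
  \<comment> \<open>Within distance \<delta> / 2 of z the lower bound for Z survives for W with half
    the constant.\<close>
  have ev: "\<forall>\<^sub>F w in at z. w \<noteq> z \<and> w \<in> slit \<and> dist w z < \<delta> / 2"
    using \<delta>(1) eventually_at_in_open'[OF open_slit assms] 
    by (auto simp: eventually_conj_iff eventually_at_filter eventually_nhds_metric intro!: exI[of _ "\<delta> / 2"])
  show ?thesis
    unfolding has_field_derivative_iff
  proof (rule LIM_zero_cancel, rule Lim_null_comparison)
    show "((\<lambda>w. norm (w - z) * (2 / \<delta> ^ 3)) \<longlongrightarrow> 0) (at z)"
      by (rule tendsto_mult_left_zero) (auto intro!: tendsto_norm_zero LIM_zero tendsto_ident_at)
    show "\<forall>\<^sub>F w in at z. norm ((F w - F z) / (w - z) - F' z) \<le> norm (w - z) * (2 / \<delta> ^ 3)"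
      using ev
    proof eventually_elim
      case (elim w)
      define g where "g \<omega> = 1 / (1 + w * of_real (B \<omega>)) - 1 / (1 + z * of_real (B \<omega>))
          - (w - z) * (- of_real (B \<omega>) / (1 + z * of_real (B \<omega>))\<^sup>2)" for \<omega>
      have gint: "integrable M g" unfolding g_def
        by (intro Bochner_Integration.integrable_diff integrable_mult_right integrable_bounds assms) (use elim in auto)
      have ig: "(\<integral>\<omega>. g \<omega> \<partial>M) = F w - F z - (w - z) * F' z"
      proof -
        have i: "integrable M (\<lambda>\<omega>. 1 / (1 + w * of_real (B \<omega>)))" "integrable M (\<lambda>\<omega>. 1 / (1 + z * of_real (B \<omega>)))"
          "integrable M (\<lambda>\<omega>. (w - z) * (- of_real (B \<omega>) / (1 + z * of_real (B \<omega>))\<^sup>2))"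
          by (intro integrable_mult_right integrable_bounds assms; use elim in simp)+
        show ?thesis unfolding g_def F_def F'_def
          by (simp only: Bochner_Integration.integral_diff[OF Bochner_Integration.integrable_diff[OF i(1,2)] i(3)]
              Bochner_Integration.integral_diff[OF i(1,2)] integral_mult_right_zero)
      qed
      have gb: "norm (g \<omega>) \<le> (norm (w - z))\<^sup>2 * (2 / \<delta> ^ 3)" for \<omega>
      proof -
        define b where "b = B \<omega>"
        have b: "0 < b" using B_pos by (simp add: b_def)
        define W where "W = 1 + w * of_real b"
        define Z where "Z = 1 + z * of_real b"
        have Z: "\<delta> * (1 + b) \<le> norm Z" using \<delta>(2)[of b] b by (simp add: Z_def)
        have "Z = W + (z - w) * of_real b" by (simp add: Z_def W_def algebra_simps)
        then have "norm Z \<le> norm W + norm ((z - w) * of_real b)" by (metis norm_triangle_ineq)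
        also have "norm ((z - w) * of_real b) \<le> \<delta> / 2 * b"
          unfolding norm_mult using elim b \<delta>(1) by (intro mult_mono) (auto simp: dist_norm norm_minus_commute)
        finally have W: "\<delta> / 2 * (1 + b) \<le> norm W" using Z \<delta>(1) by (simp add: algebra_simps)
        have pos: "0 < \<delta> * (1 + b)" "0 < \<delta> / 2 * (1 + b)" using \<delta>(1) b by auto
        then have nz: "W \<noteq> 0" "Z \<noteq> 0" using W Z by auto
        have "1 / W - 1 / Z - (w - z) * (- of_real b / Z\<^sup>2) = (w - z)\<^sup>2 * (of_real b)\<^sup>2 / (W * Z\<^sup>2)"
        proof -
          have "Z - W = - (w - z) * of_real b" by (simp add: Z_def W_def algebra_simps)
          moreover have "1 / W - 1 / Z + X / Z\<^sup>2 = ((Z - W) * Z + X * W) / (W * Z\<^sup>2)" for X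
            using nz by (simp add: field_simps power2_eq_square)
          ultimately have "1 / W - 1 / Z - (w - z) * (- of_real b / Z\<^sup>2) =
              ((- (w - z) * of_real b) * Z + ((w - z) * of_real b) * W) / (W * Z\<^sup>2)"
            by (metis (no_types, opaque_lifting) diff_minus_eq_add divide_minus_left mult_minus_right times_divide_eq_right)
          also have "(- (w - z) * of_real b) * Z + ((w - z) * of_real b) * W = (w - z) * of_real b * (W - Z)"
            by (simp add: algebra_simps)
          also have "W - Z = (w - z) * of_real b" by (simp add: Z_def W_def algebra_simps)
          finally show ?thesis by (simp add: power2_eq_square mult_ac)
        qed
        then have "norm (g \<omega>) = (norm (w - z))\<^sup>2 * (b\<^sup>2 / (norm W * (norm Z)\<^sup>2))"
          using b by (simp add: g_def b_def[symmetric] W_def[symmetric] Z_def[symmetric] norm_divide norm_mult norm_power)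
        also have "\<dots> \<le> (norm (w - z))\<^sup>2 * (b\<^sup>2 / (\<delta> / 2 * (1 + b) * (\<delta> * (1 + b))\<^sup>2))"
          using W Z pos nz \<delta>(1) b by (intro mult_left_mono divide_left_mono mult_mono power_mono mult_pos_pos zero_less_power) auto
        also have "\<dots> \<le> (norm (w - z))\<^sup>2 * (2 / \<delta> ^ 3)"
        proof (rule mult_left_mono)
          have "b\<^sup>2 \<le> (1 + b)\<^sup>2 * 1" using b by (auto intro!: power_mono)
          also have "\<dots> \<le> (1 + b)\<^sup>2 * (1 + b)" using b by (intro mult_left_mono) auto
          finally have "b\<^sup>2 / (1 + b) ^ 3 \<le> 1" using b by (simp add: power3_eq_cube power2_eq_square)
          then have "2 / \<delta> ^ 3 * (b\<^sup>2 / (1 + b) ^ 3) \<le> 2 / \<delta> ^ 3 * 1" using \<delta>(1) by (intro mult_left_mono) auto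
          then show "b\<^sup>2 / (\<delta> / 2 * (1 + b) * (\<delta> * (1 + b))\<^sup>2) \<le> 2 / \<delta> ^ 3"
            by (simp add: power_mult_distrib power3_eq_cube power2_eq_square mult_ac)
        qed simp
        finally show ?thesis .
      qed
      have "norm (\<integral>\<omega>. g \<omega> \<partial>M) \<le> (\<integral>\<omega>. norm (g \<omega>) \<partial>M)" by (rule integral_norm_bound)
      also have "\<dots> \<le> (\<integral>\<omega>. (norm (w - z))\<^sup>2 * (2 / \<delta> ^ 3) \<partial>M)"
        by (intro integral_mono gb integrable_norm gint) auto
      also have "\<dots> = (norm (w - z))\<^sup>2 * (2 / \<delta> ^ 3)" by (simp add: prob_space)
      finally have "norm (F w - F z - (w - z) * F' z) \<le> (norm (w - z))\<^sup>2 * (2 / \<delta> ^ 3)"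
        by (simp only: ig)
      moreover have "(F w - F z) / (w - z) - F' z = (F w - F z - (w - z) * F' z) / (w - z)"
        using elim by (simp add: field_simps)
      ultimately show ?case using elim by (simp add: norm_divide power2_eq_square field_simps)
    qed
  qed
qed

lemma F_holomorphic: "F holomorphic_on slit"
  using F_has_derivative field_differentiable_at_within
  by (auto simp: holomorphic_on_def field_differentiable_def intro: has_field_derivative_at_within)

lemma deriv_F: "z \<in> slit \<Longrightarrow> deriv F z = F' z"
  by (rule DERIV_imp_deriv[OF F_has_derivative])

lemma F'_holomorphic: "F' holomorphic_on slit"
  using holomorphic_deriv[OF F_holomorphic open_slit]
  by (rule holomorphic_transform) (rule deriv_F)

lemma F_cnj: "F (cnj z) = cnj (F z)"
  unfolding F_def by (subst Bochner_Integration.integral_cnj[symmetric]) simp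

lemma F'_cnj: "F' (cnj z) = cnj (F' z)"
  unfolding F'_def by (subst Bochner_Integration.integral_cnj[symmetric]) simp

lemma F_of_real: "F (of_real s) = of_real (f s)"
  unfolding F_def f_def by (subst integral_complex_of_real[symmetric]) simp

lemma F'_of_real: "F' (of_real s) = of_real (\<integral>\<omega>. - B \<omega> / (1 + s * B \<omega>)\<^sup>2 \<partial>M)"
  unfolding F'_def by (subst integral_complex_of_real[symmetric]) simp

lemma integral_pos:
  fixes g :: "'a \<Rightarrow> real"
  assumes "integrable M g" "\<And>\<omega>. 0 < g \<omega>"
  shows "0 < (\<integral>\<omega>. g \<omega> \<partial>M)"
proof -
  have "(\<integral>\<omega>. g \<omega> \<partial>M) \<noteq> 0"
  proof
    assume "(\<integral>\<omega>. g \<omega> \<partial>M) = 0"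
    then have "AE \<omega> in M. g \<omega> = 0"
      by (subst (asm) integral_nonneg_eq_0_iff_AE[OF assms(1)]) (use assms(2) less_imp_le in auto)
    then have "AE \<omega> in M. False" by eventually_elim (use assms(2) in \<open>metis less_irrefl\<close>)
    then show False by (simp only: AE_False)
  qed
  moreover have "0 \<le> (\<integral>\<omega>. g \<omega> \<partial>M)"
    by (rule Bochner_Integration.integral_nonneg) (use assms(2) less_imp_le in auto)
  ultimately show ?thesis by simp
qed

lemma f_pos:
  assumes "0 \<le> s"
  shows "0 < f s"
  unfolding f_def
proof (rule integral_pos)
  have *: "1 \<le> 1 + s * B \<omega>" for \<omega> using assms B_pos[of \<omega>] by simp
  then show "0 < 1 / (1 + s * B \<omega>)" for \<omega> by (smt (verit) divide_pos_pos)
  show "integrable M (\<lambda>\<omega>. 1 / (1 + s * B \<omega>))"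
  proof (rule integrable_const_bound[of _ 1])
    have "norm (1 / (1 + s * B \<omega>)) \<le> 1" for \<omega>
      using *[of \<omega>] divide_le_eq_1_pos[of "1 + s * B \<omega>" 1] by (simp add: abs_of_pos)
    then show "AE \<omega> in M. norm (1 / (1 + s * B \<omega>)) \<le> 1" by simp
  qed measurable
qed

text \<open>Off the real axis Im (1 / (1 + z b)) is - Im z times a positive quantity, so the mixture
  has nonzero imaginary part; on the positive axis F is the positive f.\<close>

lemma F_nonzero:
  assumes "z \<in> slit"
  shows "F z \<noteq> 0"
proof (cases "Im z = 0")
  case True
  then have "z = of_real (Re z)" by (simp add: complex_eq_iff)
  moreover have "0 < Re z" using True assms by (simp add: slit_iff)
  ultimately show ?thesis using F_of_real[of "Re z"] f_pos[of "Re z"] by (metis less_imp_le less_irrefl of_real_eq_0_iff)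
next
  case False
  note int = integrable_bounds(1)[OF assms]
  have Im: "Im (1 / (1 + z * of_real b)) = - Im z * (b / (norm (1 + z * of_real b))\<^sup>2)" for b
    by (simp add: Im_divide cmod_def)
  have nz: "1 + z * of_real (B \<omega>) \<noteq> 0" for \<omega>
    using False B_pos[of \<omega>] by (auto simp: complex_eq_iff)
  have "integrable M (\<lambda>\<omega>. Im (1 / (1 + z * of_real (B \<omega>))))"
    using int by (rule integrable_Im)
  then have int2: "integrable M (\<lambda>\<omega>. - Im z * (B \<omega> / (norm (1 + z * of_real (B \<omega>)))\<^sup>2))" by (simp only: Im)
  have "integrable M (\<lambda>\<omega>. (- 1 / Im z) * (- Im z * (B \<omega> / (norm (1 + z * of_real (B \<omega>)))\<^sup>2)))"
    by (rule integrable_mult_right[OF int2])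
  moreover have "(- 1 / Im z) * (- Im z * x) = x" for x using False by simp
  ultimately have "integrable M (\<lambda>\<omega>. B \<omega> / (norm (1 + z * of_real (B \<omega>)))\<^sup>2)" by (simp only:)
  then have "0 < (\<integral>\<omega>. B \<omega> / (norm (1 + z * of_real (B \<omega>)))\<^sup>2 \<partial>M)"
    by (rule integral_pos) (use nz B_pos in auto)
  moreover have "Im (F z) = - Im z * (\<integral>\<omega>. B \<omega> / (norm (1 + z * of_real (B \<omega>)))\<^sup>2 \<partial>M)"
    unfolding F_def using int by (subst integral_Im[symmetric]) (simp_all only: Im integral_mult_right_zero)
  ultimately show ?thesis using False by auto
qed

end

context pos_mixture begin

text \<open>Write \<open>2 cosh w - 2 = p\<^sup>2\<close> with \<open>p = 2 sinh (w / 2)\<close>, so that \<open>rr p = exp (w / 2)\<close>. The product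
  \<open>F (u exp w) F (u exp (- w))\<close> is even in \<open>p\<close>, hence analytic in \<open>p\<^sup>2\<close>; imaginary \<open>p\<close> corresponds to
  \<open>w = \<i> \<theta>\<close>, where the product is \<open>|F (u cis \<theta>)|\<^sup>2\<close>.\<close>

lemma cmod_F_mono:
  assumes hcm: "log_HCM (\<lambda>r. f (exp r))" and u: "0 < u" and \<theta>: "0 \<le> \<theta>1" "\<theta>1 \<le> \<theta>2" "\<theta>2 < pi"
  shows "cmod (F (of_real u * cis \<theta>1)) \<le> cmod (F (of_real u * cis \<theta>2))"
proof -
  from hcm obtain \<psi> where psi: "compl_mono \<psi>" "\<And>t. f (exp (ln u + t)) * f (exp (ln u - t)) = \<psi> (2 * cosh t - 2)"
    unfolding log_HCM_def by metis
  \<comment> \<open>The root r of r - 1 / r = p that equals 1 at p = 0; \<open>rr (- p)\<close> is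
    its inverse. For |p| < 2 the radicand stays in the right half-plane, so the root is analytic
    there.\<close>
  define rr where "rr p = (p + csqrt (p\<^sup>2 + 4)) / 2" for p :: complex
  define Q where "Q p = F (of_real u * (rr p)\<^sup>2) * F (of_real u * (rr (- p))\<^sup>2)" for p
  have p4: "0 < Re (p\<^sup>2 + 4)" if "norm p < 2" for p :: complex
  proof -
    have "norm (p\<^sup>2) < 2\<^sup>2" unfolding norm_power using that by (intro power_strict_mono) auto
    then show ?thesis using abs_Re_le_cmod[of "p\<^sup>2"] by simp
  qed
  \<comment> \<open>The real parts of two mutually inverse numbers have the same sign. Here the sum
    csqrt (p^2 + 4) has positive real part, so both do, and the square of such a number is off the
    closed negative axis.\<close>
  have rr_slit: "of_real u * (rr p)\<^sup>2 \<in> slit" if p: "norm p < 2" for p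
  proof -
    define a where "a = rr p"
    define b where "b = rr (- p)"
    have "a * b = ((csqrt (p\<^sup>2 + 4))\<^sup>2 - p\<^sup>2) / 4" by (simp add: a_def b_def rr_def power2_eq_square algebra_simps)
    then have ab: "a * b = 1" by simp
    have "a + b = csqrt (p\<^sup>2 + 4)" by (simp add: a_def b_def rr_def field_simps)
    moreover have "0 < Re (csqrt (p\<^sup>2 + 4))"
    proof (rule ccontr)
      assume "\<not> ?thesis"
      then have R0: "Re (csqrt (p\<^sup>2 + 4)) = 0" using Re_csqrt[of "p\<^sup>2 + 4"] by simp
      have "Re (p\<^sup>2 + 4) = Re ((csqrt (p\<^sup>2 + 4))\<^sup>2)" by simp
      also have "\<dots> \<le> 0" using R0 by (simp only: Re_power2) simp
      finally show False using p4[OF p] by simp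
    qed
    ultimately have s: "0 < Re a + Re b" by (metis plus_complex.sel(1))
    have "b * (a * cnj a) = cnj a" using ab by (metis mult.assoc mult.commute mult_1)
    then have "b * of_real ((cmod a)\<^sup>2) = cnj a" by (simp only: complex_norm_square)
    from arg_cong[OF this, of Re] have e: "Re b * (cmod a)\<^sup>2 = Re a" by (simp del: of_real_power)
    have "0 < Re a"
    proof (rule ccontr)
      assume "\<not> 0 < Re a"
      moreover from this have "0 < Re b" using s by simp
      moreover have "a \<noteq> 0" using ab by auto
      ultimately show False using e by (metis mult_pos_pos zero_less_norm_iff zero_less_power)
    qed
    then show ?thesis using u unfolding a_def[symmetric] slit_iff by (auto simp: Re_power2 Im_power2)
  qed
  have rr_hol: "rr holomorphic_on ball 0 2"
    unfolding rr_def
  proof (intro holomorphic_intros)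
    fix p :: complex assume "p \<in> ball 0 2"
    then show "p\<^sup>2 + 4 \<notin> \<real>\<^sub>\<le>\<^sub>0" using p4[of p] by (auto simp: complex_nonpos_Reals_iff)
  qed auto
  have F1: "(\<lambda>p. F (of_real u * (rr p)\<^sup>2)) holomorphic_on ball 0 2"
    by (rule holomorphic_on_compose_gen[where f="\<lambda>p. of_real u * (rr p)\<^sup>2" and g=F and t=slit, OF _ F_holomorphic, unfolded o_def])
      (use rr_slit in \<open>auto intro!: holomorphic_intros rr_hol\<close>)
  have F2: "(\<lambda>p. F (of_real u * (rr (- p))\<^sup>2)) holomorphic_on ball 0 2"
    by (rule holomorphic_on_compose_gen[where f="\<lambda>p. - p" and g="\<lambda>p. F (of_real u * (rr p)\<^sup>2)" and t="ball 0 2", OF _ F1, unfolded o_def])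
      (auto intro!: holomorphic_intros)
  have Q_hol: "Q holomorphic_on ball 0 2" unfolding Q_def by (intro holomorphic_intros F1 F2)
  have Q_even: "Q (- p) = Q p" for p by (simp add: Q_def mult.commute)
  define q where "q n = (deriv ^^ n) Q 0 / fact n" for n
  have Qs: "(\<lambda>n. q n * p ^ n) sums Q p" if "norm p < 2" for p
    using holomorphic_power_series[OF Q_hol, of p] that by (simp add: q_def)
  define C where "C y = Q (csqrt y)" for y
  \<comment> \<open>Evenness of Q removes the odd coefficients, so C is a power series in y and does
    not see the branch cut of \<open>csqrt\<close>.\<close>
  have Cs: "(\<lambda>n. q (2 * n) * (y - 0) ^ n) sums C y" if "y \<in> ball 0 4" for y
  proof -
    define p where "p = csqrt y"
    have "norm y < 4" using that by simp
    have p2: "p\<^sup>2 = y" by (simp add: p_def)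
    have "(norm p)\<^sup>2 < 2\<^sup>2" using \<open>norm y < 4\<close> by (simp add: norm_power[symmetric] p2)
    then have p: "norm p < 2" by (rule power_less_imp_less_base) simp
    have "(\<lambda>n. (q n * p ^ n + q n * (- p) ^ n) / 2) sums ((Q p + Q (- p)) / 2)"
      by (intro sums_divide sums_add Qs) (use p in auto)
    then have "(\<lambda>n. (q n * p ^ n + q n * (- p) ^ n) / 2) sums C y" by (simp add: Q_even C_def p_def)
    then have "(\<lambda>n. (q (2 * n) * p ^ (2 * n) + q (2 * n) * (- p) ^ (2 * n)) / 2) sums C y"
    proof (subst sums_mono_reindex[of "\<lambda>n. 2 * n" "\<lambda>n. (q n * p ^ n + q n * (- p) ^ n) / 2"])
      show "strict_mono (\<lambda>n::nat. 2 * n)" by (simp add: strict_mono_def)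
      fix n :: nat assume "n \<notin> range (\<lambda>n. 2 * n)"
      then have "odd n" by (auto elim!: evenE)
      then show "(q n * p ^ n + q n * (- p) ^ n) / 2 = 0" by simp
    qed
    moreover have "(q (2 * n) * p ^ (2 * n) + q (2 * n) * (- p) ^ (2 * n)) / 2 = q (2 * n) * (y - 0) ^ n" for n
      by (simp add: power_mult p2)
    ultimately show ?thesis by (simp only:)
  qed
  have C_hol: "C holomorphic_on ball 0 4" by (rule power_series_holomorphic[OF Cs])
  \<comment> \<open>For real y \<ge> 0 one has p = 2 sinh \<tau> and w = 2 \<tau>, and the product
    consists of values of f on the positive axis.\<close>
  have C_real: "C (of_real y) = of_real (\<psi> y)" if y: "0 \<le> y" "y < 4" for y
  proof -
    define \<tau> where "\<tau> = arsinh (sqrt y / 2)"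
    have sy: "sqrt y = 2 * sinh \<tau>" by (simp add: \<tau>_def)
    have y\<tau>: "y = 4 * (sinh \<tau>)\<^sup>2" using y by (metis sy power_mult_distrib real_sqrt_pow2 mult_2 numeral_Bit0 power2_eq_square numeral_times_numeral semiring_norm(13) num_double mult_numeral_1)
    have c: "csqrt ((of_real (2 * sinh \<tau>))\<^sup>2 + 4) = of_real (2 * cosh \<tau>)"
    proof (rule csqrt_unique)
      have "(2 * cosh \<tau>)\<^sup>2 = (2 * sinh \<tau>)\<^sup>2 + 4" by (simp add: power_mult_distrib cosh_square_eq)
      then show "(complex_of_real (2 * cosh \<tau>))\<^sup>2 = (complex_of_real (2 * sinh \<tau>))\<^sup>2 + 4"
        by (metis of_real_add of_real_numeral of_real_power)
      show "0 < Re (complex_of_real (2 * cosh \<tau>)) \<or> Re (complex_of_real (2 * cosh \<tau>)) = 0 \<and> 0 \<le> Im (complex_of_real (2 * cosh \<tau>))"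
        by (simp add: cosh_real_pos)
    qed
    have r1: "rr (of_real (2 * sinh \<tau>)) = of_real (exp \<tau>)"
      unfolding rr_def c by (simp add: sinh_plus_cosh[symmetric] algebra_simps)
    have r2: "rr (- of_real (2 * sinh \<tau>)) = of_real (exp (- \<tau>))"
      unfolding rr_def power2_minus c by (simp add: cosh_minus_sinh[symmetric])
    have e: "u * (exp x)\<^sup>2 = exp (ln u + 2 * x)" for x
      using u by (simp add: exp_add exp_double)
    have "csqrt (of_real y) = of_real (2 * sinh \<tau>)" using y by (simp only: csqrt_of_real sy)
    then have "C (of_real y) = F (of_real (u * (exp \<tau>)\<^sup>2)) * F (of_real (u * (exp (- \<tau>))\<^sup>2))"
      
      by (simp only: C_def Q_def r1 r2 of_real_mult[where x=u] of_real_power)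
    also have "\<dots> = of_real (f (exp (ln u + 2 * \<tau>)) * f (exp (ln u - 2 * \<tau>)))"
      unfolding e F_of_real by simp
    also have "\<dots> = of_real (\<psi> (2 * cosh (2 * \<tau>) - 2))" by (simp only: psi(2))
    also have "2 * cosh (2 * \<tau>) - 2 = y" unfolding y\<tau> by (simp add: cosh_double cosh_square_eq)
    finally show ?thesis .
  qed
  \<comment> \<open>This is 2 cos \<theta> - 2; it decreases from 0 towards - 4, the edge of the
    disc of convergence, as \<theta> goes from 0 to pi.\<close>
  define Y where "Y \<theta> = - 4 * (sin (\<theta> / 2))\<^sup>2" for \<theta> :: real
  have CY: "C (of_real (Y \<theta>)) = of_real ((cmod (F (of_real u * cis \<theta>)))\<^sup>2)" if t: "0 \<le> \<theta>" "\<theta> < pi" for \<theta>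
  proof -
    have sc: "0 \<le> sin (\<theta> / 2)" "0 < cos (\<theta> / 2)" using t by (auto intro!: sin_ge_zero cos_gt_zero_pi)
    define p where "p = \<i> * of_real (2 * sin (\<theta> / 2))"
    have p: "csqrt (of_real (Y \<theta>)) = p"
    proof (rule csqrt_unique)
      show "p\<^sup>2 = of_real (Y \<theta>)" by (simp add: p_def Y_def power_mult_distrib)
      show "0 < Re p \<or> Re p = 0 \<and> 0 \<le> Im p" using sc by (simp add: p_def)
    qed
    have c: "csqrt (p\<^sup>2 + 4) = of_real (2 * cos (\<theta> / 2))"
    proof (rule csqrt_unique)
      have p2: "p\<^sup>2 = of_real (- ((2 * sin (\<theta> / 2))\<^sup>2))" by (simp add: p_def power_mult_distrib)
      have sq: "(2 * cos (\<theta> / 2))\<^sup>2 = - ((2 * sin (\<theta> / 2))\<^sup>2) + 4" by (simp add: power_mult_distrib cos_squared_eq)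
      show "(complex_of_real (2 * cos (\<theta> / 2)))\<^sup>2 = p\<^sup>2 + 4"
        unfolding of_real_power[symmetric] sq p2 by (simp only: of_real_add of_real_numeral)
    qed (use sc in simp)
    have r1: "rr p = cis (\<theta> / 2)" unfolding rr_def c by (simp add: p_def complex_eq_iff)
    have r2: "rr (- p) = cis (- (\<theta> / 2))" unfolding rr_def power2_minus c by (simp add: p_def complex_eq_iff)
    have "C (of_real (Y \<theta>)) = F (of_real u * cis \<theta>) * F (of_real u * cis (- \<theta>))"
      unfolding C_def p Q_def r1 r2 by (simp add: power2_eq_square cis_mult)
    also have "of_real u * cis (- \<theta>) = cnj (of_real u * cis \<theta>)" by (simp add: cis_cnj)
    finally show ?thesis by (simp only: F_cnj complex_norm_square)
  qed
  have "Re (C (of_real (Y \<theta>1))) \<le> Re (C (of_real (Y \<theta>2)))"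
  proof (rule compl_mono_extension_antimono[OF C_hol psi(1) C_real])
    have "0 \<le> sin (\<theta>1 / 2)" using \<theta> by (auto intro!: sin_ge_zero)
    moreover have "sin (\<theta>1 / 2) \<le> sin (\<theta>2 / 2)" using \<theta> by (intro sin_monotone_2pi_le) auto
    moreover have "sin (\<theta>2 / 2) < 1" using \<theta> sin_monotone_2pi[of "\<theta>2 / 2" "pi / 2"] by auto
    ultimately show "- 4 < Y \<theta>2" "Y \<theta>2 \<le> Y \<theta>1" "Y \<theta>1 \<le> 0"
      by (auto simp: Y_def abs_square_less_1 intro!: power_mono)
  qed
  then have "(cmod (F (of_real u * cis \<theta>1)))\<^sup>2 \<le> (cmod (F (of_real u * cis \<theta>2)))\<^sup>2"
    using \<theta> by (simp add: CY)
  then show ?thesis by (rule power2_le_imp_le) simp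
qed

definition P :: "complex \<Rightarrow> complex" where "P z = - z * F' z / F z"

lemma P_holomorphic: "P holomorphic_on slit"
  unfolding P_def by (intro holomorphic_intros F_holomorphic F'_holomorphic F_nonzero)

lemma P_cnj: "P (cnj z) = cnj (P z)"
  by (simp add: P_def F_cnj F'_cnj)

text \<open>Differentiating ln (F (u cis \<theta>)) in \<theta> gives i z F' / F = - i P, whose real
  part is Im P. So Im P is the angular derivative of ln |F|, and \<open>cmod_F_mono\<close> gives
  its sign.\<close>

lemma Im_P_nonneg:
  assumes hcm: "log_HCM (\<lambda>r. f (exp r))" and z: "0 < Im z"
  shows "0 \<le> Im (P z)"
proof -
  define u where "u = cmod z"
  define \<theta> where "\<theta> = Arg z"
  have u: "0 < u" using z by (auto simp: u_def)
  have zu: "z = of_real u * cis \<theta>" using cis_Arg[of z] z u by (auto simp: u_def \<theta>_def sgn_eq)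
  have \<theta>: "0 < \<theta>" "\<theta> < pi" using Arg_lt_pi[of z] z by (auto simp: \<theta>_def)
  define \<gamma> where "\<gamma> t = of_real u * cis t" for t
  define v where "v = F z"
  define v' where "v' = \<i> * z * F' z"
  have slit: "z \<in> slit" using z by (simp add: slit_iff)
  have "(\<gamma> has_vector_derivative \<i> * z) (at \<theta>)"
  proof -
    have "((\<lambda>w. of_real u * exp (\<i> * w)) has_field_derivative \<i> * z) (at (of_real \<theta>))"
      by (auto intro!: derivative_eq_intros simp: zu cis_conv_exp)
    from has_vector_derivative_real_field[OF this] show ?thesis
      by (simp add: \<gamma>_def[abs_def] cis_conv_exp)
  qed
  then have "(F \<circ> \<gamma> has_vector_derivative \<i> * z * F' z) (at \<theta>)"
    by (rule field_vector_diff_chain_at) (use F_has_derivative[OF slit] in \<open>simp add: \<gamma>_def zu[symmetric]\<close>)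
  then have d: "((\<lambda>t. F (\<gamma> t)) has_vector_derivative v') (at \<theta>)" by (simp add: o_def v'_def)
  have R: "((\<lambda>t. Re (F (\<gamma> t))) has_real_derivative Re v') (at \<theta>)"
    unfolding has_real_derivative_iff_has_vector_derivative
    by (rule bounded_linear.has_vector_derivative[OF bounded_linear_Re d])
  have I: "((\<lambda>t. Im (F (\<gamma> t))) has_real_derivative Im v') (at \<theta>)"
    unfolding has_real_derivative_iff_has_vector_derivative
    by (rule bounded_linear.has_vector_derivative[OF bounded_linear_Im d])
  have v: "F (\<gamma> \<theta>) = v" by (simp add: \<gamma>_def zu v_def)
  have "((\<lambda>t. (cmod (F (\<gamma> t)))\<^sup>2) has_real_derivative 2 * (Re v * Re v' + Im v * Im v')) (at \<theta>)"
    unfolding cmod_power2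
    using DERIV_add[OF DERIV_power[OF R, of 2] DERIV_power[OF I, of 2]] by (simp add: v algebra_simps)
  then have nn: "0 \<le> 2 * (Re v * Re v' + Im v * Im v')"
  proof (rule mono_on_imp_deriv_nonneg[rotated])
    show "mono_on {0..<pi} (\<lambda>t. (cmod (F (\<gamma> t)))\<^sup>2)"
      unfolding \<gamma>_def by (intro mono_onI power_mono cmod_F_mono[OF hcm u]) auto
    have "\<theta> \<in> {0<..<pi}" using \<theta> by simp
    then show "\<theta> \<in> interior {0..<pi}" by (meson atLeastLessThan_iff greaterThanLessThan_iff interiorI less_imp_le open_greaterThanLessThan subsetI)
  qed
  have "P z = \<i> * (v' / v)" 
  proof -
    have "\<i> * (v' / v) = (\<i> * \<i>) * (z * F' z / F z)"
      by (simp only: v_def v'_def times_divide_eq_right mult.assoc)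
    then show ?thesis by (simp add: P_def)
  qed
  then have "Im (P z) = Re (v' / v)" by (simp only: Im_i_times)
  also have "\<dots> = (Re v * Re v' + Im v * Im v') / (cmod v)\<^sup>2" by (simp add: Re_divide cmod_power2 mult_ac)
  finally show ?thesis using nn by simp
qed

end

section \<open>Typically real functions\<close>

text \<open>For c = cos t the expression is the square of |1 - x cis t|, which the triangle
  inequality bounds from below.\<close>

lemma poisson_denominator_pos:
  fixes x c :: real
  assumes "\<bar>x\<bar> < 1" "\<bar>c\<bar> \<le> 1"
  shows "(1 - \<bar>x\<bar>)\<^sup>2 \<le> 1 - 2 * x * c + x\<^sup>2" "0 < 1 - 2 * x * c + x\<^sup>2"
proof -
  have "x * c \<le> \<bar>x\<bar> * \<bar>c\<bar>" by (metis abs_ge_self abs_mult)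
  also have "\<dots> \<le> \<bar>x\<bar> * 1" using assms by (intro mult_left_mono) auto
  finally show *: "(1 - \<bar>x\<bar>)\<^sup>2 \<le> 1 - 2 * x * c + x\<^sup>2" by (simp add: power2_diff)
  have "0 < (1 - \<bar>x\<bar>)\<^sup>2" using assms by simp
  then show "0 < 1 - 2 * x * c + x\<^sup>2" using * by linarith
qed

text \<open>The kernel comes from applying Cauchy's formula to \<open>(1 - w\<^sup>2) (G (r w) - G 0) / (1 - x w)\<close> at
  \<open>x\<close> and at \<open>0\<close>: on the unit circle the weight becomes real.\<close>

lemma typically_real_poisson:
  fixes G :: "complex \<Rightarrow> complex" and r x :: real
  assumes hol: "G holomorphic_on ball 0 1" and G0: "Im (G 0) = 0"
    and r: "0 < r" "r < 1" and x: "\<bar>x\<bar> < 1"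
  shows "((\<lambda>t. x * (2 * sin (2 * pi * t) * Im (G (of_real r * cis (2 * pi * t)))) /
            (1 - 2 * x * cos (2 * pi * t) + x\<^sup>2)) has_integral (Re (G (of_real (r * x))) - Re (G 0))) {0..1}"
proof -
  define N where "N w = (1 - w\<^sup>2) * (G (of_real r * w) - G 0) / (1 - of_real x * w)" for w
  have rw: "of_real r * w \<in> ball 0 1" if "norm w \<le> 1" for w :: complex
  proof -
    have "r * norm w < 1" using mult_left_le[OF that less_imp_le[OF r(1)]] r by linarith
    then show ?thesis using r by (simp add: norm_mult)
  qed
  have xw: "1 - of_real x * w \<noteq> 0" if "norm w \<le> 1" for w :: complex
  proof
    assume "1 - of_real x * w = 0"
    then have "norm (of_real x * w) = 1" by simp
    then show False using that x mult_left_mono[of "norm w" 1 "\<bar>x\<bar>"] by (simp add: norm_mult)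
  qed
  have "(G \<circ> (\<lambda>w. of_real r * w)) holomorphic_on cball 0 1"
    by (rule holomorphic_on_compose_gen[OF _ hol]) (use rw in \<open>auto intro!: holomorphic_intros\<close>)
  then have "N holomorphic_on cball 0 1"
    unfolding N_def o_def by (intro holomorphic_intros) (use xw in auto)
  note C = Cauchy_integral_circlepath_simple[OF this]
  define J where "J t = (N (circlepath 0 1 t) / (circlepath 0 1 t - of_real x) - N (circlepath 0 1 t) / circlepath 0 1 t) *
      vector_derivative (circlepath 0 1) (at t)" for t
  \<comment> \<open>N vanishes at 0, so subtracting N u / u leaves the integral unchanged; it
    supplies the factor x of the kernel, as 1 / (u - x) - 1 / u = x / (u (u - x)).\<close>
  have "((\<lambda>u. N u / (u - of_real x) - N u / (u - 0)) has_contour_integral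
     (2 * of_real pi * \<i> * N (of_real x) - 2 * of_real pi * \<i> * N 0)) (circlepath 0 1)"
    by (intro has_contour_integral_diff C) (use x in auto)
  moreover have "N 0 = 0" by (simp add: N_def)
  moreover have "N (of_real x) = G (of_real (r * x)) - G 0"
  proof -
    have "x\<^sup>2 \<noteq> 1" using x by (simp add: abs_square_less_1 less_imp_neq)
    then have "1 - (complex_of_real x)\<^sup>2 \<noteq> 0" by (metis eq_iff_diff_eq_0 of_real_1 of_real_eq_iff of_real_power)
    then show ?thesis by (simp add: N_def power2_eq_square)
  qed
  ultimately have "(J has_integral (2 * of_real pi * \<i> * (G (of_real (r * x)) - G 0))) {0..1}"
    by (simp add: has_contour_integral J_def[abs_def])
  moreover have "bounded_linear (\<lambda>z. Re (z / (2 * of_real pi * \<i>)))"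
    by (intro bounded_linear_compose[OF bounded_linear_Re] bounded_linear_divide)
  ultimately have "((\<lambda>z. Re (z / (2 * of_real pi * \<i>))) \<circ> J has_integral Re (2 * of_real pi * \<i> * (G (of_real (r * x)) - G 0) / (2 * of_real pi * \<i>))) {0..1}"
    by (rule has_integral_linear)
  then have "((\<lambda>z. Re (z / (2 * of_real pi * \<i>))) \<circ> J has_integral (Re (G (of_real (r * x))) - Re (G 0))) {0..1}"
    by simp
  then show ?thesis
  proof (rule has_integral_eq[rotated])
    fix t :: real
    define e where "e = cis (2 * pi * t)"
    have ce: "circlepath 0 1 t = e" by (simp add: circlepath e_def cis_conv_exp mult_ac)
    have vd: "vector_derivative (circlepath 0 1) (at t) = 2 * of_real pi * \<i> * e"
      by (rule vector_derivative_at, rule has_vector_derivative_eq_rhs[OF has_vector_derivative_circlepath])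
        (simp add: e_def cis_conv_exp mult_ac)
    have ne: "norm e = 1" "e \<noteq> 0" by (auto simp: e_def)
    have ee: "e * cnj e = 1" using complex_norm_square[of e] ne by simp
    have Re_e: "Re e = cos (2 * pi * t)" and Im_e: "Im e = sin (2 * pi * t)" by (simp_all add: e_def)
    define D where "D = G (of_real r * e) - G 0"
    define K where "K = 1 - 2 * x * cos (2 * pi * t) + x\<^sup>2"
    have K: "0 < K" unfolding K_def by (rule poisson_denominator_pos) (use x in auto)
    have KK: "(1 - of_real x * e) * (1 - of_real x * cnj e) = of_real K"
    proof -
      have "(1 - of_real x * e) * (1 - of_real x * cnj e) = 1 - of_real x * (e + cnj e) + (of_real x)\<^sup>2 * (e * cnj e)"
        by (simp add: algebra_simps power2_eq_square)
      also have "\<dots> = of_real K" unfolding ee by (simp add: complex_add_cnj Re_e K_def)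
      finally show ?thesis .
    qed
    have ex: "e - of_real x = e * (1 - of_real x * cnj e)" using ee by (simp add: algebra_simps)
    have nz: "1 - of_real x * e \<noteq> 0" "1 - of_real x * cnj e \<noteq> 0" using KK K by auto
    \<comment> \<open>On the unit circle the conjugate is the inverse, so 1 - e^2 is - 2 i e sin (2
      pi t). The weight becomes a real multiple of - i, and the real part retains only Im G.\<close>
    have e2: "1 - e\<^sup>2 = e * (cnj e - e)" using ee by (simp add: algebra_simps power2_eq_square)
    have "(N e / (e - of_real x) - N e / e) * (2 * of_real pi * \<i> * e) / (2 * of_real pi * \<i>) = (N e / (e - of_real x) - N e / e) * e"
    proof -
      have "X * (c * e) / c = X * e" if "c \<noteq> 0" for X c using that by simp
      from this[of "2 * of_real pi * \<i>"] show ?thesis by (simp only: mult_eq_0_iff) simp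
    qed
    also have "\<dots> = of_real x * (N e / (e - of_real x))"
    proof -
      have "(X / w - X / e) * e = (e - w) * (X / w)" if "w \<noteq> 0" for X w
        using that ne by (simp add: field_simps)
      moreover have "e - of_real x \<noteq> 0" unfolding ex using ne nz by simp
      ultimately show ?thesis by simp
    qed
    also have "\<dots> = of_real (x * (2 * sin (2 * pi * t)) / K) * (- \<i> * D)"
    proof -
      have "N e / (e - of_real x) = (cnj e - e) * D / of_real K"
        unfolding N_def D_def[symmetric] ex e2 KK[symmetric] using ne nz by simp
      moreover have "cnj e - e = - 2 * \<i> * of_real (sin (2 * pi * t))" by (simp add: complex_eq_iff Im_e)
      ultimately show ?thesis by simp
    qed
    finally have "(N e / (e - of_real x) - N e / e) * (2 * of_real pi * \<i> * e) / (2 * of_real pi * \<i>) =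
      of_real (x * (2 * sin (2 * pi * t)) / K) * (- \<i> * D)" .
    then have "Re ((N e / (e - of_real x) - N e / e) * (2 * of_real pi * \<i> * e) / (2 * of_real pi * \<i>)) =
      x * (2 * sin (2 * pi * t)) / K * Im D" by (simp only: Re_complex_of_real times_complex.sel Im_complex_of_real) simp
    moreover have "Im D = Im (G (of_real r * e))" using G0 by (simp add: D_def)
    ultimately show "((\<lambda>z. Re (z / (2 * of_real pi * \<i>))) \<circ> J) t = x * (2 * sin (2 * pi * t) * Im (G (of_real r * cis (2 * pi * t)))) /
            (1 - 2 * x * cos (2 * pi * t) + x\<^sup>2)"
      by (simp only: o_def J_def ce vd) (simp add: K_def e_def)
  qed
qed

text \<open>By conjugation symmetry sin t Im (G (r cis t)) \<ge> 0, so the Poisson weight is a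
  positive measure. At x = 1 / 2 the denominator is (5 - 4 c) / 4; scaling by 5 - 4 c therefore
  makes the kernel equal to 1 there, so the total masses are increments of Re G that converge as r
  -> 1, and \<open>helly_interval\<close> provides the limit in c = cos t.\<close>

lemma typically_real_representation:
  fixes G :: "complex \<Rightarrow> complex"
  assumes hol: "G holomorphic_on ball 0 1" and cnj: "\<And>\<zeta>. \<zeta> \<in> ball 0 1 \<Longrightarrow> G (cnj \<zeta>) = cnj (G \<zeta>)"
    and upper: "\<And>\<zeta>. \<zeta> \<in> ball 0 1 \<Longrightarrow> 0 < Im \<zeta> \<Longrightarrow> 0 \<le> Im (G \<zeta>)"
  obtains \<tau> where "real_distribution \<tau>" "AE c in \<tau>. c \<in> {- 1..1}" "Re (G 0) \<le> Re (G (1 / 2))"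
    "\<And>x::real. \<bar>x\<bar> < 1 \<Longrightarrow> Re (G (of_real x)) - Re (G 0) =
      (Re (G (1 / 2)) - Re (G 0)) * (\<integral>c. x * (5 - 4 * c) / (2 * (1 - 2 * x * c + x\<^sup>2)) \<partial>\<tau>)"
proof -
  have G0: "Im (G 0) = 0" using cnj[of 0] by (simp add: complex_eq_iff)
  have sgn: "0 \<le> Im \<zeta> * Im (G \<zeta>)" if z: "\<zeta> \<in> ball 0 1" for \<zeta>
  proof -
    consider "0 < Im \<zeta>" | "Im \<zeta> = 0" | "Im \<zeta> < 0" by linarith
    then show ?thesis
    proof cases
      case 3
      then have "0 \<le> Im (G (cnj \<zeta>))" using z by (intro upper) auto
      then show ?thesis using 3 cnj[OF z] by (simp add: mult_nonpos_nonpos)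
    qed (use upper[OF z] in auto)
  qed
  \<comment> \<open>The maximum changes nothing for |c| \<le> 1 and keeps the denominator positive
    elsewhere, so the test function is continuous on the whole line.\<close>
  define KK where "KK x c = x * (5 - 4 * c) / (2 * max ((1 - \<bar>x\<bar>)\<^sup>2) (1 - 2 * x * c + x\<^sup>2))" for x c :: real
  have KKe: "KK x c = x * (5 - 4 * c) / (2 * (1 - 2 * x * c + x\<^sup>2))" if "\<bar>x\<bar> < 1" "\<bar>c\<bar> \<le> 1" for x c
    using poisson_denominator_pos(1)[OF that] by (simp add: KK_def max_def)
  have KKc: "continuous_on UNIV (KK x)" if "\<bar>x\<bar> < 1" for x
  proof -
    have "0 < (1 - \<bar>x\<bar>)\<^sup>2" using that by simp
    then have "max ((1 - \<bar>x\<bar>)\<^sup>2) (1 - 2 * x * c + x\<^sup>2) \<noteq> 0" for c by (metis less_irrefl less_max_iff_disj)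
    then show ?thesis unfolding KK_def by (intro continuous_intros) auto
  qed
  \<comment> \<open>The weight normalised at x = 1 / 2; its denominator 5 - 4 c cancels against
    \<open>KK\<close>, and the product is the integrand of
    \<open>typically_real_poisson\<close>.\<close>
  define v where "v r t = 2 * sin (2 * pi * t) * Im (G (of_real r * cis (2 * pi * t))) * (2 / (5 - 4 * cos (2 * pi * t)))" for r t
  have c5: "0 < 5 - 4 * cos (2 * pi * t)" for t using cos_le_one[of "2 * pi * t"] by linarith
  have ball: "of_real r * cis (2 * pi * t) \<in> ball 0 1" if "0 < r" "r < 1" for r t using that by (simp add: norm_mult)
  have vnn: "0 \<le> v r t" if r: "0 < r" "r < 1" for r t
  proof -
    have "0 \<le> r * (sin (2 * pi * t) * Im (G (of_real r * cis (2 * pi * t))))"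
      using sgn[OF ball[OF r, of t]] by (simp add: mult.assoc)
    then have "0 \<le> sin (2 * pi * t) * Im (G (of_real r * cis (2 * pi * t)))" using r by (simp add: zero_le_mult_iff)
    then have "0 \<le> (sin (2 * pi * t) * Im (G (of_real r * cis (2 * pi * t)))) * (4 / (5 - 4 * cos (2 * pi * t)))"
      by (rule mult_nonneg_nonneg) (use c5[of t] in simp)
    then show ?thesis by (simp add: v_def mult_ac)
  qed
  have vc: "continuous_on UNIV (v r)" if r: "0 < r" "r < 1" for r
  proof -
    have "continuous_on UNIV (\<lambda>t. G (of_real r * cis (2 * pi * t)))"
      by (rule continuous_on_compose2[OF holomorphic_on_imp_continuous_on[OF hol]])
        (use ball[OF r] in \<open>auto intro!: continuous_intros simp: cis_conv_exp\<close>)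
    then show ?thesis unfolding v_def by (intro continuous_intros) (assumption, rule ballI, rule c5[THEN less_imp_neq, THEN not_sym])
  qed
  have int: "integrable lborel (\<lambda>t. indicator {0..1} t * (v r t * KK x (cos (2 * pi * t))))"
    and val: "(\<integral>t. indicator {0..1} t * (v r t * KK x (cos (2 * pi * t))) \<partial>lborel) = Re (G (of_real (r * x))) - Re (G 0)"
    if r: "0 < r" "r < 1" and x: "\<bar>x\<bar> < 1" for r x
  proof -
    have c: "continuous_on {0..1} (\<lambda>t. v r t * KK x (cos (2 * pi * t)))"
      by (intro continuous_intros continuous_on_compose2[OF KKc[OF x]] continuous_on_subset[OF vc[OF r]]) auto
    have si: "set_integrable lborel {0..1} (\<lambda>t. v r t * KK x (cos (2 * pi * t)))"
      by (rule borel_integrable_atLeastAtMost'[OF c])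
    then show "integrable lborel (\<lambda>t. indicator {0..1} t * (v r t * KK x (cos (2 * pi * t))))"
      by (simp add: set_integrable_def)
    have "((\<lambda>t. v r t * KK x (cos (2 * pi * t))) has_integral (Re (G (of_real (r * x))) - Re (G 0))) {0..1}"
    proof (rule has_integral_eq[OF _ typically_real_poisson[OF hol G0 r x]])
      fix t :: real
      have "KK x (cos (2 * pi * t)) = x * (5 - 4 * cos (2 * pi * t)) / (2 * (1 - 2 * x * cos (2 * pi * t) + x\<^sup>2))"
        by (rule KKe[OF x]) simp
      moreover have kp: "0 < 1 - 2 * x * cos (2 * pi * t) + x\<^sup>2" by (rule poisson_denominator_pos[OF x]) simp
      have gen: "x * (2 * s * I) / K = 2 * s * I * (2 / C) * (x * C / (2 * K))" if "0 < K" "0 < C" for s I K C :: real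
        using that by (simp add: field_simps)
      ultimately show "x * (2 * sin (2 * pi * t) * Im (G (of_real r * cis (2 * pi * t)))) /
            (1 - 2 * x * cos (2 * pi * t) + x\<^sup>2) = v r t * KK x (cos (2 * pi * t))"
        by (simp only: v_def gen[OF kp c5])
    qed
    from integral_unique[OF this] show "(\<integral>t. indicator {0..1} t * (v r t * KK x (cos (2 * pi * t))) \<partial>lborel) = Re (G (of_real (r * x))) - Re (G 0)"
      using set_borel_integral_eq_integral(2)[OF si] by (simp add: set_lebesgue_integral_def)
  qed
  have KKh: "KK (1 / 2) c = 1" if "\<bar>c\<bar> \<le> 1" for c
    using that KKe[of "1 / 2" c] by (simp add: power2_eq_square field_simps)
  define m where "m r = Re (G (of_real (r / 2))) - Re (G 0)" for r
  have mint: "integrable lborel (\<lambda>t. indicator {0..1} t * v r t)" and mval: "(\<integral>t. indicator {0..1} t * v r t \<partial>lborel) = m r"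
    if r: "0 < r" "r < 1" for r
    using int[OF r, of "1 / 2"] val[OF r, of "1 / 2"] by (simp_all add: KKh m_def)
  have mnn: "0 \<le> m r" if r: "0 < r" "r < 1" for r
    unfolding mval[OF r, symmetric] by (rule Bochner_Integration.integral_nonneg) (use vnn[OF r] in \<open>auto simp: indicator_def\<close>)
  define rs where "rs n = 1 - inverse (real (Suc (Suc n)))" for n
  have rs: "0 < rs n" "rs n < 1" for n by (auto simp: rs_def field_simps)
  have rs1: "rs \<longlonglongrightarrow> 1"
    unfolding rs_def using tendsto_diff[OF tendsto_const[of 1] LIMSEQ_Suc[OF LIMSEQ_inverse_real_of_nat]] by simp
  have Glim: "(\<lambda>n. Re (G (of_real (rs n * x)))) \<longlonglongrightarrow> Re (G (of_real x))" if x: "\<bar>x\<bar> < 1" for x :: real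
  proof -
    have "(\<lambda>n. complex_of_real (rs n * x)) \<longlonglongrightarrow> of_real (1 * x)"
      by (intro tendsto_of_real tendsto_mult rs1 tendsto_const)
    then have l: "(\<lambda>n. complex_of_real (rs n * x)) \<longlonglongrightarrow> of_real x" by simp
    have "isCont G (of_real x)"
      using holomorphic_on_imp_continuous_on[OF hol] x by (simp add: continuous_on_eq_continuous_at)
    from tendsto_Re[OF isCont_tendsto_compose[OF this l]] show ?thesis .
  qed
  define mm where "mm = Re (G (1 / 2)) - Re (G 0)"
  have mlim: "(\<lambda>n. m (rs n)) \<longlonglongrightarrow> mm"
    unfolding m_def mm_def using tendsto_diff[OF Glim[of "1 / 2"] tendsto_const[of "Re (G 0)"]] by simp
  have mm: "0 \<le> mm" by (rule LIMSEQ_le_const[OF mlim]) (use mnn rs in auto)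
  show ?thesis
  proof (cases "mm = 0")
    case True
    \<comment> \<open>Degenerate case: the masses tend to 0 and the kernel is bounded (with 9 from
      |5 - 4 c| \<le> 9), so Re G is constant on the real diameter and any law on [-1, 1]
      serves.\<close>
    have "Re (G (of_real x)) = Re (G 0)" if x: "\<bar>x\<bar> < 1" for x :: real
    proof -
      define D where "D = 9 / (2 * (1 - \<bar>x\<bar>)\<^sup>2)"
      have D: "\<bar>KK x c\<bar> \<le> D" if c: "\<bar>c\<bar> \<le> 1" for c
      proof -
        have p: "0 < (1 - \<bar>x\<bar>)\<^sup>2" using x by simp
        have "\<bar>KK x c\<bar> = \<bar>x\<bar> * \<bar>5 - 4 * c\<bar> / (2 * (1 - 2 * x * c + x\<^sup>2))"
          using poisson_denominator_pos[OF x c] by (simp add: KKe[OF x c] abs_mult)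
        also have "\<dots> \<le> 1 * 9 / (2 * (1 - \<bar>x\<bar>)\<^sup>2)"
          using poisson_denominator_pos[OF x c] p x c by (intro frac_le mult_mono) auto
        finally show ?thesis by (simp add: D_def)
      qed
      have le: "\<bar>Re (G (of_real (rs n * x))) - Re (G 0)\<bar> \<le> D * m (rs n)" for n
      proof -
        have "\<bar>\<integral>t. indicator {0..1} t * (v (rs n) t * KK x (cos (2 * pi * t))) \<partial>lborel\<bar> \<le>
           (\<integral>t. D * (indicator {0..1} t * v (rs n) t) \<partial>lborel)"
        proof (rule integral_abs_bound_integral)
          fix t :: real
          have "\<bar>v (rs n) t * KK x (cos (2 * pi * t))\<bar> \<le> v (rs n) t * D"
            unfolding abs_mult using vnn[OF rs, of n t] D[of "cos (2 * pi * t)"] by (intro mult_mono) auto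
          then show "\<bar>indicator {0..1} t * (v (rs n) t * KK x (cos (2 * pi * t)))\<bar> \<le> D * (indicator {0..1} t * v (rs n) t)"
            by (simp add: indicator_def mult.commute)
        qed (use int[OF rs x] mint[OF rs] in auto)
        then show ?thesis by (simp add: val[OF rs x] mval[OF rs])
      qed
      have "(\<lambda>n. \<bar>Re (G (of_real (rs n * x))) - Re (G 0)\<bar>) \<longlonglongrightarrow> \<bar>Re (G (of_real x)) - Re (G 0)\<bar>"
        by (intro tendsto_intros Glim x)
      moreover have "(\<lambda>n. D * m (rs n)) \<longlonglongrightarrow> D * 0" using mlim True by (intro tendsto_intros) auto
      ultimately have "\<bar>Re (G (of_real x)) - Re (G 0)\<bar> \<le> D * 0" by (rule LIMSEQ_le) (use le in auto)
      then show ?thesis by simp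
    qed
    moreover have "real_distribution (return borel (0::real))"
      by (intro real_distribution.intro prob_space_return) (auto intro!: real_distribution_axioms.intro)
    moreover have "AE c in return borel (0::real). c \<in> {- 1..1}" by (subst AE_return) auto
    ultimately show ?thesis using True mm by (intro that[of "return borel 0"]) (auto simp: mm_def)
  next
    case False
    then have "0 < mm" using mm by simp
    then obtain n0 where n0: "\<And>n. n \<ge> n0 \<Longrightarrow> 0 < m (rs n)"
      using order_tendstoD(1)[OF mlim] by (auto simp: eventually_sequentially)
    define \<rho> where "\<rho> n = rs (n + n0)" for n
    have \<rho>: "0 < \<rho> n" "\<rho> n < 1" "0 < m (\<rho> n)" for n using rs n0 by (auto simp: \<rho>_def)
    define T where "T n = distr (density lborel (\<lambda>t. ennreal (indicator {0..1} t * v (\<rho> n) t / m (\<rho> n)))) borel (\<lambda>t. cos (2 * pi * t))" for n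
    have vm[measurable]: "v (\<rho> n) \<in> borel_measurable borel" for n
      by (rule borel_measurable_continuous_onI[OF vc]) (rule \<rho>)+
    have wnn: "0 \<le> indicator {0..1} t * v (\<rho> n) t / m (\<rho> n)" for n t
      using vnn[OF \<rho>(1,2), of n t] \<rho>(3)[of n] by (simp add: indicator_def)
    have Td: "real_distribution (T n)" for n
    proof -
      have "(\<integral>\<^sup>+t. ennreal (indicator {0..1} t * v (\<rho> n) t / m (\<rho> n)) \<partial>lborel) =
         ennreal (\<integral>t. indicator {0..1} t * v (\<rho> n) t / m (\<rho> n) \<partial>lborel)"
        by (rule nn_integral_eq_integral) (use mint[OF \<rho>(1,2), of n] wnn in auto)
      also have "\<dots> = 1" using mval[OF \<rho>(1,2), of n] \<rho>(3)[of n] by simp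
      finally have "prob_space (density lborel (\<lambda>t. ennreal (indicator {0..1} t * v (\<rho> n) t / m (\<rho> n))))"
        by (intro prob_spaceI) (simp add: emeasure_density)
      then show ?thesis unfolding T_def
        by (intro real_distribution.intro prob_space.prob_space_distr) (auto intro!: real_distribution_axioms.intro)
    qed
    have Tae: "AE c in T n. c \<in> {- 1..1}" for n
      unfolding T_def by (subst AE_distr_iff) auto
    obtain s \<tau> where s: "strict_mono (s :: nat \<Rightarrow> nat)" and tau: "real_distribution \<tau>" "AE c in \<tau>. c \<in> {- 1..1}"
      and lim: "\<And>g :: real \<Rightarrow> real. continuous_on UNIV g \<Longrightarrow> (\<lambda>n. \<integral>x. g x \<partial>T (s n)) \<longlonglongrightarrow> (\<integral>x. g x \<partial>\<tau>)"
      by (rule helly_interval[of T "- 1" 1, OF Td Tae]) (rule that)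
    interpret tau: real_distribution \<tau> by fact
    show ?thesis
    proof (rule that[OF tau])
      show "Re (G 0) \<le> Re (G (1 / 2))" using mm by (simp add: mm_def)
      fix x :: real assume x: "\<bar>x\<bar> < 1"
      note [measurable] = borel_measurable_continuous_onI[OF KKc[OF x]]
      have TK: "(\<integral>c. KK x c \<partial>T n) = (Re (G (of_real (\<rho> n * x))) - Re (G 0)) / m (\<rho> n)" for n
      proof -
        have "(\<integral>c. KK x c \<partial>T n) = (\<integral>t. KK x (cos (2 * pi * t)) \<partial>density lborel (\<lambda>t. ennreal (indicator {0..1} t * v (\<rho> n) t / m (\<rho> n))))"
          unfolding T_def by (rule integral_distr) measurable
        also have "\<dots> = (\<integral>t. (indicator {0..1} t * v (\<rho> n) t / m (\<rho> n)) * KK x (cos (2 * pi * t)) \<partial>lborel)"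
          by (subst integral_density) (use wnn in auto)
        also have "\<dots> = (\<integral>t. (indicator {0..1} t * (v (\<rho> n) t * KK x (cos (2 * pi * t)))) / m (\<rho> n) \<partial>lborel)"
          by (rule Bochner_Integration.integral_cong) auto
        also have "\<dots> = (Re (G (of_real (\<rho> n * x))) - Re (G 0)) / m (\<rho> n)"
          using val[OF \<rho>(1,2) x, of n] by simp
        finally show ?thesis .
      qed
      have "(\<lambda>n. (Re (G (of_real (rs n * x))) - Re (G 0)) / m (rs n)) \<longlonglongrightarrow> (Re (G (of_real x)) - Re (G 0)) / mm"
        by (intro tendsto_intros Glim x mlim False)
      from LIMSEQ_ignore_initial_segment[OF this, of n0]
      have "(\<lambda>n. \<integral>c. KK x c \<partial>T n) \<longlonglongrightarrow> (Re (G (of_real x)) - Re (G 0)) / mm"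
        by (simp only: TK \<rho>_def)
      from LIMSEQ_subseq_LIMSEQ[OF this s] have "(\<lambda>n. \<integral>c. KK x c \<partial>T (s n)) \<longlonglongrightarrow> (Re (G (of_real x)) - Re (G 0)) / mm"
        by (simp add: o_def)
      then have "(Re (G (of_real x)) - Re (G 0)) / mm = (\<integral>c. KK x c \<partial>\<tau>)"
        using lim[OF KKc[OF x]] LIMSEQ_unique by blast
      moreover have "(\<integral>c. KK x c \<partial>\<tau>) = (\<integral>c. x * (5 - 4 * c) / (2 * (1 - 2 * x * c + x\<^sup>2)) \<partial>\<tau>)"
      proof (rule integral_cong_AE)
        show "AE c in \<tau>. KK x c = x * (5 - 4 * c) / (2 * (1 - 2 * x * c + x\<^sup>2))"
          using tau(2)
        proof eventually_elim
          case (elim c)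
          show ?case by (rule KKe[OF x]) (use elim in auto)
        qed
      qed measurable
      ultimately show "Re (G (of_real x)) - Re (G 0) =
        (Re (G (1 / 2)) - Re (G 0)) * (\<integral>c. x * (5 - 4 * c) / (2 * (1 - 2 * x * c + x\<^sup>2)) \<partial>\<tau>)"
        using False by (simp add: mm_def field_simps)
    qed
  qed
qed

section \<open>The Thorin measure\<close>

context pos_mixture begin

definition p :: "real \<Rightarrow> real" where "p s = s * (\<integral>\<omega>. B \<omega> / (1 + s * B \<omega>)\<^sup>2 \<partial>M) / f s"

lemma P_of_real: "P (of_real s) = of_real (p s)"
  by (simp add: P_def F_of_real F'_of_real p_def)

lemma p_nonneg:
  assumes "0 \<le> s"
  shows "0 \<le> p s"
proof -
  have "0 \<le> (\<integral>\<omega>. B \<omega> / (1 + s * B \<omega>)\<^sup>2 \<partial>M)"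
    by (rule Bochner_Integration.integral_nonneg) (use B_pos in \<open>auto simp: less_imp_le\<close>)
  then show ?thesis using assms f_pos[OF assms] by (simp add: p_def)
qed

lemma slit_of_real: "0 < s \<Longrightarrow> of_real s \<in> slit"
  by (simp add: slit_iff)

lemma f_has_derivative:
  assumes "0 < s"
  shows "(f has_real_derivative (- (p s / s * f s))) (at s)"
proof -
  have "((\<lambda>t. F (of_real t)) has_vector_derivative F' (of_real s)) (at s)"
    by (rule has_vector_derivative_real_field, rule F_has_derivative, rule slit_of_real[OF assms])
  then have "((\<lambda>t. Re (F (of_real t))) has_vector_derivative Re (F' (of_real s))) (at s)"
    by (rule bounded_linear.has_vector_derivative[OF bounded_linear_Re])
  then have "(f has_real_derivative Re (F' (of_real s))) (at s)"
    by (simp add: F_of_real has_real_derivative_iff_has_vector_derivative)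
  moreover have "Re (F' (of_real s)) = - (p s / s * f s)"
    using f_pos[of s] assms by (simp add: F'_of_real p_def)
  ultimately show ?thesis by simp
qed

lemma f_tendsto_1:
  assumes "e \<longlonglongrightarrow> 0" "\<And>n. 0 \<le> e n"
  shows "(\<lambda>n. f (e n)) \<longlonglongrightarrow> 1"
proof -
  have "(\<lambda>n. \<integral>\<omega>. 1 / (1 + e n * B \<omega>) \<partial>M) \<longlonglongrightarrow> (\<integral>\<omega>. 1 / (1 + 0 * B \<omega>) \<partial>M)"
  proof (rule integral_dominated_convergence[where w="\<lambda>_. 1"])
    show "AE \<omega> in M. (\<lambda>n. 1 / (1 + e n * B \<omega>)) \<longlonglongrightarrow> 1 / (1 + 0 * B \<omega>)"
      by (intro AE_I2 tendsto_intros assms(1)) simp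
    show "AE \<omega> in M. norm (1 / (1 + e n * B \<omega>)) \<le> 1" for n
    proof (rule AE_I2)
      fix \<omega>
      have "0 \<le> e n * B \<omega>" using assms(2)[of n] B_pos[of \<omega>] by simp
      then show "norm (1 / (1 + e n * B \<omega>)) \<le> 1" by (simp add: abs_of_pos)
    qed
  qed auto
  then show ?thesis by (simp add: f_def prob_space)
qed

text \<open>B may have infinite mean, so e n stays inside the integral, where y / (1 + y)^2 \<le> 1
  with y = e n B gives a constant majorant.\<close>

lemma p_tendsto_0:
  assumes "e \<longlonglongrightarrow> 0" "\<And>n. 0 \<le> e n"
  shows "(\<lambda>n. p (e n)) \<longlonglongrightarrow> 0"
proof -
  have "(\<lambda>n. \<integral>\<omega>. e n * (B \<omega> / (1 + e n * B \<omega>)\<^sup>2) \<partial>M) \<longlonglongrightarrow> (\<integral>\<omega>. 0 * (B \<omega> / (1 + 0 * B \<omega>)\<^sup>2) \<partial>M)"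
  proof (rule integral_dominated_convergence[where w="\<lambda>_. 1"])
    show "AE \<omega> in M. (\<lambda>n. e n * (B \<omega> / (1 + e n * B \<omega>)\<^sup>2)) \<longlonglongrightarrow> 0 * (B \<omega> / (1 + 0 * B \<omega>)\<^sup>2)"
      by (intro AE_I2 tendsto_intros assms(1)) simp
    show "AE \<omega> in M. norm (e n * (B \<omega> / (1 + e n * B \<omega>)\<^sup>2)) \<le> 1" for n
    proof (rule AE_I2)
      fix \<omega>
      define y where "y = e n * B \<omega>"
      have y: "0 \<le> y" using assms(2)[of n] B_pos[of \<omega>] by (simp add: y_def)
      have "y \<le> (1 + y)\<^sup>2" using y by (simp add: power2_eq_square algebra_simps)
      then have "y / (1 + y)\<^sup>2 \<le> 1" using y by (simp add: divide_le_eq_1)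
      then show "norm (e n * (B \<omega> / (1 + e n * B \<omega>)\<^sup>2)) \<le> 1" using y by (simp add: y_def)
    qed
  qed auto
  then have "(\<lambda>n. e n * (\<integral>\<omega>. B \<omega> / (1 + e n * B \<omega>)\<^sup>2 \<partial>M)) \<longlonglongrightarrow> 0"
    by (simp only: integral_mult_right_zero) simp
  from tendsto_divide[OF this f_tendsto_1[OF assms]] show ?thesis by (simp add: p_def)
qed

text \<open>m, the square of the Cayley transform, takes the disc to the slit plane, the upper
  half-disc to the upper half-plane and the real diameter to the positive axis. At x = (sqrt s - 1)
  / (sqrt s + 1) the kernel becomes rational in s.\<close>

lemma p_representation:
  assumes hcm: "log_HCM (\<lambda>r. f (exp r))"
  obtains \<tau> K where "real_distribution \<tau>" "AE c in \<tau>. c \<in> {- 1..1}" "0 \<le> K"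
    "\<And>s. 0 < s \<Longrightarrow> p s = p 1 + (\<integral>c. K * (5 - 4 * c) * (s - 1) / (2 * (s * (1 - c) + 1 + c)) \<partial>\<tau>)"
proof -
  define m where "m \<zeta> = ((1 + \<zeta>) / (1 - \<zeta>))\<^sup>2" for \<zeta> :: complex
  define G where "G \<zeta> = P (m \<zeta>)" for \<zeta>
  have cayley: "Re ((1 + \<zeta>) / (1 - \<zeta>)) = (1 - (cmod \<zeta>)\<^sup>2) / (cmod (1 - \<zeta>))\<^sup>2"
    "Im ((1 + \<zeta>) / (1 - \<zeta>)) = 2 * Im \<zeta> / (cmod (1 - \<zeta>))\<^sup>2" for \<zeta>
    unfolding cmod_power2 by (simp_all add: Re_divide Im_divide power2_eq_square algebra_simps)
  have pos: "0 < Re ((1 + \<zeta>) / (1 - \<zeta>))" and ne: "1 - \<zeta> \<noteq> 0" if "\<zeta> \<in> ball 0 1" for \<zeta>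
  proof -
    have n: "cmod \<zeta> < 1" using that by simp
    then show ne: "1 - \<zeta> \<noteq> 0" by auto
    have "(cmod \<zeta>)\<^sup>2 < 1" using n by (simp add: abs_square_less_1)
    then show "0 < Re ((1 + \<zeta>) / (1 - \<zeta>))" unfolding cayley using ne by simp
  qed
  have m_slit: "m \<zeta> \<in> slit" if z: "\<zeta> \<in> ball 0 1" for \<zeta>
    using pos[OF z] unfolding m_def slit_iff by (auto simp: Re_power2 Im_power2 simp del: Re_divide)
  have m_Im: "0 < Im (m \<zeta>)" if z: "\<zeta> \<in> ball 0 1" and "0 < Im \<zeta>" for \<zeta>
  proof -
    have "0 < Im ((1 + \<zeta>) / (1 - \<zeta>))" unfolding cayley using that ne[OF z] by simp
    then show ?thesis unfolding m_def Im_power2 using pos[OF z] by simp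
  qed
  have "(P \<circ> m) holomorphic_on ball 0 1"
    by (rule holomorphic_on_compose_gen[OF _ P_holomorphic])
      (use m_slit ne in \<open>auto simp: m_def[abs_def] intro!: holomorphic_intros\<close>)
  then have G_hol: "G holomorphic_on ball 0 1" by (simp add: o_def G_def[abs_def])
  have G_cnj: "G (cnj \<zeta>) = cnj (G \<zeta>)" for \<zeta>
    unfolding G_def P_cnj[symmetric] by (simp add: m_def)
  obtain \<tau> where tau: "real_distribution \<tau>" "AE c in \<tau>. c \<in> {- 1..1}" and le: "Re (G 0) \<le> Re (G (1 / 2))"
    and rep: "\<And>x::real. \<bar>x\<bar> < 1 \<Longrightarrow> Re (G (of_real x)) - Re (G 0) =
      (Re (G (1 / 2)) - Re (G 0)) * (\<integral>c. x * (5 - 4 * c) / (2 * (1 - 2 * x * c + x\<^sup>2)) \<partial>\<tau>)"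
    by (rule typically_real_representation[OF G_hol G_cnj]) (use Im_P_nonneg[OF hcm] m_Im in \<open>auto simp: G_def intro: that\<close>)
  interpret tau: real_distribution \<tau> by fact
  define K where "K = (Re (G (1 / 2)) - Re (G 0)) / 2"
  show ?thesis
  proof (rule that[OF tau])
    show "0 \<le> K" using le by (simp add: K_def)
    fix s :: real assume s: "0 < s"
    define q where "q = sqrt s"
    have q: "0 < q" "s = q\<^sup>2" using s by (auto simp: q_def)
    define x where "x = (q - 1) / (q + 1)"
    have x: "\<bar>x\<bar> < 1" using q by (auto simp: x_def abs_if field_simps)
    have "(1 + x) / (1 - x) = q" using q by (simp add: x_def field_simps)
    then have "m (of_real x) = of_real s" unfolding m_def q(2) by (metis of_real_1 of_real_add of_real_diff of_real_divide of_real_power)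
    then have Gx: "Re (G (of_real x)) = p s" by (simp add: G_def P_of_real)
    have G0: "Re (G 0) = p 1" using P_of_real[of 1] by (simp add: G_def m_def)
    have ker: "x * (5 - 4 * c) / (2 * (1 - 2 * x * c + x\<^sup>2)) = (5 - 4 * c) * (s - 1) / (4 * (s * (1 - c) + 1 + c))"
      if c: "c \<in> {- 1..1}" for c
    proof -
      have k: "0 < 1 - 2 * x * c + x\<^sup>2" by (rule poisson_denominator_pos[OF x]) (use c in auto)
      \<comment> \<open>Multiplying by (q + 1)^2 clears the denominator of x and leaves an
        expression in s = q^2 alone.\<close>
      have e1: "(1 - 2 * x * c + x\<^sup>2) * (q + 1)\<^sup>2 = 2 * (s * (1 - c) + 1 + c)"
      proof -
        have "x * (q + 1) = q - 1" using q by (simp add: x_def)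
        moreover have "(1 - 2 * x * c + x\<^sup>2) * (q + 1)\<^sup>2 = (q + 1)\<^sup>2 - 2 * c * (x * (q + 1)) * (q + 1) + (x * (q + 1))\<^sup>2"
          by (simp add: algebra_simps power2_eq_square)
        ultimately have "(1 - 2 * x * c + x\<^sup>2) * (q + 1)\<^sup>2 = (q + 1)\<^sup>2 - 2 * c * (q - 1) * (q + 1) + (q - 1)\<^sup>2"
          by (simp only:)
        then show ?thesis by (simp add: q power2_eq_square algebra_simps)
      qed
      have e2: "x * (q + 1)\<^sup>2 = s - 1" using q by (simp add: x_def power2_eq_square field_simps)
      have d: "0 < 2 * (s * (1 - c) + 1 + c)" unfolding e1[symmetric] using k q by simp
      have "x / (1 - 2 * x * c + x\<^sup>2) = (x * (q + 1)\<^sup>2) / ((1 - 2 * x * c + x\<^sup>2) * (q + 1)\<^sup>2)"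
        using q by simp
      also have "\<dots> = (s - 1) / (2 * (s * (1 - c) + 1 + c))" by (simp only: e1 e2)
      finally have "x / (1 - 2 * x * c + x\<^sup>2) = (s - 1) / (2 * (s * (1 - c) + 1 + c))" .
      then have "x / (1 - 2 * x * c + x\<^sup>2) * ((5 - 4 * c) / 2) = (s - 1) / (2 * (s * (1 - c) + 1 + c)) * ((5 - 4 * c) / 2)"
        by (simp only:)
      then show ?thesis by (simp add: mult.commute)
    qed
    have "p s - p 1 = 2 * K * (\<integral>c. x * (5 - 4 * c) / (2 * (1 - 2 * x * c + x\<^sup>2)) \<partial>\<tau>)"
      using rep[OF x] by (simp add: Gx G0 K_def)
    also have "(\<integral>c. x * (5 - 4 * c) / (2 * (1 - 2 * x * c + x\<^sup>2)) \<partial>\<tau>) = (\<integral>c. (5 - 4 * c) * (s - 1) / (4 * (s * (1 - c) + 1 + c)) \<partial>\<tau>)"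
    proof (rule integral_cong_AE)
      show "AE c in \<tau>. x * (5 - 4 * c) / (2 * (1 - 2 * x * c + x\<^sup>2)) = (5 - 4 * c) * (s - 1) / (4 * (s * (1 - c) + 1 + c))"
        using tau(2) by eventually_elim (rule ker)
    qed measurable
    also have "2 * K * \<dots> = (\<integral>c. 2 * K * ((5 - 4 * c) * (s - 1) / (4 * (s * (1 - c) + 1 + c))) \<partial>\<tau>)"
      by (simp only: integral_mult_right_zero)
    also have "\<dots> = (\<integral>c. K * (5 - 4 * c) * (s - 1) / (2 * (s * (1 - c) + 1 + c)) \<partial>\<tau>)"
    proof (rule Bochner_Integration.integral_cong[OF refl])
      have "2 * K * (X / (4 * Y)) = K * X / (2 * Y)" for X Y :: real by simp
      then show "2 * K * ((5 - 4 * c) * (s - 1) / (4 * (s * (1 - c) + 1 + c))) = K * (5 - 4 * c) * (s - 1) / (2 * (s * (1 - c) + 1 + c))" for c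
        by (simp only: mult.assoc)
    qed
    finally show "p s = p 1 + (\<integral>c. K * (5 - 4 * c) * (s - 1) / (2 * (s * (1 - c) + 1 + c)) \<partial>\<tau>)" by simp
  qed
qed

end

context pos_mixture begin

text \<open>Since \<open>p s\<close> vanishes as \<open>s \<rightarrow> 0\<close>, the constant \<open>p 1\<close> can be absorbed into the integral; this also
  excludes an atom at \<open>c = - 1\<close>. The point \<open>c\<close> corresponds to \<open>u = (1 + c) / (1 - c)\<close> in the Thorin
  measure, and \<open>c = 1\<close> to the drift.\<close>

lemma p_integral_representation:
  assumes hcm: "log_HCM (\<lambda>r. f (exp r))"
  obtains \<tau> h where "real_distribution \<tau>" "AE c in \<tau>. c \<in> {- 1..1}" "h \<in> borel_measurable borel"
    "\<And>c. c \<le> 1 \<Longrightarrow> 0 \<le> h c" "AE c in \<tau>. h c = 0 \<or> - 1 < c"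
    "\<And>s. 0 < s \<Longrightarrow> integrable \<tau> (\<lambda>c. h c / ((1 + c) * (s * (1 - c) + 1 + c)))"
    "\<And>s. 0 < s \<Longrightarrow> p s / s = (\<integral>c. h c / ((1 + c) * (s * (1 - c) + 1 + c)) \<partial>\<tau>)"
proof -
  obtain \<tau> K where tau: "real_distribution \<tau>" "AE c in \<tau>. c \<in> {- 1..1}" and K: "0 \<le> K"
    and rep: "\<And>s. 0 < s \<Longrightarrow> p s = p 1 + (\<integral>c. K * (5 - 4 * c) * (s - 1) / (2 * (s * (1 - c) + 1 + c)) \<partial>\<tau>)"
    by (rule p_representation[OF hcm]) (rule that)
  interpret tau: real_distribution \<tau> by fact
  define h where "h c = K * (5 - 4 * c)" for c
  have hm[measurable]: "h \<in> borel_measurable borel" unfolding h_def by measurable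
  have h: "0 \<le> h c" if "c \<le> 1" for c using K that by (simp add: h_def)
  have hle: "h c \<le> 9 * K" if "- 1 \<le> c" for c using mult_left_mono[OF _ K, of "5 - 4 * c" 9] that by (simp add: h_def mult.commute)
  define D where "D s c = s * (1 - c) + 1 + c" for s c :: real
  have D: "0 < D s c" "min 1 s \<le> D s c / 2" if "0 < s" "c \<in> {- 1..1}" for s c
  proof -
    have "min 1 s * (1 - c) \<le> s * (1 - c)" "min 1 s * (1 + c) \<le> 1 * (1 + c)"
      using that by (intro mult_right_mono; auto)+
    then have "2 * min 1 s \<le> D s c" by (simp add: D_def algebra_simps)
    then show "min 1 s \<le> D s c / 2" "0 < D s c" using that by (auto simp: min_def split: if_splits)
  qed
  have Dm[measurable]: "D s \<in> borel_measurable borel" for s unfolding D_def by measurable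
  have int: "integrable \<tau> (\<lambda>c. h c * (s - 1) / (2 * D s c))" if s: "0 < s" for s
  proof (rule tau.integrable_const_bound)
    show "AE c in \<tau>. norm (h c * (s - 1) / (2 * D s c)) \<le> 9 * K * \<bar>s - 1\<bar> / (4 * min 1 s)"
      using tau(2)
    proof eventually_elim
      case (elim c)
      have "norm (h c * (s - 1) / (2 * D s c)) = h c * \<bar>s - 1\<bar> / (2 * D s c)"
        using D[OF s elim] h[of c] elim by (simp add: abs_mult)
      also have "\<dots> \<le> 9 * K * \<bar>s - 1\<bar> / (4 * min 1 s)"
        using D[OF s elim] hle[of c] h[of c] elim s K by (intro frac_le mult_right_mono) auto
      finally show ?case .
    qed
  qed measurable
  \<comment> \<open>Decreases to 0 and, owing to the second Suc, stays strictly below 1, so that 1 -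
    e n is positive.\<close>
  define e where "e n = inverse (real (Suc (Suc n)))" for n
  have e: "0 < e n" "e n < 1" for n by (auto simp: e_def field_simps)
  have e_dec: "e n \<le> e m" if "m \<le> n" for m n using that by (simp add: e_def field_simps)
  have e0: "e \<longlonglongrightarrow> 0" unfolding e_def by (rule LIMSEQ_Suc[OF LIMSEQ_inverse_real_of_nat])
  define k where "k n c = h c * (1 - e n) / (2 * D (e n) c)" for n c
  have kint: "integrable \<tau> (k n)" and kval: "(\<integral>c. k n c \<partial>\<tau>) = p 1 - p (e n)" for n
  proof -
    have kk: "k n c = - (h c * (e n - 1) / (2 * D (e n) c))" for c by (simp add: k_def minus_divide_left algebra_simps)
    show "integrable \<tau> (k n)" unfolding kk[abs_def] using int[OF e(1)] by simp
    show "(\<integral>c. k n c \<partial>\<tau>) = p 1 - p (e n)" unfolding kk using rep[OF e(1), of n] by (simp add: h_def D_def)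
  qed
  have kmeas[measurable]: "k n \<in> borel_measurable borel" for n unfolding k_def by measurable
  have h0: "AE c in \<tau>. h c = 0 \<or> - 1 < c"
  proof (cases "K = 0")
    case False
    define Q where "Q = measure \<tau> {- 1}"
    \<comment> \<open>At c = - 1 the integrand is 9 K (1 - e n) / (4 e n), unbounded as e n -> 0,
      whereas the integral p 1 - p (e n) is at most p 1; an atom there is impossible.\<close>
    have "9 * K * Q * (1 - e n) \<le> 4 * e n * p 1" for n
    proof -
      have "(\<integral>c. (9 * K * (1 - e n) / (4 * e n)) * indicator {- 1} c \<partial>\<tau>) \<le> (\<integral>c. k n c \<partial>\<tau>)"
      proof (rule integral_mono_AE)
        show "AE c in \<tau>. (9 * K * (1 - e n) / (4 * e n)) * indicator {- 1} c \<le> k n c"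
          using tau(2)
        proof eventually_elim
          case (elim c)
          show ?case
          proof (cases "c = - 1")
            case True
            then show ?thesis by (simp add: k_def h_def D_def mult_ac)
          next
            case False
            then show ?thesis using D[OF e(1) elim, of n] h[of c] e[of n] elim by (simp add: k_def)
          qed
        qed
      qed (use kint in \<open>auto intro!: integrable_mult_right integrable_real_indicator simp: tau.emeasure_finite less_top[symmetric]\<close>)
      then have "9 * K * (1 - e n) / (4 * e n) * Q \<le> p 1 - p (e n)" by (simp add: kval Q_def)
      also have "\<dots> \<le> p 1" using p_nonneg[of "e n"] e(1)[of n] by simp
      finally show ?thesis using e(1)[of n] by (simp add: field_simps)
    qed
    then have "9 * K * Q * (1 - 0) \<le> 4 * 0 * p 1"
      by (intro LIMSEQ_le[where X="\<lambda>n. 9 * K * Q * (1 - e n)" and Y="\<lambda>n. 4 * e n * p 1"] tendsto_intros e0) auto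
    then have "Q \<le> 0" using K False by (simp add: mult_le_0_iff)
    then have "measure \<tau> {- 1} = 0" by (simp add: Q_def measure_le_0_iff)
    then have "AE c in \<tau>. c \<notin> {- 1}"
      by (subst AE_iff_measurable[OF _ refl]) (auto simp: tau.emeasure_eq_measure)
    with tau(2) show ?thesis by eventually_elim auto
  qed (simp add: h_def)
  \<comment> \<open>Monotone convergence along e n -> 0; as p (e n) tends to 0, the limit is p 1
    itself, now written as an integral against \<tau>.\<close>
  have lim: "integrable \<tau> (\<lambda>c. h c / (2 * (1 + c)))" "(\<integral>c. h c / (2 * (1 + c)) \<partial>\<tau>) = p 1"
  proof -
    have 1: "AE c in \<tau>. mono (\<lambda>n. k n c)"
      using tau(2)
    proof eventually_elim
      case (elim c)
      show ?case
      proof (rule monoI)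
        fix m n :: nat assume mn: "m \<le> n"
        have "D (e n) c \<le> D (e m) c" using e_dec[OF mn] elim by (auto simp: D_def intro: mult_right_mono)
        then show "k m c \<le> k n c"
          unfolding k_def using e_dec[OF mn] h[of c] elim D[OF e(1) elim, of n] e[of n] D[OF e(1) elim, of m]
          by (intro frac_le mult_left_mono mult_nonneg_nonneg) auto
      qed
    qed
    have 2: "AE c in \<tau>. (\<lambda>n. k n c) \<longlonglongrightarrow> h c / (2 * (1 + c))"
      using h0
    proof eventually_elim
      case (elim c)
      show ?case
      proof (cases "h c = 0")
        case False
        then have c: "- 1 < c" using elim by simp
        have "(\<lambda>n. k n c) \<longlonglongrightarrow> h c * (1 - 0) / (2 * (0 * (1 - c) + 1 + c))"
          unfolding k_def D_def by (intro tendsto_intros e0) (use c in auto)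
        then show ?thesis by simp
      qed (simp add: k_def)
    qed
    have 3: "(\<lambda>n. \<integral>c. k n c \<partial>\<tau>) \<longlonglongrightarrow> p 1"
      unfolding kval using tendsto_diff[OF tendsto_const[of "p 1"] p_tendsto_0[OF e0]] e(1) by (simp add: less_imp_le)
    show "integrable \<tau> (\<lambda>c. h c / (2 * (1 + c)))"
      by (rule integrable_monotone_convergence[OF kint 1 2 3]) measurable
    show "(\<integral>c. h c / (2 * (1 + c)) \<partial>\<tau>) = p 1"
      by (rule integral_monotone_convergence[OF kint 1 2 3]) measurable
  qed
  have fin: "integrable \<tau> (\<lambda>c. h c / ((1 + c) * D s c))" "p s / s = (\<integral>c. h c / ((1 + c) * D s c) \<partial>\<tau>)" if s: "0 < s" for s
  proof -
    have i: "integrable \<tau> (\<lambda>c. (h c / (2 * (1 + c)) + h c * (s - 1) / (2 * D s c)) / s)"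
      using lim(1) int[OF s] by simp
    have ae: "AE c in \<tau>. (h c / (2 * (1 + c)) + h c * (s - 1) / (2 * D s c)) / s = h c / ((1 + c) * D s c)"
      using h0 tau(2)
    proof eventually_elim
      case (elim c)
      show ?case
      proof (cases "h c = 0")
        case False
        then have c: "0 < 1 + c" using elim by simp
        have d: "0 < D s c" using D[OF s elim(2)] by simp
        \<comment> \<open>This identity merges the absorbed constant and the kernel into one
          fraction, with a factor s that cancels in p s / s.\<close>
        have e: "D s c + (s - 1) * (1 + c) = 2 * s" by (simp add: D_def algebra_simps)
        have gen: "(H / (2 * a) + H * b / (2 * d)) / s = H * (d + b * a) / (2 * s * (a * d))" if "0 < a" "0 < d" for H a b d :: real
          using that s by (simp add: field_simps)
        have "(h c / (2 * (1 + c)) + h c * (s - 1) / (2 * D s c)) / s = h c * (2 * s) / (2 * s * ((1 + c) * D s c))"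
          by (simp only: gen[OF c d] e)
        then show ?thesis using s by simp
      qed simp
    qed
    show "integrable \<tau> (\<lambda>c. h c / ((1 + c) * D s c))"
      by (rule integrable_cong_AE_imp[OF i _ ae]) measurable
    have "p s / s = (\<integral>c. (h c / (2 * (1 + c)) + h c * (s - 1) / (2 * D s c)) / s \<partial>\<tau>)"
    proof -
      have "p s = (\<integral>c. h c / (2 * (1 + c)) \<partial>\<tau>) + (\<integral>c. h c * (s - 1) / (2 * D s c) \<partial>\<tau>)"
        using rep[OF s] lim(2) by (simp only: h_def D_def)
      also have "\<dots> = (\<integral>c. h c / (2 * (1 + c)) + h c * (s - 1) / (2 * D s c) \<partial>\<tau>)"
        by (rule Bochner_Integration.integral_add[OF lim(1) int[OF s], symmetric])
      finally show ?thesis by (simp only: integral_divide_zero)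
    qed
    also have "\<dots> = (\<integral>c. h c / ((1 + c) * D s c) \<partial>\<tau>)"
      by (rule integral_cong_AE[OF _ _ ae]) measurable
    finally show "p s / s = (\<integral>c. h c / ((1 + c) * D s c) \<partial>\<tau>)" .
  qed
  show ?thesis by (rule that[OF tau hm h h0 fin[unfolded D_def]])
qed

text \<open>p s / s is the derivative of - ln f. Its kernel is integrated over [r, s] by Tonelli,
  everything being nonnegative; r -> 0 is a monotone limit in which f r -> 1, and the integrability
  of the primitive comes out of this limit.\<close>

lemma neg_ln_f_representation:
  assumes hcm: "log_HCM (\<lambda>r. f (exp r))"
  obtains \<tau> h where "real_distribution \<tau>" "AE c in \<tau>. c \<in> {- 1..1}" "h \<in> borel_measurable borel"
    "\<And>c. c \<le> 1 \<Longrightarrow> 0 \<le> h c" "AE c in \<tau>. h c = 0 \<or> - 1 < c"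
    "\<And>s. 0 < s \<Longrightarrow> integrable \<tau> (\<lambda>c. if c = 1 then h c * s / 4 else h c * ln (1 + s * (1 - c) / (1 + c)) / ((1 + c) * (1 - c)))"
    "\<And>s. 0 < s \<Longrightarrow> - ln (f s) = (\<integral>c. (if c = 1 then h c * s / 4 else h c * ln (1 + s * (1 - c) / (1 + c)) / ((1 + c) * (1 - c))) \<partial>\<tau>)"
proof -
  obtain \<tau> h where tau: "real_distribution \<tau>" "AE c in \<tau>. c \<in> {- 1..1}" and hm[measurable]: "h \<in> borel_measurable borel"
    and h: "\<And>c. c \<le> 1 \<Longrightarrow> 0 \<le> h c" and h0: "AE c in \<tau>. h c = 0 \<or> - 1 < c"
    and int: "\<And>s. 0 < s \<Longrightarrow> integrable \<tau> (\<lambda>c. h c / ((1 + c) * (s * (1 - c) + 1 + c)))"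
    and rep: "\<And>s. 0 < s \<Longrightarrow> p s / s = (\<integral>c. h c / ((1 + c) * (s * (1 - c) + 1 + c)) \<partial>\<tau>)"
    by (rule p_integral_representation[OF hcm]) (rule that)
  interpret tau: real_distribution \<tau> by fact
  interpret P: pair_sigma_finite \<tau> lborel ..
  \<comment> \<open>The primitive in s of \<open>g s c\<close> that vanishes at s = 0. At c = 1 the
    kernel is the constant h c / 4, whence the linear branch.\<close>
  define \<Lambda> where "\<Lambda> s c = (if c = 1 then h c * s / 4 else h c * ln (1 + s * (1 - c) / (1 + c)) / ((1 + c) * (1 - c)))" for s c :: real
  define g where "g s c = h c / ((1 + c) * (s * (1 - c) + 1 + c))" for s c :: real
  have \<Lambda>m[measurable]: "\<Lambda> s \<in> borel_measurable borel" for s unfolding \<Lambda>_def by measurable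
  have good: "AE c in \<tau>. c \<le> 1 \<and> (h c = 0 \<or> - 1 < c)" using tau(2) h0 by eventually_elim auto
  have gnn: "0 \<le> g s c" if "0 \<le> s" "c \<le> 1 \<and> (h c = 0 \<or> - 1 < c)" for s c
  proof (cases "h c = 0")
    case False
    have "0 \<le> s * (1 - c)" using that by simp
    then show ?thesis unfolding g_def using that False h[of c]
      by (intro divide_nonneg_nonneg mult_nonneg_nonneg) (auto simp: add.assoc)
  qed (simp add: g_def)
  have \<Lambda>_deriv: "(\<Lambda>' has_real_derivative g s c) (at s)" if s: "0 < s" and c: "c \<le> 1 \<and> (h c = 0 \<or> - 1 < c)" and L: "\<Lambda>' = (\<lambda>s. \<Lambda> s c)" for s c \<Lambda>'
  proof (cases "c = 1 \<or> h c = 0")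
    case True
    show ?thesis
    proof (cases "c = 1")
      case True
      then show ?thesis unfolding L by (auto simp: \<Lambda>_def g_def intro!: derivative_eq_intros)
    next
      case False
      then show ?thesis using True unfolding L by (simp add: \<Lambda>_def g_def)
    qed
  next
    case False
    then have c': "- 1 < c" "c < 1" "c \<noteq> 1" using c by auto
    have pos: "0 < 1 + s * (1 - c) / (1 + c)" using c' s by (intro add_pos_nonneg) auto
    have "((\<lambda>s. h c * ln (1 + s * (1 - c) / (1 + c)) / ((1 + c) * (1 - c))) has_real_derivative
        h c * (((1 - c) / (1 + c)) / (1 + s * (1 - c) / (1 + c))) / ((1 + c) * (1 - c))) (at s)"
      using pos c' by (auto intro!: derivative_eq_intros)
    moreover have "h c * (((1 - c) / (1 + c)) / (1 + s * (1 - c) / (1 + c))) / ((1 + c) * (1 - c)) = g s c"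
    proof -
      have "1 + s * (1 - c) / (1 + c) = (s * (1 - c) + 1 + c) / (1 + c)" using c' by (simp add: field_simps)
      then have "((1 - c) / (1 + c)) / (1 + s * (1 - c) / (1 + c)) = (1 - c) / (s * (1 - c) + 1 + c)" using c' by simp
      then show ?thesis using c' by (simp add: g_def)
    qed
    ultimately show ?thesis unfolding L \<Lambda>_def using c' by simp
  qed
  have diff: "integrable \<tau> (\<lambda>c. \<Lambda> s c - \<Lambda> r c)" "(\<integral>c. \<Lambda> s c - \<Lambda> r c \<partial>\<tau>) = ln (f r) - ln (f s)"
    and diffnn: "AE c in \<tau>. 0 \<le> \<Lambda> s c - \<Lambda> r c" if r: "0 < r" "r \<le> s" for r s
  proof -
    have fm[measurable]: "f \<in> borel_measurable borel" unfolding f_def by measurable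
    have pm[measurable]: "(\<lambda>t. p t / t) \<in> borel_measurable borel" unfolding p_def by measurable
    have ftc1: "(\<integral>\<^sup>+t. ennreal (p t / t) * indicator {r..s} t \<partial>lborel) = ennreal (- ln (f s) - - ln (f r))"
    proof (rule nn_integral_FTC_Icc[OF pm])
      fix t assume t: "t \<in> {r..s}"
      then have t0: "0 < t" using r by simp
      have "((\<lambda>t. - ln (f t)) has_real_derivative - ((- (p t / t * f t)) / f t)) (at t)"
        using f_pos[of t] t0 by (auto intro!: derivative_eq_intros f_has_derivative simp: divide_inverse mult.commute)
      then show "((\<lambda>t. - ln (f t)) has_real_derivative p t / t) (at t)"
        using f_pos[of t] t0 by simp
      show "0 \<le> p t / t" using p_nonneg[of t] t0 by simp
    qed (use r in auto)
    have ftc2: "(\<integral>\<^sup>+t. ennreal (g t c) * indicator {r..s} t \<partial>lborel) = ennreal (\<Lambda> s c - \<Lambda> r c)" and ge: "0 \<le> \<Lambda> s c - \<Lambda> r c"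
      if c: "c \<le> 1 \<and> (h c = 0 \<or> - 1 < c)" for c
    proof -
      show "(\<integral>\<^sup>+t. ennreal (g t c) * indicator {r..s} t \<partial>lborel) = ennreal (\<Lambda> s c - \<Lambda> r c)"
      proof (rule nn_integral_FTC_Icc)
        show "(\<lambda>t. g t c) \<in> borel_measurable borel" unfolding g_def by measurable
        show "((\<lambda>s. \<Lambda> s c) has_real_derivative g t c) (at t)" if "t \<in> {r..s}" for t
          by (rule \<Lambda>_deriv[OF _ c refl]) (use that r in auto)
        show "0 \<le> g t c" if "t \<in> {r..s}" for t by (rule gnn[OF _ c]) (use that r in auto)
      qed (use r in auto)
      have "\<Lambda> r c \<le> \<Lambda> s c"
      proof (rule DERIV_nonneg_imp_nondecreasing[OF r(2)])
        fix t assume "r \<le> t" "t \<le> s"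
        then show "\<exists>y. ((\<lambda>s. \<Lambda> s c) has_real_derivative y) (at t) \<and> 0 \<le> y"
          using \<Lambda>_deriv[OF _ c refl, of t] gnn[OF _ c, of t] r by auto
      qed
      then show "0 \<le> \<Lambda> s c - \<Lambda> r c" by simp
    qed
    show ae: "AE c in \<tau>. 0 \<le> \<Lambda> s c - \<Lambda> r c" using good by eventually_elim (rule ge)
    have "(\<integral>\<^sup>+c. ennreal (\<Lambda> s c - \<Lambda> r c) \<partial>\<tau>) = (\<integral>\<^sup>+c. \<integral>\<^sup>+t. ennreal (g t c) * indicator {r..s} t \<partial>lborel \<partial>\<tau>)"
    proof (rule nn_integral_cong_AE)
      show "AE c in \<tau>. ennreal (\<Lambda> s c - \<Lambda> r c) = (\<integral>\<^sup>+t. ennreal (g t c) * indicator {r..s} t \<partial>lborel)"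
        using good by eventually_elim (simp only: ftc2)
    qed
    also have "\<dots> = (\<integral>\<^sup>+t. \<integral>\<^sup>+c. ennreal (g t c) * indicator {r..s} t \<partial>\<tau> \<partial>lborel)"
      unfolding g_def by (rule P.Fubini'[symmetric]) measurable
    also have "\<dots> = (\<integral>\<^sup>+t. ennreal (p t / t) * indicator {r..s} t \<partial>lborel)"
    proof (rule nn_integral_cong)
      fix t :: real
      show "(\<integral>\<^sup>+c. ennreal (g t c) * indicator {r..s} t \<partial>\<tau>) = ennreal (p t / t) * indicator {r..s} t"
      proof (cases "t \<in> {r..s}")
        case True
        then have t: "0 < t" using r by simp
        have "(\<integral>\<^sup>+c. ennreal (g t c) \<partial>\<tau>) = ennreal (\<integral>c. g t c \<partial>\<tau>)"
        proof (rule nn_integral_eq_integral)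
          show "integrable \<tau> (\<lambda>c. g t c)" unfolding g_def by (rule int[OF t])
          show "AE c in \<tau>. 0 \<le> g t c" using good by eventually_elim (rule gnn, use t in simp)
        qed
        then show ?thesis using True rep[OF t] by (simp add: g_def)
      qed simp
    qed
    also have "\<dots> = ennreal (ln (f r) - ln (f s))" by (simp add: ftc1)
    finally have nn: "(\<integral>\<^sup>+c. ennreal (\<Lambda> s c - \<Lambda> r c) \<partial>\<tau>) = ennreal (ln (f r) - ln (f s))" .
    show i: "integrable \<tau> (\<lambda>c. \<Lambda> s c - \<Lambda> r c)"
      by (rule integrableI_nonneg[OF _ ae]) (auto simp: nn)
    have "0 \<le> ln (f r) - ln (f s)"
    proof -
      have "- ln (f r) \<le> - ln (f s)"
      proof (rule DERIV_nonneg_imp_nondecreasing[OF r(2)])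
        fix t assume t: "r \<le> t" "t \<le> s"
        then have t0: "0 < t" using r by simp
        have "((\<lambda>t. - ln (f t)) has_real_derivative - ((- (p t / t * f t)) / f t)) (at t)"
          using f_pos[of t] t0 by (auto intro!: derivative_eq_intros f_has_derivative simp: divide_inverse mult.commute)
        then show "\<exists>y. ((\<lambda>t. - ln (f t)) has_real_derivative y) (at t) \<and> 0 \<le> y"
          using f_pos[of t] p_nonneg[of t] t0 by (intro exI[of _ "p t / t"]) auto
      qed
      then show ?thesis by simp
    qed
    then show "(\<integral>c. \<Lambda> s c - \<Lambda> r c \<partial>\<tau>) = ln (f r) - ln (f s)"
      using nn nn_integral_eq_integral[OF i ae] integral_nonneg_AE[OF ae] by simp
  qed
  have lim: "integrable \<tau> (\<Lambda> s)" "(\<integral>c. \<Lambda> s c \<partial>\<tau>) = - ln (f s)" if s: "0 < s" for s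
  proof -
    define e where "e n = s * inverse (real (Suc n))" for n
    have e: "0 < e n" "e n \<le> s" for n using s by (auto simp: e_def field_simps)
    have e_dec: "e n \<le> e m" if "m \<le> n" for m n using that s by (simp add: e_def field_simps)
    have e0: "e \<longlonglongrightarrow> 0" unfolding e_def using tendsto_mult_right_zero[OF LIMSEQ_inverse_real_of_nat, of s] by simp
    define k where "k n c = \<Lambda> s c - \<Lambda> (e n) c" for n c
    have 0: "integrable \<tau> (k n)" for n unfolding k_def[abs_def] by (rule diff[OF e])
    have 1: "AE c in \<tau>. mono (\<lambda>n. k n c)"
    proof -
      have "AE c in \<tau>. \<forall>n. 0 \<le> \<Lambda> (e n) c - \<Lambda> (e (Suc n)) c"
        unfolding AE_all_countable using diffnn[OF e(1) e_dec] by auto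
      then show ?thesis by eventually_elim (auto simp: k_def mono_iff_le_Suc)
    qed
    have 2: "AE c in \<tau>. (\<lambda>n. k n c) \<longlonglongrightarrow> \<Lambda> s c"
      using good
    proof eventually_elim
      case (elim c)
      have "(\<lambda>n. \<Lambda> (e n) c) \<longlonglongrightarrow> 0"
      proof (cases "c = 1 \<or> h c = 0")
        case True
        have "(\<lambda>n. h c * e n / 4) \<longlonglongrightarrow> h c * 0 / 4" by (intro tendsto_intros e0) simp
        then show ?thesis using True by (cases "c = 1") (auto simp: \<Lambda>_def)
      next
        case False
        then have c: "- 1 < c" "c \<noteq> 1" using elim by auto
        have "(\<lambda>n. h c * ln (1 + e n * (1 - c) / (1 + c)) / ((1 + c) * (1 - c))) \<longlonglongrightarrow> h c * ln (1 + 0 * (1 - c) / (1 + c)) / ((1 + c) * (1 - c))"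
          by (intro tendsto_intros e0) (use c in auto)
        then show ?thesis using c by (simp add: \<Lambda>_def)
      qed
      from tendsto_diff[OF tendsto_const[of "\<Lambda> s c"] this] show ?case by (simp add: k_def)
    qed
    have 3: "(\<lambda>n. \<integral>c. k n c \<partial>\<tau>) \<longlonglongrightarrow> - ln (f s)"
    proof -
      have "(\<lambda>n. ln (f (e n)) - ln (f s)) \<longlonglongrightarrow> ln 1 - ln (f s)"
        by (intro tendsto_intros f_tendsto_1 e0) (use e less_imp_le in auto)
      then show ?thesis by (simp add: k_def diff[OF e])
    qed
    show "integrable \<tau> (\<Lambda> s)" by (rule integrable_monotone_convergence[OF 0 1 2 3]) measurable
    show "(\<integral>c. \<Lambda> s c \<partial>\<tau>) = - ln (f s)" by (rule integral_monotone_convergence[OF 0 1 2 3]) measurable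
  qed
  show ?thesis
    by (rule that[OF tau hm h h0]) (use lim in \<open>simp_all add: \<Lambda>_def[abs_def]\<close>)
qed

end

text \<open>At t = 1 / u this bounds the tail condition on the Thorin measure by the logarithmic
  integral at s = 1.\<close>

lemma half_le_ln_one_plus:
  assumes "0 \<le> t" "t \<le> (1::real)"
  shows "t / 2 \<le> ln (1 + t)"
proof -
  have "ln (1 / (1 + t)) \<le> 1 / (1 + t) - 1" by (rule ln_le_minus_one) (use assms in auto)
  then have "t / (1 + t) \<le> ln (1 + t)" using assms by (simp add: ln_div field_simps)
  moreover have "t / 2 \<le> t / (1 + t)" using assms by (intro divide_left_mono) auto
  ultimately show ?thesis by linarith
qed

context pos_mixture begin

text \<open>With u = (1 + c) / (1 - c) the logarithm in the representation becomes ln (1 + s / u).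
  The Thorin measure is the image of \<tau> weighted by \<open>w\<close>, and the atom of \<tau> at
  c = 1 gives the drift.\<close>

lemma GGC_laplace_of_HCM:
  assumes hcm: "log_HCM (\<lambda>r. f (exp r))"
  shows "\<exists>(a::real) (\<mu> :: real measure). 0 \<le> a \<and>
        sets \<mu> = sets (restrict_space borel {0<..}) \<and>
        (\<integral>\<^sup>+u\<in>{0<..1}. ennreal \<bar>ln u\<bar> \<partial>\<mu>) + (\<integral>\<^sup>+u\<in>{1<..}. ennreal (1 / u) \<partial>\<mu>) < \<infinity> \<and>
        (\<forall>s\<ge>0. integrable \<mu> (\<lambda>u. ln (1 + s / u)) \<and>
           f s = exp (- a * s - (\<integral>u. ln (1 + s / u) \<partial>\<mu>)))"
proof -
  obtain \<tau> h where tau: "real_distribution \<tau>" "AE c in \<tau>. c \<in> {- 1..1}" and hm[measurable]: "h \<in> borel_measurable borel"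
    and h: "\<And>c. c \<le> 1 \<Longrightarrow> 0 \<le> h c" and h0: "AE c in \<tau>. h c = 0 \<or> - 1 < c"
    and int: "\<And>s. 0 < s \<Longrightarrow> integrable \<tau> (\<lambda>c. if c = 1 then h c * s / 4 else h c * ln (1 + s * (1 - c) / (1 + c)) / ((1 + c) * (1 - c)))"
    and rep: "\<And>s. 0 < s \<Longrightarrow> - ln (f s) = (\<integral>c. (if c = 1 then h c * s / 4 else h c * ln (1 + s * (1 - c) / (1 + c)) / ((1 + c) * (1 - c))) \<partial>\<tau>)"
    by (rule neg_ln_f_representation[OF hcm]) (rule that)
  interpret tau: real_distribution \<tau> by fact
  define \<Lambda> where "\<Lambda> s c = (if c = 1 then h c * s / 4 else h c * ln (1 + s * (1 - c) / (1 + c)) / ((1 + c) * (1 - c)))" for s c :: real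
  note int = int[folded \<Lambda>_def] and rep = rep[folded \<Lambda>_def]
  \<comment> \<open>The indicator confines the mass to - 1 < c < 1, where \<open>\<kappa> c\<close>
    is positive, so restricting the image measure to the half-line loses nothing.\<close>
  define w where "w c = indicator {- 1<..<1} c * h c / ((1 + c) * (1 - c))" for c
  have wm[measurable]: "w \<in> borel_measurable borel" unfolding w_def by measurable
  have wnn: "0 \<le> w c" for c using h[of c] by (auto simp: w_def indicator_def)
  define \<kappa> where "\<kappa> c = (1 + c) / (1 - c)" for c :: real
  have \<kappa>m[measurable]: "\<kappa> \<in> borel_measurable borel" unfolding \<kappa>_def by measurable
  have \<kappa>: "0 < \<kappa> c" if "- 1 < c" "c < 1" for c using that by (simp add: \<kappa>_def)
  define \<mu> where "\<mu> = restrict_space (distr (density \<tau> (\<lambda>c. ennreal (w c))) borel \<kappa>) {0<..}"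
  define a where "a = h 1 * measure \<tau> {1} / 4"
  have a: "0 \<le> a" using h[of 1] by (simp add: a_def)
  have sets: "sets \<mu> = sets (restrict_space borel {0<..})"
    unfolding \<mu>_def by (rule sets_restrict_space_cong) simp
  have space: "space \<mu> = {0<..}" using sets_eq_imp_space_eq[OF sets] by (simp add: space_restrict_space)
  have meas: "g \<in> borel_measurable \<mu>" if "g \<in> borel_measurable borel" for g :: "real \<Rightarrow> real"
    unfolding measurable_cong_sets[OF sets refl] using that by (rule measurable_restrict_space1)
  have nnmu: "(\<integral>\<^sup>+u. ennreal (g u) \<partial>\<mu>) = (\<integral>\<^sup>+c. ennreal (w c) * (ennreal (g (\<kappa> c)) * indicator {0<..} (\<kappa> c)) \<partial>\<tau>)"
    if [measurable]: "g \<in> borel_measurable borel" for g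
    unfolding \<mu>_def
    by (subst nn_integral_restrict_space, simp, subst nn_integral_distr, simp, simp, subst nn_integral_density) auto
  have aew: "AE c in \<tau>. \<Lambda> s c = w c * ln (1 + s / \<kappa> c) + h 1 * s / 4 * indicator {1} c" for s
    using tau(2) h0
  proof eventually_elim
    case (elim c)
    consider "c = 1" | "c \<noteq> 1" "h c = 0" | "- 1 < c" "c < 1" using elim by fastforce
    then show ?case
    proof cases
      case 3
      have "s / \<kappa> c = s * (1 - c) / (1 + c)" by (simp add: \<kappa>_def)
      then show ?thesis using 3 by (simp add: \<Lambda>_def w_def)
    qed (auto simp: \<Lambda>_def w_def)
  qed
  have wln: "0 \<le> w c * ln (1 + s / \<kappa> c)" if s: "0 \<le> s" for s c
  proof (cases "- 1 < c \<and> c < 1")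
    case True
    then have "0 \<le> s / \<kappa> c" using \<kappa>[of c] s by simp
    then show ?thesis using wnn[of c] by (intro mult_nonneg_nonneg ln_ge_zero) auto
  qed (auto simp: w_def)
  have wint: "integrable \<tau> (\<lambda>c. w c * ln (1 + s / \<kappa> c))"
    and wval: "(\<integral>c. w c * ln (1 + s / \<kappa> c) \<partial>\<tau>) = - ln (f s) - a * s" if s: "0 < s" for s
  proof -
    have ii: "integrable \<tau> (\<lambda>c. h 1 * s / 4 * indicator {1} c)"
      by (intro integrable_mult_right integrable_real_indicator) (auto simp: tau.emeasure_finite less_top[symmetric])
    have d: "integrable \<tau> (\<lambda>c. \<Lambda> s c - h 1 * s / 4 * indicator {1} c)"
      by (intro Bochner_Integration.integrable_diff int[OF s] ii)
    have ae: "AE c in \<tau>. \<Lambda> s c - h 1 * s / 4 * indicator {1} c = w c * ln (1 + s / \<kappa> c)"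
      using aew[of s] by eventually_elim simp
    have \<Lambda>m[measurable]: "\<Lambda> s \<in> borel_measurable borel" unfolding \<Lambda>_def by measurable
    show "integrable \<tau> (\<lambda>c. w c * ln (1 + s / \<kappa> c))"
      by (rule integrable_cong_AE_imp[OF d _ ae]) measurable
    have "(\<integral>c. w c * ln (1 + s / \<kappa> c) \<partial>\<tau>) = (\<integral>c. \<Lambda> s c - h 1 * s / 4 * indicator {1} c \<partial>\<tau>)"
      by (rule integral_cong_AE[symmetric, OF _ _ ae]) measurable
    also have "\<dots> = (\<integral>c. \<Lambda> s c \<partial>\<tau>) - (\<integral>c. h 1 * s / 4 * indicator {1} c \<partial>\<tau>)"
      by (rule Bochner_Integration.integral_diff[OF int[OF s] ii])
    also have "\<dots> = - ln (f s) - a * s" by (simp add: rep[OF s] a_def)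
    finally show "(\<integral>c. w c * ln (1 + s / \<kappa> c) \<partial>\<tau>) = - ln (f s) - a * s" .
  qed
  have nnln: "(\<integral>\<^sup>+u. ennreal (ln (1 + s / u)) \<partial>\<mu>) = ennreal (- ln (f s) - a * s)" if s: "0 < s" for s
  proof -
    have "(\<integral>\<^sup>+u. ennreal (ln (1 + s / u)) \<partial>\<mu>) = (\<integral>\<^sup>+c. ennreal (w c) * (ennreal (ln (1 + s / \<kappa> c)) * indicator {0<..} (\<kappa> c)) \<partial>\<tau>)"
      by (rule nnmu) measurable
    also have "\<dots> = (\<integral>\<^sup>+c. ennreal (w c * ln (1 + s / \<kappa> c)) \<partial>\<tau>)"
    proof (rule nn_integral_cong)
      fix c
      show "ennreal (w c) * (ennreal (ln (1 + s / \<kappa> c)) * indicator {0<..} (\<kappa> c)) = ennreal (w c * ln (1 + s / \<kappa> c))"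
      proof (cases "- 1 < c \<and> c < 1")
        case True
        then show ?thesis using \<kappa>[of c] by (simp add: ennreal_mult'[OF wnn])
      qed (auto simp: w_def)
    qed
    also have "\<dots> = ennreal (\<integral>c. w c * ln (1 + s / \<kappa> c) \<partial>\<tau>)"
      by (rule nn_integral_eq_integral[OF wint[OF s]]) (use wln s in auto)
    finally show ?thesis by (simp only: wval[OF s])
  qed
  have lnn: "0 \<le> ln (1 + s / u)" if "u \<in> space \<mu>" "0 \<le> s" for s u
    using that space by simp
  have main: "integrable \<mu> (\<lambda>u. ln (1 + s / u)) \<and> f s = exp (- a * s - (\<integral>u. ln (1 + s / u) \<partial>\<mu>))" if s: "0 \<le> s" for s
  proof (cases "s = 0")
    case True
    then show ?thesis by (simp add: f_def prob_space)
  next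
    case False
    then have s: "0 < s" using s by simp
    have ae: "AE u in \<mu>. 0 \<le> ln (1 + s / u)" using lnn s by (intro AE_I2) simp
    have m: "(\<lambda>u. ln (1 + s / u)) \<in> borel_measurable \<mu>" by (rule meas) measurable
    have i: "integrable \<mu> (\<lambda>u. ln (1 + s / u))"
      by (rule integrableI_nonneg[OF m ae]) (simp add: nnln[OF s])
    have "ennreal (\<integral>u. ln (1 + s / u) \<partial>\<mu>) = ennreal (- ln (f s) - a * s)"
      using nn_integral_eq_integral[OF i ae] nnln[OF s] by simp
    moreover have "0 \<le> - ln (f s) - a * s"
      unfolding wval[OF s, symmetric] by (rule Bochner_Integration.integral_nonneg) (use wln s in auto)
    ultimately have "(\<integral>u. ln (1 + s / u) \<partial>\<mu>) = - ln (f s) - a * s"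
      using integral_nonneg_AE[OF ae] by simp
    then show ?thesis using i f_pos[of s] s by simp
  qed
  \<comment> \<open>Both conditions follow from the logarithmic integral at s = 1: |ln u| \<le> ln
    (1 + 1 / u) for u \<le> 1, and 1 / u \<le> 2 ln (1 + 1 / u) for u > 1.\<close>
  have fin: "(\<integral>\<^sup>+u\<in>{0<..1}. ennreal \<bar>ln u\<bar> \<partial>\<mu>) + (\<integral>\<^sup>+u\<in>{1<..}. ennreal (1 / u) \<partial>\<mu>) < \<infinity>"
  proof -
    have m: "(\<lambda>u. ennreal (g u) * indicator S u) \<in> borel_measurable \<mu>" if "g \<in> borel_measurable borel" "S \<in> sets borel" for g S
    proof -
      note [measurable] = that
      show ?thesis unfolding measurable_cong_sets[OF sets refl] by (intro measurable_restrict_space1) measurable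
    qed
    have "(\<integral>\<^sup>+u\<in>{0<..1}. ennreal \<bar>ln u\<bar> \<partial>\<mu>) + (\<integral>\<^sup>+u\<in>{1<..}. ennreal (1 / u) \<partial>\<mu>) =
      (\<integral>\<^sup>+u. ennreal \<bar>ln u\<bar> * indicator {0<..1} u + ennreal (1 / u) * indicator {1<..} u \<partial>\<mu>)"
      by (rule nn_integral_add[symmetric]; rule m) measurable
    also have "\<dots> \<le> (\<integral>\<^sup>+u. 2 * ennreal (ln (1 + 1 / u)) \<partial>\<mu>)"
    proof (rule nn_integral_mono)
      fix u assume "u \<in> space \<mu>"
      then have u: "0 < u" using space by simp
      have two: "2 * ennreal (ln (1 + 1 / u)) = ennreal (2 * ln (1 + 1 / u))"
        using u by (simp add: ennreal_mult)
      show "ennreal \<bar>ln u\<bar> * indicator {0<..1} u + ennreal (1 / u) * indicator {1<..} u \<le> 2 * ennreal (ln (1 + 1 / u))"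
      proof (cases "u \<le> 1")
        case True
        have "ln (inverse u) \<le> ln (1 + 1 / u)"
          using u by (subst ln_le_cancel_iff) (auto simp: inverse_eq_divide intro: add_pos_pos)
        then have "- ln u \<le> ln (1 + 1 / u)" using u by (simp only: ln_inverse)
        moreover have "0 \<le> ln (1 + 1 / u)" "ln u \<le> 0" using u True by auto
        ultimately have "\<bar>ln u\<bar> \<le> 2 * ln (1 + 1 / u)" by linarith
        then show ?thesis using u True unfolding two by (simp add: ennreal_leI)
      next
        case False
        then have "1 / u \<le> 2 * ln (1 + 1 / u)" using half_le_ln_one_plus[of "1 / u"] u by simp
        then show ?thesis using u False unfolding two by (simp add: ennreal_leI)
      qed
    qed
    also have "\<dots> = 2 * (\<integral>\<^sup>+u. ennreal (ln (1 + 1 / u)) \<partial>\<mu>)"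
      using meas[of "\<lambda>u. ln (1 + 1 / u)"] by (intro nn_integral_cmult) simp
    also have "\<dots> < \<infinity>" using nnln[of 1] by (simp add: ennreal_mult_less_top)
    finally show ?thesis .
  qed
  show ?thesis using a sets fin main by blast
qed

end

section \<open>The three properties of the product\<close>

lemma laplace_mult_exponential_positive:
  fixes A E X :: "'a \<Rightarrow> real"
  assumes M: "prob_space M" and A[measurable]: "A \<in> borel_measurable M" and pos: "AE \<omega> in M. 0 < A \<omega>" and l: "0 < l"
    and E: "distributed M lborel E (exponential_density l)"
    and ind: "prob_space.indep_var M borel A borel E"
    and X: "\<And>\<omega>. \<omega> \<in> space M \<Longrightarrow> X \<omega> = A \<omega> * E \<omega>"
  obtains A' where "A' \<in> borel_measurable M" "\<And>\<omega>. 0 < A' \<omega>" "AE \<omega> in M. A' \<omega> = A \<omega>"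
    "\<And>s. 0 \<le> s \<Longrightarrow> (\<integral>\<omega>. exp (- s * X \<omega>) \<partial>M) = (\<integral>\<omega>. l / (l + s * A' \<omega>) \<partial>M)"
proof -
  \<comment> \<open>A version of A positive at every sample point, as the lemmas on mixtures
    require; the value 1 on the null set is arbitrary.\<close>
  define A' where "A' \<omega> = (if 0 < A \<omega> then A \<omega> else 1)" for \<omega>
  have A'm[measurable]: "A' \<in> borel_measurable M" unfolding A'_def by measurable
  have AA': "AE \<omega> in M. A' \<omega> = A \<omega>" using pos by eventually_elim (simp add: A'_def)
  show ?thesis
  proof (rule that[OF A'm _ AA'])
    show "0 < A' \<omega>" for \<omega> by (simp add: A'_def)
    fix s :: real assume s: "0 \<le> s"
    have "(\<integral>\<omega>. exp (- s * X \<omega>) \<partial>M) = (\<integral>\<omega>. exp (- s * (A \<omega> * E \<omega>)) \<partial>M)"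
      by (rule Bochner_Integration.integral_cong) (auto simp: X)
    also have "\<dots> = (\<integral>\<omega>. l / (l + s * A \<omega>) \<partial>M)"
      by (rule laplace_mult_exponential[OF M A l E ind pos s])
    also have "\<dots> = (\<integral>\<omega>. l / (l + s * A' \<omega>) \<partial>M)"
    proof (rule integral_cong_AE)
      show "AE \<omega> in M. l / (l + s * A \<omega>) = l / (l + s * A' \<omega>)" using AA' by eventually_elim simp
    qed measurable
    finally show "(\<integral>\<omega>. exp (- s * X \<omega>) \<partial>M) = (\<integral>\<omega>. l / (l + s * A' \<omega>) \<partial>M)" .
  qed
qed

lemma GGC_rv_mult_exponential:
  fixes A E X :: "'a \<Rightarrow> real"
  assumes M: "prob_space M" and A[measurable]: "A \<in> borel_measurable M" and pos: "AE \<omega> in M. 0 < A \<omega>" and l: "0 < l"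
    and E: "distributed M lborel E (exponential_density l)"
    and ind: "prob_space.indep_var M borel A borel E"
    and X: "\<And>\<omega>. \<omega> \<in> space M \<Longrightarrow> X \<omega> = A \<omega> * E \<omega>" and Xnn: "nonneg_random_variable M X"
    and ggc: "GGC_rv M A"
  shows "GGC_rv M X"
proof -
  interpret prob_space M by fact
  obtain A' where A'm[measurable]: "A' \<in> borel_measurable M" and A'pos: "\<And>\<omega>. 0 < A' \<omega>" and AA': "AE \<omega> in M. A' \<omega> = A \<omega>"
    and Xf: "\<And>s. 0 \<le> s \<Longrightarrow> (\<integral>\<omega>. exp (- s * X \<omega>) \<partial>M) = (\<integral>\<omega>. l / (l + s * A' \<omega>) \<partial>M)"
    by (rule laplace_mult_exponential_positive[OF M A pos l E ind X]) (assumption, rule that)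
  from ggc obtain a and \<mu> :: "real measure" where a: "0 \<le> a" and sets: "sets \<mu> = sets (restrict_space borel {0<..})"
    and int: "\<And>s. 0 \<le> s \<Longrightarrow> integrable \<mu> (\<lambda>u. ln (1 + s / u))"
    and lap: "\<And>s. 0 \<le> s \<Longrightarrow> (\<integral>\<omega>. exp (- s * A \<omega>) \<partial>M) = exp (- a * s - (\<integral>u. ln (1 + s / u) \<partial>\<mu>))"
    unfolding GGC_rv_def by blast
  have "(\<integral>\<omega>. exp (- exp r * A' \<omega>) \<partial>M) = exp (- a * exp r - (\<integral>u. ln (1 + exp r / u) \<partial>\<mu>))" for r
  proof -
    have "(\<integral>\<omega>. exp (- exp r * A' \<omega>) \<partial>M) = (\<integral>\<omega>. exp (- exp r * A \<omega>) \<partial>M)"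
    proof (rule integral_cong_AE)
      show "AE \<omega> in M. exp (- exp r * A' \<omega>) = exp (- exp r * A \<omega>)" using AA' by eventually_elim simp
    qed measurable
    then show ?thesis using lap[of "exp r"] by simp
  qed
  then have "log_HCM (\<lambda>r. \<integral>\<omega>. exp (- exp r * A' \<omega>) \<partial>M)"
    using log_HCM_GGC_laplace[OF a sets int] by simp
  then have hcm: "log_HCM (\<lambda>r. \<integral>\<omega>. l / (l + exp r * A' \<omega>) \<partial>M)"
    by (intro log_HCM_exponential_mixture[OF M _ A'pos l]) auto
  \<comment> \<open>Dividing by l brings l / (l + s A') to the form 1 / (1 + s B) of the
    locale.\<close>
  interpret B: pos_mixture M "\<lambda>\<omega>. A' \<omega> / l"
    by unfold_locales (use A'pos l in auto)
  have eq: "l / (l + s * A' \<omega>) = 1 / (1 + s * (A' \<omega> / l))" for s \<omega> using l by (simp add: field_simps)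
  have Bf: "B.f s = (\<integral>\<omega>. l / (l + s * A' \<omega>) \<partial>M)" for s unfolding B.f_def eq ..
  show ?thesis
    unfolding GGC_rv_def using Xnn B.GGC_laplace_of_HCM[unfolded Bf, OF hcm] Xf by (simp add: Bf)
qed

lemma infinitely_divisible_mult_exponential:
  fixes A E X :: "'a \<Rightarrow> real"
  assumes M: "prob_space M" and A[measurable]: "A \<in> borel_measurable M" and pos: "AE \<omega> in M. 0 < A \<omega>" and l: "0 < l"
    and E: "distributed M lborel E (exponential_density l)"
    and ind: "prob_space.indep_var M borel A borel E"
    and X: "\<And>\<omega>. \<omega> \<in> space M \<Longrightarrow> X \<omega> = A \<omega> * E \<omega>" and Xnn: "nonneg_random_variable M X"
  shows "infinitely_divisible_rv M X"
proof (rule infinitely_divisible_rvI[OF M])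
  interpret prob_space M by fact
  show "X \<in> borel_measurable M" "AE \<omega> in M. 0 \<le> X \<omega>" using Xnn by (auto simp: nonneg_random_variable_def)
  obtain A' where A'm[measurable]: "A' \<in> borel_measurable M" and A'pos: "\<And>\<omega>. 0 < A' \<omega>" and AA': "AE \<omega> in M. A' \<omega> = A \<omega>"
    and Xf: "\<And>s. 0 \<le> s \<Longrightarrow> (\<integral>\<omega>. exp (- s * X \<omega>) \<partial>M) = (\<integral>\<omega>. l / (l + s * A' \<omega>) \<partial>M)"
    by (rule laplace_mult_exponential_positive[OF M A pos l E ind X]) (assumption, rule that)
  define \<phi> where "\<phi> s = (\<integral>\<omega>. l / (l + s * A' \<omega>) \<partial>M)" for s
  fix n :: nat assume n: "1 \<le> n"
  have "compl_mono (\<lambda>s. \<phi> s powr (1 / real n))"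
    unfolding \<phi>_def by (rule compl_mono_powr_exponential_mixture[OF M _ A'pos l]) (use n in auto)
  moreover have "(\<phi> s powr (1 / real n)) ^ n = (\<integral>\<omega>. exp (- s * X \<omega>) \<partial>M)" if s: "0 \<le> s" for s
  proof -
    have "0 \<le> \<phi> s" unfolding \<phi>_def
      by (rule Bochner_Integration.integral_nonneg) (use s l A'pos in \<open>auto simp: less_imp_le\<close>)
    then have "(\<phi> s powr (1 / real n)) ^ n = \<phi> s"
      using n by (cases "\<phi> s = 0") (auto simp: powr_powr simp flip: powr_realpow)
    then show ?thesis by (simp only: Xf[OF s] \<phi>_def)
  qed
  ultimately show "\<exists>\<psi>. compl_mono \<psi> \<and> (\<forall>s\<ge>0. \<psi> s ^ n = (\<integral>\<omega>. exp (- s * X \<omega>) \<partial>M))" by blast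
qed

lemma nonneg_random_variable_mult_exponential:
  fixes A E X :: "'a \<Rightarrow> real"
  assumes M: "prob_space M" and A[measurable]: "A \<in> borel_measurable M" and pos: "AE \<omega> in M. 0 < A \<omega>"
    and E: "distributed M lborel E (exponential_density l)"
    and X: "\<And>\<omega>. \<omega> \<in> space M \<Longrightarrow> X \<omega> = A \<omega> * E \<omega>"
  shows "nonneg_random_variable M X"
proof -
  have Em[measurable]: "E \<in> borel_measurable M" using distributed_measurable[OF E] by simp
  have Xm: "X \<in> borel_measurable M"
    using X by (subst measurable_cong[where g="\<lambda>\<omega>. A \<omega> * E \<omega>"]) auto
  have dE: "distr M lborel E = density lborel (exponential_density l)"
    by (rule distributed_distr_eq_density[OF E])
  have "AE y in distr M lborel E. 0 \<le> y"
    unfolding dE by (subst AE_density) (auto simp: exponential_density_def)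
  then have "AE \<omega> in M. 0 \<le> E \<omega>" by (subst (asm) AE_distr_iff) auto
  with pos AE_space have "AE \<omega> in M. 0 \<le> X \<omega>" by eventually_elim (simp add: X)
  then show ?thesis using Xm by (simp add: nonneg_random_variable_def)
qed

theorem mainTheorem4:
  fixes M :: "'a measure" and A E X :: "'a \<Rightarrow> real" and l :: real
  assumes "prob_space M"
    and "A \<in> borel_measurable M"
    and "AE \<omega> in M. 0 < A \<omega>"
    and "0 < l"
    and "distributed M lborel E (exponential_density l)"
    and "prob_space.indep_var M borel A borel E"
    and "\<And>\<omega>. \<omega> \<in> space M \<Longrightarrow> X \<omega> = A \<omega> * E \<omega>"
  shows "infinitely_divisible_rv M X
    \<and> (GGC_rv M A \<longrightarrow> GGC_rv M X)
    \<and> (HCM_rv M A \<longrightarrow> HCM_rv M X)"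
proof (intro conjI impI)
  note X = nonneg_random_variable_mult_exponential[OF assms(1-3,5,7)]
  show "infinitely_divisible_rv M X"
    by (rule infinitely_divisible_mult_exponential[OF assms X])
  show "GGC_rv M X" if "GGC_rv M A"
    by (rule GGC_rv_mult_exponential[OF assms X that])
  show "HCM_rv M X" if "HCM_rv M A"
    by (rule HCM_rv_mult_exponential[OF assms(1,2,4-7) that])
qed

end
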